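(* Let $(Q_N)$ be a sequence of radially symmetric potentials defining an almost-circular ensemble (as described in the context), with parameter $\rho=\lim_{N\to\infty}\sqrt{N/\Delta Q_N(1)}>0$ and droplets $S_{Q_N}=\{\zeta\in\mathbb{C}:r_N\le|\zeta|\le1\}$. Let $\{\zeta_j\}_1^N$ be a random sample from the Gibbs measure associated with $Q_N$ (at $\beta=1$). Put $p_N=(r_N+1)/2$, fix $\theta\in[0,2\pi]$, let $p_{N,\theta}=p_N\,e^{i\theta}$, and rescale by $$z_j=-i\,e^{-i\theta}\sqrt{N\Delta Q_N(p_{N,\theta})}\,(\zeta_j-p_{N,\theta}),\qquad j=1,\dots,N.$$ Let $R_N$ be the $1$-point function of the rescaled system $\{z_j\}_1^N$. Then, as $N\to\infty$, $R_N$ converges locally uniformly on $\mathbb{C}$ to the limit $R(z)=F(2\operatorname{Im}z)$, where $$F(z)=\frac1{\sqrt{2\pi}}\int_{-2a}^{2a}e^{-\frac12(z-t)^2}\,dt,\qquad a=\rho/4.$$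
   Context: $dA(\zeta)=\tfrac1\pi\,d\xi\,d\eta$ ($\zeta=\xi+i\eta$) is normalized Lebesgue measure on $\mathbb{C}$, $dA_N=(dA)^{\otimes N}$, and $\Delta=\tfrac14\left(\frac{\partial^2}{\partial\xi^2}+\frac{\partial^2}{\partial\eta^2}\right)$ (one quarter of the usual Laplacian). For a potential $Q_N$ put $H_N=\sum_{j\ne k}\log\frac1{|\zeta_j-\zeta_k|}+N\sum_{j=1}^NQ_N(\zeta_j)$; the Gibbs measure at $\beta=1$ is $d\mathbf{P}_N=\frac1{Z_N}e^{-H_N}\,dA_N$ on $\mathbb{C}^N$. The $1$-point function of a random system $\{z_j\}_1^N$ is $\lim_{\varepsilon\to0}\varepsilon^{-2}\,\mathbf{E}[\#(\{z_j\}_1^N\cap D(z,\varepsilon))]$, with $D(z,\varepsilon)$ the open disc with center $z$ and radius $\varepsilon$. External potentials: all potentials $W$ are lower semicontinuous functions $\mathbb{C}\to\mathbb{R}\cup\{+\infty\}$, finite on some set of positive capacity, with $\liminf_{\zeta\to\infty}\frac{W(\zeta)}{2\log|\zeta|}\ge k$ for a constant $k>1$ (the same for all $N$). The droplet $S_W$ is the support of the unique compactly supported Borel probability measure minimizing $\mu\mapsto\iint\log\frac1{|\zeta-\eta|}\,d\mu(\zeta)\,d\mu(\eta)+\int W\,d\mu$. Almost-circular ensembles: $Q_N(\zeta)=g_N(|\zeta|)$, where $g_N:\mathbb{R}_+\to\mathbb{R}$ is differentiable on $\mathbb{R}_+$ with absolutely continuous derivative, normalized so that $g_N(1)=0$ and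 $g_N'(1)=2$. It is assumed that $Q_N$ is subharmonic in $\mathbb{C}$ and strictly subharmonic in a neighbourhood of the unit circle. Then the droplet is the annulus $S_{Q_N}=\{r_N\le|\zeta|\le1\}$, where $r_N$ is the unique constant satisfying $r_Ng_N'(r_N)=0$. It is assumed that the limit $\rho=\lim_{N\to\infty}\sqrt{N/\Delta Q_N(1)}$ exists and is strictly positive; as part of the set-up, $r_N=1-\frac{\rho^2}{2N}+o(\frac1N)$ as $N\to\infty$.
   Formalization: Q_N is required to be subharmonic only off the origin; g_N' is assumed differentiable at 1 and p_N; and it is assumed that, for each C, ΔQ_N(s)/ΔQ_N(1) → 1 uniformly for a.e. s with |s−1| ≤ C/N, without which the claim fails. *)

theory Defs
  imports "HOL-Probability.Probability"
begin

section \<open>Normalized area and Laplacian\<close>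

definition area :: "complex measure" where
  "area = density lborel (\<lambda>_. ennreal (1 / pi))"

(* Points of C^N are the functions extensional on {..<N}. *)
definition area_power :: "nat \<Rightarrow> (nat \<Rightarrow> complex) measure" where
  "area_power N = PiM {..<N} (\<lambda>_. area)"

(* One quarter of the usual Laplacian.  Potentials take values in the extended reals; the value is
   only meaningful at points near which W is finite and where the derivatives exist. *)
definition laplacian :: "(complex \<Rightarrow> ereal) \<Rightarrow> complex \<Rightarrow> real" where
  "laplacian W z =
     (deriv (deriv (\<lambda>x. real_of_ereal (W (Complex x (Im z))))) (Re z)
    + deriv (deriv (\<lambda>y. real_of_ereal (W (Complex (Re z) y)))) (Im z)) / 4"


section \<open>Logarithmic potential theory\<close>

definition log_kernel :: "complex \<Rightarrow> complex \<Rightarrow> ereal" where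
  "log_kernel z w = (if z = w then \<infinity> else ereal (ln (1 / cmod (z - w))))"

(* Integral of an extended real function whose negative part has finite integral; this is the case
   for the kernel and for potentials against compactly supported probability measures, since these
   functions are bounded below on compact sets. *)
definition ereal_integral :: "'a measure \<Rightarrow> ('a \<Rightarrow> ereal) \<Rightarrow> ereal" where
  "ereal_integral M f =
     enn2ereal (\<integral>\<^sup>+ x. e2ennreal (f x) \<partial>M) - enn2ereal (\<integral>\<^sup>+ x. e2ennreal (- f x) \<partial>M)"

definition log_energy :: "complex measure \<Rightarrow> ereal" where
  "log_energy \<mu> = ereal_integral (\<mu> \<Otimes>\<^sub>M \<mu>) (\<lambda>(z, w). log_kernel z w)"

definition weighted_energy :: "(complex \<Rightarrow> ereal) \<Rightarrow> complex measure \<Rightarrow> ereal" where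
  "weighted_energy W \<mu> = log_energy \<mu> + ereal_integral \<mu> W"

definition borel_prob_on :: "complex set \<Rightarrow> complex measure \<Rightarrow> bool" where
  "borel_prob_on K \<mu> \<longleftrightarrow> sets \<mu> = sets borel \<and> prob_space \<mu> \<and> emeasure \<mu> (- K) = 0"

definition compact_borel_prob :: "complex measure \<Rightarrow> bool" where
  "compact_borel_prob \<mu> \<longleftrightarrow> (\<exists>K. compact K \<and> borel_prob_on K \<mu>)"

definition positive_capacity :: "complex set \<Rightarrow> bool" where
  "positive_capacity E \<longleftrightarrow>
     (\<exists>K \<mu>. compact K \<and> K \<subseteq> E \<and> borel_prob_on K \<mu> \<and> log_energy \<mu> < \<infinity>)"

definition external_potential :: "real \<Rightarrow> (complex \<Rightarrow> ereal) \<Rightarrow> bool" where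
  "external_potential k W \<longleftrightarrow>
     (\<forall>z. W z \<noteq> -\<infinity>) \<and>
     (\<forall>c. open {z. c < W z}) \<and>
     positive_capacity {z. W z < \<infinity>} \<and>
     ereal k \<le> Liminf at_infinity (\<lambda>z. W z / ereal (2 * ln (cmod z)))"

definition equilibrium_measure :: "(complex \<Rightarrow> ereal) \<Rightarrow> complex measure \<Rightarrow> bool" where
  "equilibrium_measure W \<mu> \<longleftrightarrow>
     compact_borel_prob \<mu> \<and>
     (\<forall>\<nu>. compact_borel_prob \<nu> \<longrightarrow> weighted_energy W \<mu> \<le> weighted_energy W \<nu>)"

definition measure_support :: "complex measure \<Rightarrow> complex set" where
  "measure_support \<mu> = {z. \<forall>U. open U \<and> z \<in> U \<longrightarrow> emeasure \<mu> U > 0}"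

definition droplet :: "(complex \<Rightarrow> ereal) \<Rightarrow> complex set" where
  "droplet W = measure_support (THE \<mu>. equilibrium_measure W \<mu>)"

(* Finite-valued subharmonic functions only. *)
definition subharmonic_on :: "complex set \<Rightarrow> (complex \<Rightarrow> real) \<Rightarrow> bool" where
  "subharmonic_on D u \<longleftrightarrow>
     open D \<and> (\<forall>c. open {z \<in> D. u z < c}) \<and>
     (\<forall>z r. 0 < r \<and> cball z r \<subseteq> D \<longrightarrow>
        (\<lambda>t. u (z + of_real r * cis t)) absolutely_integrable_on {0..2 * pi} \<and>
        u z \<le> 1 / (2 * pi) * integral {0..2 * pi} (\<lambda>t. u (z + of_real r * cis t)))"

(* Locally, the Laplacian (as a measure) is bounded below by a positive multiple of area.
   For C^2 functions this says that the Laplacian is positive on D. *)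
definition strictly_subharmonic_on :: "complex set \<Rightarrow> (complex \<Rightarrow> real) \<Rightarrow> bool" where
  "strictly_subharmonic_on D u \<longleftrightarrow>
     open D \<and>
     (\<forall>z\<in>D. \<exists>c>0. \<exists>d>0. ball z d \<subseteq> D \<and> subharmonic_on (ball z d) (\<lambda>w. u w - c * (cmod w)\<^sup>2))"


section \<open>Gibbs measure and one-point function\<close>

definition exp_minus :: "ereal \<Rightarrow> ennreal" where
  "exp_minus x = (case x of ereal t \<Rightarrow> ennreal (exp (- t)) | PInfty \<Rightarrow> 0 | MInfty \<Rightarrow> \<infinity>)"

definition hamiltonian :: "nat \<Rightarrow> (complex \<Rightarrow> ereal) \<Rightarrow> (nat \<Rightarrow> complex) \<Rightarrow> ereal" where
  "hamiltonian N W \<zeta> =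
     (\<Sum>j<N. \<Sum>k\<in>{..<N} - {j}. log_kernel (\<zeta> j) (\<zeta> k)) + ereal (real N) * (\<Sum>j<N. W (\<zeta> j))"

definition partition_function :: "nat \<Rightarrow> (complex \<Rightarrow> ereal) \<Rightarrow> ennreal" where
  "partition_function N W = (\<integral>\<^sup>+ \<zeta>. exp_minus (hamiltonian N W \<zeta>) \<partial>area_power N)"

definition gibbs :: "nat \<Rightarrow> (complex \<Rightarrow> ereal) \<Rightarrow> (nat \<Rightarrow> complex) measure" where
  "gibbs N W =
     density (area_power N) (\<lambda>\<zeta>. exp_minus (hamiltonian N W \<zeta>) / partition_function N W)"

(* For a random system z 0, ..., z (N - 1) on the probability space M. *)
definition scaled_mean_count ::
    "'a measure \<Rightarrow> nat \<Rightarrow> (nat \<Rightarrow> 'a \<Rightarrow> complex) \<Rightarrow> complex \<Rightarrow> real \<Rightarrow> real" where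
  "scaled_mean_count M N z w \<epsilon> =
     integral\<^sup>L M (\<lambda>\<omega>. real (card {j. j < N \<and> z j \<omega> \<in> ball w \<epsilon>})) / \<epsilon>\<^sup>2"

definition one_point_function ::
    "'a measure \<Rightarrow> nat \<Rightarrow> (nat \<Rightarrow> 'a \<Rightarrow> complex) \<Rightarrow> complex \<Rightarrow> real" where
  "one_point_function M N z w = Lim (at_right 0) (scaled_mean_count M N z w)"


section \<open>Almost-circular ensembles\<close>

definition abs_continuous_on_interval :: "real \<Rightarrow> real \<Rightarrow> (real \<Rightarrow> real) \<Rightarrow> bool" where
  "abs_continuous_on_interval a b f \<longleftrightarrow>
     (\<forall>\<epsilon>>0. \<exists>\<delta>>0. \<forall>(n::nat) u v.
        (\<forall>i<n. a \<le> u i \<and> u i \<le> v i \<and> v i \<le> b) \<and>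
        disjoint_family_on (\<lambda>i. {u i<..<v i}) {..<n} \<and>
        (\<Sum>i<n. v i - u i) < \<delta> \<longrightarrow>
        (\<Sum>i<n. \<bar>f (v i) - f (u i)\<bar>) < \<epsilon>)"

definition middle_point :: "real \<Rightarrow> real \<Rightarrow> complex" where
  "middle_point r \<theta> = of_real ((r + 1) / 2) * cis \<theta>"

(* The profile g lives on the open half-line, so W is prescribed off the origin only; W 0 may be
   infinite (as for |z|^2 - c log|z|) and is only subject to lower semicontinuity.  Subharmonicity
   is accordingly required off the origin, i.e. s * g'(s) is nondecreasing for s > 0: if W were
   subharmonic across the origin, then g' >= 0, so g'(r) = 0 would make g constant on (0, r],
   contradicting that r is the only zero of s * g'(s). *)
definition almost_circular :: "real \<Rightarrow> (complex \<Rightarrow> ereal) \<Rightarrow> (real \<Rightarrow> real) \<Rightarrow> real \<Rightarrow> bool" where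
  "almost_circular k W g r \<longleftrightarrow>
     external_potential k W \<and>
     (\<forall>z. z \<noteq> 0 \<longrightarrow> W z = ereal (g (cmod z))) \<and>
     (\<forall>s>0. g differentiable at s) \<and>
     (\<forall>a b. 0 < a \<and> a < b \<longrightarrow> abs_continuous_on_interval a b (deriv g)) \<and>
     g 1 = 0 \<and> deriv g 1 = 2 \<and>
     subharmonic_on (- {0}) (\<lambda>z. real_of_ereal (W z)) \<and>
     (\<exists>U. sphere 0 1 \<subseteq> U \<and> strictly_subharmonic_on U (\<lambda>z. real_of_ereal (W z))) \<and>
     0 < r \<and> (\<forall>s>0. s * deriv g s = 0 \<longleftrightarrow> s = r) \<and>
     droplet W = {z. r \<le> cmod z \<and> cmod z \<le> 1} \<and>
     deriv g differentiable at 1 \<and> deriv g differentiable at ((r + 1) / 2)"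

definition limit_profile :: "real \<Rightarrow> real \<Rightarrow> real" where
  "limit_profile a x =
     1 / sqrt (2 * pi) * integral {- 2 * a..2 * a} (\<lambda>t. exp (- (1 / 2) * (x - t)\<^sup>2))"

end

theory Submission
  imports Defs "HOL-Complex_Analysis.Cauchy_Integral_Formula" "HOL-Real_Asymp.Real_Asymp"
begin

text \<open>
  The particles of a radially symmetric Gibbs measure at \<open>\<beta> = 1\<close> form a determinantal process
  whose orthogonal functions are monomials. Indeed \<open>exp (- H)\<close> is the squared modulus of a
  Vandermonde determinant times a product of weights \<open>exp (- N Q)\<close>
  (\<open>exp_minus_hamiltonian_alternant\<close>); after expansion of the two determinants over permutations,
  rotation invariance leaves only the diagonal terms. Hence the mean number of particles in a Borel
  set has the density \<open>\<Sum>j<N. |\<zeta>|\<^sup>2\<^sup>j exp (- N Q(\<zeta>)) / h j\<close> with respect to area, where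
  \<open>h j\<close> is the integral of the numerator (\<open>gibbs_mean_count\<close>), and the one-point function is this
  density divided by the square of the scaling factor (\<open>one_point_function_limits\<close>).

  The droplet has width of order \<open>1 / N\<close>, so the natural radial coordinate is \<open>y = - N log |\<zeta>|\<close>.
  In this coordinate the exponent \<open>N g(|\<zeta>|)\<close> becomes \<open>E\<^sub>N(y) - 2 y\<close>, where \<open>E\<^sub>N\<close> is
  \<open>log_profile\<close>, and the numerator of the \<open>j\<close>-th term equals
  \<open>exp (2 y / N) exp (- E\<^sub>N(y) + 2 (1 - (j + 1) / N) y)\<close>. Three facts determine the limit.

  \<^item> \<open>E\<^sub>N\<close> is convex, because a radial subharmonic function is a convex function of \<open>log |\<zeta>|\<close>
    (\<open>radial_subharmonic_convex\<close>). The slope of \<open>E\<^sub>N\<close> is \<open>2 - \<phi>(exp (- y / N))\<close> with the flux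
    \<open>\<phi>(s) = s g'(s)\<close>.
  \<^item> The derivative of \<open>\<phi>\<close> is \<open>4 s \<Delta>Q(s)\<close>, and near the unit circle \<open>\<Delta>Q\<close> is asymptotic
    to the constant \<open>N / \<rho>\<^sup>2\<close>. Hence the slope of \<open>E\<^sub>N\<close> converges to \<open>4 y / \<rho>\<^sup>2\<close> uniformly on
    bounded sets, so that \<open>E\<^sub>N(y)\<close> tends to \<open>2 y\<^sup>2 / \<rho>\<^sup>2\<close> (\<open>flux_slopes\<close>).
  \<^item> By convexity the slopes at two fixed points bound \<open>E\<^sub>N\<close> from below by a linear function of
    \<open>|y|\<close>. Dominated convergence therefore applies to the integrals \<open>h j\<close>, uniformly in \<open>j\<close>, and to
    the sum over \<open>j\<close>, which is a Riemann sum in \<open>u = (j + 1) / N\<close> (\<open>normalized_sum_tendsto\<close>).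

  All terms become Gaussian in the limit, and the sum over \<open>j\<close> turns into the integral over the
  centres of these Gaussians, which is \<open>limit_profile\<close>. The argument is carried out along an
  arbitrary convergent sequence of points \<open>w\<^sub>N\<close>; since the limit is continuous,
  this amounts to uniform convergence on compact sets (\<open>uniform_limit_compactI\<close>).
\<close>


section \<open>Vandermonde determinants and alternants\<close>

definition vandermonde :: "nat \<Rightarrow> (nat \<Rightarrow> 'a::comm_ring_1) \<Rightarrow> 'a" where
  "vandermonde n x = (\<Prod>j<n. \<Prod>i<j. x j - x i)"

lemma vandermonde_eq_0_iff:
  fixes x :: "nat \<Rightarrow> 'a::{idom,ring_char_0}"
  shows "vandermonde n x = 0 \<longleftrightarrow> (\<exists>j<n. \<exists>i<j. x j = x i)"
  unfolding vandermonde_def by (subst prod_zero_iff) (auto simp: prod_zero_iff)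

text \<open>Composition with the transposition of \<open>i\<close> and \<open>j\<close> changes the sign of a permutation but, since
  \<open>f i = f j\<close>, not the product belonging to it; so the sum is its own negative.\<close>

lemma alternating_sum_eq_0:
  fixes f :: "nat \<Rightarrow> nat \<Rightarrow> 'a::{idom,ring_char_0}"
  assumes S: "finite S" "i \<in> S" "j \<in> S" "i \<noteq> j" and eq: "\<And>k. f i k = f j k"
  shows "(\<Sum>\<sigma> | \<sigma> permutes S. of_int (sign \<sigma>) * (\<Prod>l\<in>S. f l (\<sigma> l))) = 0"
proof -
  let ?t = "Transposition.transpose i j"
  let ?F = "\<lambda>\<sigma>. of_int (sign \<sigma>) * (\<Prod>l\<in>S. f l (\<sigma> l))"
  have t: "?t permutes S" using S by (intro permutes_swap_id)
  have "(\<Sum>\<sigma> | \<sigma> permutes S. ?F \<sigma>) = (\<Sum>\<sigma> | \<sigma> permutes S. ?F (\<sigma> \<circ> ?t))"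
    by (rule sum_permutations_compose_right[OF t])
  also have "\<dots> = (\<Sum>\<sigma> | \<sigma> permutes S. - ?F \<sigma>)"
  proof (rule sum.cong[OF refl])
    fix \<sigma> assume "\<sigma> \<in> {\<sigma>. \<sigma> permutes S}"
    then have \<sigma>: "\<sigma> permutes S" by simp
    have sg: "sign (\<sigma> \<circ> ?t) = - sign \<sigma>"
      using S \<sigma> t by (subst sign_compose)
        (auto simp: sign_swap_id intro: permutation_permutes[THEN iffD2])
    have "(\<Prod>l\<in>S. f l (\<sigma> l)) = (\<Prod>l\<in>S. f (?t l) (\<sigma> (?t l)))"
      using prod.permute[OF t, of "\<lambda>l. f l (\<sigma> l)"] by (simp add: o_def)
    also have "\<dots> = (\<Prod>l\<in>S. f l ((\<sigma> \<circ> ?t) l))"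
      by (intro prod.cong) (auto simp: Transposition.transpose_def eq)
    finally show "?F (\<sigma> \<circ> ?t) = - ?F \<sigma>" using sg by simp
  qed
  finally have "(\<Sum>\<sigma> | \<sigma> permutes S. ?F \<sigma>) = - (\<Sum>\<sigma> | \<sigma> permutes S. ?F \<sigma>)"
    by (simp add: sum_negf)
  then show ?thesis by simp
qed

lemma permutes_lessThan_Suc_fixing:
  "{\<sigma>. \<sigma> permutes {..<Suc n} \<and> \<sigma> n = n} = {\<sigma>. \<sigma> permutes {..<n}}"
proof safe
  fix \<sigma> assume s: "\<sigma> permutes {..<Suc n}" "\<sigma> n = n"
  show "\<sigma> permutes {..<n}"
    by (rule permutes_superset[OF s(1)]) (use s in \<open>auto simp: less_Suc_eq\<close>)
next
  fix \<sigma> assume s: "\<sigma> permutes {..<n}"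
  show "\<sigma> permutes {..<Suc n}" by (rule permutes_subset[OF s]) auto
  show "\<sigma> n = n" using s by (simp add: permutes_not_in)
qed

text \<open>Induction on the number of nodes. With the last node replaced by an indeterminate, both sides are
  polynomials of degree at most \<open>n\<close> that vanish at the other nodes, and the induction hypothesis says
  that their coefficients of degree \<open>n\<close> agree. If two nodes coincide, both sides are zero.\<close>

lemma vandermonde_eq_alternating_sum:
  fixes x :: "nat \<Rightarrow> 'a::{idom,ring_char_0}"
  shows "vandermonde n x = (\<Sum>\<sigma> | \<sigma> permutes {..<n}. of_int (sign \<sigma>) * (\<Prod>j<n. x j ^ \<sigma> j))"
proof (induction n)
  case 0
  show ?case by (simp add: vandermonde_def)
next
  case (Suc n)
  let ?S = "{..<Suc n}"
  show ?case
  proof (cases "inj_on x ?S")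
    case False
    then obtain i j where ij: "i < Suc n" "j < Suc n" "x i = x j" "i < j"
      unfolding inj_on_def by (metis lessThan_iff nat_neq_iff)
    have "vandermonde (Suc n) x = 0" unfolding vandermonde_eq_0_iff using ij by metis
    with alternating_sum_eq_0[of ?S i j "\<lambda>l k. x l ^ k"] ij show ?thesis by simp
  next
    case True
    define P :: "'a poly" where
      "P = (\<Sum>\<sigma> | \<sigma> permutes ?S. monom (of_int (sign \<sigma>) * (\<Prod>j<n. x j ^ \<sigma> j)) (\<sigma> n))"
    define R :: "'a poly" where "R = smult (vandermonde n x) (\<Prod>i<n. [:- x i, 1:])"
    have fin: "finite {\<sigma>. \<sigma> permutes ?S}" by (rule finite_permutations) simp
    have polyP: "poly P y = (\<Sum>\<sigma> | \<sigma> permutes ?S. of_int (sign \<sigma>) * (\<Prod>j<Suc n. (if j = n then y else x j) ^ \<sigma> j))" for y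
      unfolding P_def by (simp add: poly_sum poly_monom mult.assoc)
    have "P = R"
    proof (rule poly_eqI_degree_lead_coeff[where A = "x ` {..<n}" and n = n])
      have "inj_on x {..<n}" using True by (rule inj_on_subset) auto
      then show "card (x ` {..<n}) \<ge> n" by (simp add: card_image)
      show "degree P \<le> n" unfolding P_def
      proof (rule degree_sum_le[OF fin])
        fix \<sigma> assume "\<sigma> \<in> {\<sigma>. \<sigma> permutes ?S}"
        then have "\<sigma> n \<le> n" using permutes_in_image[of \<sigma> ?S n] by auto
        then show "degree (monom (of_int (sign \<sigma>) * (\<Prod>j<n. x j ^ \<sigma> j)) (\<sigma> n)) \<le> n"
          using degree_monom_le order_trans by blast
      qed
      have deg: "degree (\<Prod>i<n. [:- x i, 1:]) = n"
        by (subst degree_prod_sum_eq) auto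
      show "degree R \<le> n" unfolding R_def using degree_smult_le deg by metis
      have "coeff (\<Prod>i<n. [:- x i, 1:]) n = lead_coeff (\<Prod>i<n. [:- x i, 1:])" using deg by simp
      also have "\<dots> = 1" by (subst lead_coeff_prod) simp
      finally have "coeff R n = vandermonde n x" by (simp add: R_def)
      moreover have "coeff P n = (\<Sum>\<sigma> | \<sigma> permutes ?S. if \<sigma> n = n then of_int (sign \<sigma>) * (\<Prod>j<n. x j ^ \<sigma> j) else 0)"
        unfolding P_def by (simp add: coeff_sum)
      moreover have "\<dots> = (\<Sum>\<sigma> | \<sigma> permutes {..<n}. of_int (sign \<sigma>) * (\<Prod>j<n. x j ^ \<sigma> j))"
        by (subst sum.inter_filter[OF fin, symmetric]) (simp add: permutes_lessThan_Suc_fixing)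
      ultimately show "coeff P n = coeff R n" using Suc.IH by simp
    next
      fix z assume "z \<in> x ` {..<n}"
      then obtain i where i: "i < n" "z = x i" by auto
      have "poly P z = 0" unfolding polyP
        by (rule alternating_sum_eq_0[of ?S i n "\<lambda>l k. (if l = n then z else x l) ^ k"]) (use i in auto)
      moreover have "poly R z = 0" unfolding R_def poly_smult poly_prod
        using i by (auto intro!: prod_zero)
      ultimately show "poly P z = poly R z" by simp
    qed
    then have "poly P (x n) = poly R (x n)" by simp
    moreover have "poly R (x n) = vandermonde (Suc n) x"
      by (simp add: R_def poly_prod vandermonde_def)
    moreover have "poly P (x n) = (\<Sum>\<sigma> | \<sigma> permutes ?S. of_int (sign \<sigma>) * (\<Prod>j<Suc n. x j ^ \<sigma> j))"
      unfolding polyP by (intro sum.cong refl arg_cong2[where f = "(*)"] prod.cong) auto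
    ultimately show ?thesis by simp
  qed
qed

text \<open>The determinant of the matrix \<open>e i (x j)\<close>, as a Leibniz sum, so that integrals over product measures
  can be evaluated term by term.\<close>

definition alternant :: "nat \<Rightarrow> (nat \<Rightarrow> 'b \<Rightarrow> complex) \<Rightarrow> (nat \<Rightarrow> 'b) \<Rightarrow> complex" where
  "alternant n e x = (\<Sum>\<sigma> | \<sigma> permutes {..<n}. of_int (sign \<sigma>) * (\<Prod>j<n. e (\<sigma> j) (x j)))"

text \<open>The squared modulus is a sum over pairs of permutations \<open>\<sigma>, \<tau>\<close> of products of functions of one
  variable. Orthogonality in the variables other than \<open>i\<close> kills every pair that differs at one of
  these variables, and permutations that agree off \<open>i\<close> are equal. Only the diagonal survives.\<close>

lemma integral_alternant_indicator:
  fixes e :: "nat \<Rightarrow> 'b \<Rightarrow> complex"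
  assumes sf: "sigma_finite_measure M"
    and int: "\<And>a b. a < n \<Longrightarrow> b < n \<Longrightarrow> integrable M (\<lambda>x. e a x * cnj (e b x))"
    and orth: "\<And>a b. a < n \<Longrightarrow> b < n \<Longrightarrow> a \<noteq> b \<Longrightarrow> (\<integral>x. e a x * cnj (e b x) \<partial>M) = 0"
    and i: "i < n" and B: "B \<in> sets M"
  shows "integrable (PiM {..<n} (\<lambda>_. M)) (\<lambda>x. (cmod (alternant n e x))\<^sup>2 * indicator B (x i))" (is ?A)
    and "(\<integral>x. (cmod (alternant n e x))\<^sup>2 * indicator B (x i) \<partial>PiM {..<n} (\<lambda>_. M)) =
      (\<Sum>\<sigma> | \<sigma> permutes {..<n}. \<Prod>j<n. \<integral>x. (cmod (e (\<sigma> j) x))\<^sup>2 * (if j = i then indicator B x else 1) \<partial>M)" (is ?B)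
proof -
  interpret product_sigma_finite "\<lambda>_::nat. M" using sf by (simp add: product_sigma_finite_def)
  let ?P = "{\<sigma>. \<sigma> permutes {..<n}}"
  let ?c = "\<lambda>j x. (if j = i then indicator B x else 1 :: complex)"
  let ?f = "\<lambda>\<sigma> \<tau> j x. e (\<sigma> j) x * cnj (e (\<tau> j) x) * ?c j x"
  have fin: "finite ?P" by (rule finite_permutations) simp
  have perm: "\<sigma> j < n" if "\<sigma> \<in> ?P" "j < n" for \<sigma> j
    using that permutes_in_image[of \<sigma> "{..<n}" j] by auto
  have intf: "integrable M (?f \<sigma> \<tau> j)" if "\<sigma> \<in> ?P" "\<tau> \<in> ?P" "j < n" for \<sigma> \<tau> j
  proof (cases "j = i")
    case True
    have "integrable M (\<lambda>x. indicator B x *\<^sub>R (e (\<sigma> j) x * cnj (e (\<tau> j) x)))"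
      using that int perm B by (intro integrable_mult_indicator) auto
    then show ?thesis using True by (simp add: scaleR_conv_of_real mult.commute of_real_indicator)
  next
    case False
    then show ?thesis using that int perm by simp
  qed
  have expand: "complex_of_real ((cmod (alternant n e x))\<^sup>2 * indicator B (x i)) =
      (\<Sum>\<sigma>\<in>?P. \<Sum>\<tau>\<in>?P. of_int (sign \<sigma> * sign \<tau>) * (\<Prod>j<n. ?f \<sigma> \<tau> j (x j)))" for x
  proof -
    have "(\<Prod>j<n. ?c j (x j)) = indicator B (x i)"
      using i by (simp add: prod.delta)
    then have f: "(\<Prod>j<n. ?f \<sigma> \<tau> j (x j)) =
       (\<Prod>j<n. e (\<sigma> j) (x j)) * cnj (\<Prod>j<n. e (\<tau> j) (x j)) * indicator B (x i)" for \<sigma> \<tau>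
      by (simp add: prod.distrib)
    have "complex_of_real ((cmod (alternant n e x))\<^sup>2) =
        (\<Sum>\<sigma>\<in>?P. \<Sum>\<tau>\<in>?P. (of_int (sign \<sigma>) * (\<Prod>j<n. e (\<sigma> j) (x j))) * (of_int (sign \<tau>) * cnj (\<Prod>j<n. e (\<tau> j) (x j))))"
      by (simp only: complex_norm_square alternant_def sum_product cnj_sum complex_cnj_mult complex_cnj_of_int)
    then have "complex_of_real ((cmod (alternant n e x))\<^sup>2 * indicator B (x i)) =
        (\<Sum>\<sigma>\<in>?P. \<Sum>\<tau>\<in>?P. (of_int (sign \<sigma>) * (\<Prod>j<n. e (\<sigma> j) (x j))) * (of_int (sign \<tau>) * cnj (\<Prod>j<n. e (\<tau> j) (x j))) * indicator B (x i))"
      by (simp only: of_real_mult of_real_indicator sum_distrib_right)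
    also have "\<dots> = (\<Sum>\<sigma>\<in>?P. \<Sum>\<tau>\<in>?P. of_int (sign \<sigma> * sign \<tau>) * (\<Prod>j<n. ?f \<sigma> \<tau> j (x j)))"
      by (intro sum.cong refl, subst f) (simp only: of_int_mult mult_ac)
    finally show ?thesis .
  qed
  have intprod: "integrable (PiM {..<n} (\<lambda>_. M)) (\<lambda>x. \<Prod>j<n. ?f \<sigma> \<tau> j (x j))"
    if "\<sigma> \<in> ?P" "\<tau> \<in> ?P" for \<sigma> \<tau>
    using that by (intro product_integrable_prod intf) auto
  have ci: "integrable (PiM {..<n} (\<lambda>_. M)) (\<lambda>x. complex_of_real ((cmod (alternant n e x))\<^sup>2 * indicator B (x i)))"
    unfolding expand by (intro Bochner_Integration.integrable_sum integrable_mult_right intprod) auto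
  then show ?A by (simp only: complex_of_real_integrable_eq)
  have diag: "(\<Prod>j<n. \<integral>x. ?f \<sigma> \<tau> j x \<partial>M) = 0" if "\<sigma> \<in> ?P" "\<tau> \<in> ?P" "\<sigma> \<noteq> \<tau>" for \<sigma> \<tau>
  proof -
    \<comment> \<open>the \<open>i\<close>-th factor carries the indicator, so orthogonality is available at the other indices only\<close>
    have "\<exists>j<n. j \<noteq> i \<and> \<sigma> j \<noteq> \<tau> j"
    proof (rule ccontr)
      assume "\<not> ?thesis"
      then have eq: "\<sigma> j = \<tau> j" if "j \<noteq> i" for j
        using that \<open>\<sigma> \<in> ?P\<close> \<open>\<tau> \<in> ?P\<close> permutes_not_in[of _ "{..<n}" j] by (metis lessThan_iff mem_Collect_eq)
      have "\<sigma> i = \<tau> i"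
      proof (rule ccontr)
        assume ne: "\<sigma> i \<noteq> \<tau> i"
        have inj: "inj \<sigma>" "inj \<tau>" "surj \<tau>" using that permutes_bij[of _ "{..<n}"] by (auto simp: bij_def)
        obtain k where k: "\<tau> k = \<sigma> i" using inj(3) by (metis surjD)
        then have "k \<noteq> i" using ne by auto
        then show False using eq[of k] k inj(1) by (metis injD)
      qed
      with eq have "\<sigma> = \<tau>" by (metis ext)
      with that show False by simp
    qed
    then obtain j where j: "j < n" "j \<noteq> i" "\<sigma> j \<noteq> \<tau> j" by auto
    then have "(\<integral>x. ?f \<sigma> \<tau> j x \<partial>M) = 0" using orth perm that by simp
    then show ?thesis using j(1) by (intro prod_zero) auto
  qed
  have "complex_of_real (\<integral>x. (cmod (alternant n e x))\<^sup>2 * indicator B (x i) \<partial>PiM {..<n} (\<lambda>_. M)) =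
      (\<integral>x. complex_of_real ((cmod (alternant n e x))\<^sup>2 * indicator B (x i)) \<partial>PiM {..<n} (\<lambda>_. M))"
    by (rule integral_complex_of_real[symmetric])
  also have "\<dots> = (\<Sum>\<sigma>\<in>?P. \<Sum>\<tau>\<in>?P. of_int (sign \<sigma> * sign \<tau>) * (\<Prod>j<n. \<integral>x. ?f \<sigma> \<tau> j x \<partial>M))"
  proof -
    have "(\<integral>x. (\<Sum>\<sigma>\<in>?P. \<Sum>\<tau>\<in>?P. of_int (sign \<sigma> * sign \<tau>) * (\<Prod>j<n. ?f \<sigma> \<tau> j (x j))) \<partial>PiM {..<n} (\<lambda>_. M)) =
        (\<Sum>\<sigma>\<in>?P. \<integral>x. (\<Sum>\<tau>\<in>?P. of_int (sign \<sigma> * sign \<tau>) * (\<Prod>j<n. ?f \<sigma> \<tau> j (x j))) \<partial>PiM {..<n} (\<lambda>_. M))"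
      by (intro Bochner_Integration.integral_sum Bochner_Integration.integrable_sum integrable_mult_right intprod)
    also have "\<dots> = (\<Sum>\<sigma>\<in>?P. \<Sum>\<tau>\<in>?P. \<integral>x. of_int (sign \<sigma> * sign \<tau>) * (\<Prod>j<n. ?f \<sigma> \<tau> j (x j)) \<partial>PiM {..<n} (\<lambda>_. M))"
      by (intro sum.cong refl Bochner_Integration.integral_sum integrable_mult_right intprod)
    also have "\<dots> = (\<Sum>\<sigma>\<in>?P. \<Sum>\<tau>\<in>?P. of_int (sign \<sigma> * sign \<tau>) * (\<Prod>j<n. \<integral>x. ?f \<sigma> \<tau> j x \<partial>M))"
    proof (intro sum.cong refl)
      fix \<sigma> \<tau> assume st: "\<sigma> \<in> ?P" "\<tau> \<in> ?P"
      have "(\<integral>x. (\<Prod>j<n. ?f \<sigma> \<tau> j (x j)) \<partial>PiM {..<n} (\<lambda>_. M)) = (\<Prod>j<n. \<integral>x. ?f \<sigma> \<tau> j x \<partial>M)"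
        by (rule product_integral_prod) (use st intf in auto)
      then show "(\<integral>x. of_int (sign \<sigma> * sign \<tau>) * (\<Prod>j<n. ?f \<sigma> \<tau> j (x j)) \<partial>PiM {..<n} (\<lambda>_. M)) =
          of_int (sign \<sigma> * sign \<tau>) * (\<Prod>j<n. \<integral>x. ?f \<sigma> \<tau> j x \<partial>M)"
        by (subst integral_mult_right_zero) simp
    qed
    finally show ?thesis unfolding expand .
  qed
  also have "\<dots> = (\<Sum>\<sigma>\<in>?P. \<Sum>\<tau>\<in>?P. if \<tau> = \<sigma> then (\<Prod>j<n. \<integral>x. ?f \<sigma> \<sigma> j x \<partial>M) else 0)"
  proof (intro sum.cong refl)
    fix \<sigma> \<tau> assume "\<sigma> \<in> ?P" "\<tau> \<in> ?P"
    then show "of_int (sign \<sigma> * sign \<tau>) * (\<Prod>j<n. \<integral>x. ?f \<sigma> \<tau> j x \<partial>M) =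
        (if \<tau> = \<sigma> then (\<Prod>j<n. \<integral>x. ?f \<sigma> \<sigma> j x \<partial>M) else 0)"
      using diag[of \<sigma> \<tau>] by (cases "\<tau> = \<sigma>") (auto simp: sign_idempotent)
  qed
  also have "\<dots> = (\<Sum>\<sigma>\<in>?P. \<Prod>j<n. \<integral>x. ?f \<sigma> \<sigma> j x \<partial>M)"
    using fin by (intro sum.cong refl) (simp add: sum.delta)
  also have "\<dots> = (\<Sum>\<sigma>\<in>?P. \<Prod>j<n. complex_of_real (\<integral>x. (cmod (e (\<sigma> j) x))\<^sup>2 * (if j = i then indicator B x else 1) \<partial>M))"
  proof (intro sum.cong prod.cong refl)
    fix \<sigma> j
    have "?f \<sigma> \<sigma> j x = complex_of_real ((cmod (e (\<sigma> j) x))\<^sup>2 * (if j = i then indicator B x else 1))" for x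
      by (simp only: complex_norm_square[symmetric] of_real_mult) (auto simp: indicator_def)
    then show "(\<integral>x. ?f \<sigma> \<sigma> j x \<partial>M) =
       complex_of_real (\<integral>x. (cmod (e (\<sigma> j) x))\<^sup>2 * (if j = i then indicator B x else 1) \<partial>M)"
      by (simp only: integral_complex_of_real)
  qed
  finally show ?B by (simp only: of_real_sum[symmetric] of_real_prod[symmetric] of_real_eq_iff)
qed

section \<open>Normalized area\<close>

lemma sets_area [simp, measurable_cong]: "sets area = sets borel"
  by (simp add: area_def)

lemma space_area [simp]: "space area = UNIV"
  by (simp add: area_def)

lemma sigma_finite_area: "sigma_finite_measure area"
  unfolding area_def
  by (subst sigma_finite_measure.sigma_finite_iff_density_finite[OF lborel.sigma_finite_measure_axioms]) auto

lemma emeasure_area: "A \<in> sets borel \<Longrightarrow> emeasure area A = ennreal (1 / pi) * emeasure lborel A"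
  unfolding area_def by (subst emeasure_density) (auto simp: nn_integral_cmult)

lemma emeasure_area_ball: "r \<ge> 0 \<Longrightarrow> emeasure area (ball z r) = ennreal (r\<^sup>2)"
  by (simp add: emeasure_area emeasure_ball unit_ball_vol_2 ennreal_mult[symmetric] power2_eq_square)

lemma lborel_translation_invariant_nn_integral:
  fixes f :: "'a::euclidean_space \<Rightarrow> ennreal"
  assumes [measurable]: "f \<in> borel_measurable borel"
  shows "(\<integral>\<^sup>+x. f (c + x) \<partial>lborel) = (\<integral>\<^sup>+x. f x \<partial>lborel)"
  by (subst (2) lborel_distr_plus[of c, symmetric]) (simp add: nn_integral_distr)

lemma lborel_reflection_invariant_nn_integral:
  fixes f :: "'a::euclidean_space \<Rightarrow> ennreal"
  assumes [measurable]: "f \<in> borel_measurable borel"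
  shows "(\<integral>\<^sup>+x. f (- x) \<partial>lborel) = (\<integral>\<^sup>+x. f x \<partial>lborel)"
proof -
  have "lborel = distr lborel borel (\<lambda>x::'a. - x)"
    using lborel_affine[of "- 1" "0::'a"] by (simp add: density_1)
  then have "(\<integral>\<^sup>+x. f x \<partial>lborel) = (\<integral>\<^sup>+x. f x \<partial>distr lborel borel (\<lambda>x::'a. - x))" by simp
  also have "\<dots> = (\<integral>\<^sup>+x. f (- x) \<partial>lborel)" by (subst nn_integral_distr) auto
  finally show ?thesis by simp
qed

text \<open>Uniqueness of translation-invariant measures: for the image measure \<open>\<mu>\<close>, integration of
  \<open>indicator A x * indicator B (x + y)\<close> in both orders yields \<open>\<mu> A * lborel B = lborel A * \<mu> B\<close>. The unit
  ball \<open>B\<close> has the same positive finite measure for both, because \<open>T\<close> preserves it.\<close>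

lemma lborel_isometry_invariant:
  fixes T :: "'a::euclidean_space \<Rightarrow> 'a"
  assumes lin: "linear T" and iso: "\<And>x. norm (T x) = norm x"
  shows "distr lborel borel T = lborel"
proof -
  have cont: "continuous_on UNIV T" using lin by (simp add: linear_continuous_on linear_linear)
  have Tm[measurable]: "T \<in> borel_measurable borel" using cont by (rule borel_measurable_continuous_onI)
  have inj: "inj T" using iso by (simp add: linear_injective_0[OF lin]) (metis norm_eq_zero)
  have surj: "surj T" by (rule linear_inj_imp_surj[OF lin inj])
  define \<mu> where "\<mu> = distr lborel borel T"
  have s\<mu>[simp, measurable_cong]: "sets \<mu> = sets borel" by (simp add: \<mu>_def)
  have inv: "(\<integral>\<^sup>+x. f (c + x) \<partial>\<mu>) = (\<integral>\<^sup>+x. f x \<partial>\<mu>)" if [measurable]: "f \<in> borel_measurable borel" for f c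
  proof -
    obtain d where d: "c = T d" using surj by (metis surjD)
    have "(\<integral>\<^sup>+x. f (c + x) \<partial>\<mu>) = (\<integral>\<^sup>+x. f (T (d + x)) \<partial>lborel)"
      unfolding \<mu>_def by (subst nn_integral_distr) (auto simp: d linear_add[OF lin])
    also have "\<dots> = (\<integral>\<^sup>+x. f (T x) \<partial>lborel)"
      using lborel_translation_invariant_nn_integral[of "\<lambda>x. f (T x)" d] by simp
    finally show ?thesis by (simp add: \<mu>_def nn_integral_distr)
  qed
  let ?B = "ball 0 1 :: 'a set"
  have vB: "T -` ?B = ?B" using iso by (auto simp: dist_norm)
  have \<mu>B: "emeasure \<mu> ?B = emeasure lborel ?B"
    by (simp add: \<mu>_def emeasure_distr vB)
  have sf: "sigma_finite_measure \<mu>"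
  proof
    show "\<exists>A. countable A \<and> A \<subseteq> sets \<mu> \<and> \<Union> A = space \<mu> \<and> (\<forall>a\<in>A. emeasure \<mu> a \<noteq> \<infinity>)"
    proof (intro exI[of _ "range (\<lambda>n::nat. ball 0 (real n))"] conjI ballI)
      show "\<Union> (range (\<lambda>n::nat. ball (0::'a) (real n))) = space \<mu>"
        using reals_Archimedean2 by (auto simp: \<mu>_def)
      fix a assume "a \<in> range (\<lambda>n::nat. ball (0::'a) (real n))"
      then obtain n where "a = ball 0 (real n)" by auto
      moreover from this have "T -` a = a" using iso by (auto simp: dist_norm)
      ultimately show "emeasure \<mu> a \<noteq> \<infinity>"
        using emeasure_lborel_ball_finite[of 0 "real n"] by (simp add: \<mu>_def emeasure_distr less_top)
    qed auto
  qed
  interpret \<mu>: sigma_finite_measure \<mu> by fact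
  interpret pair_sigma_finite lborel \<mu> by (simp add: pair_sigma_finite_def sf lborel.sigma_finite_measure_axioms)
  have key: "emeasure \<mu> A * emeasure lborel ?B = emeasure lborel A * emeasure \<mu> ?B"
    if [measurable]: "A \<in> sets borel" for A
  proof -
    define iA :: "'a \<Rightarrow> ennreal" where "iA = indicator A"
    define iB :: "'a \<Rightarrow> ennreal" where "iB = indicator ?B"
    have [measurable]: "iA \<in> borel_measurable borel" "iB \<in> borel_measurable borel"
      unfolding iA_def iB_def by (intro borel_measurable_indicator; simp add: that)+
    have intA: "(\<integral>\<^sup>+x. iA x \<partial>\<mu>) = emeasure \<mu> A" "(\<integral>\<^sup>+x. iA x \<partial>lborel) = emeasure lborel A"
      and intB: "(\<integral>\<^sup>+x. iB x \<partial>\<mu>) = emeasure \<mu> ?B" "(\<integral>\<^sup>+x. iB x \<partial>lborel) = emeasure lborel ?B"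
      unfolding iA_def iB_def using that by simp_all
    have "emeasure \<mu> A * emeasure lborel ?B = (\<integral>\<^sup>+x. iA x * (\<integral>\<^sup>+y. iB y \<partial>lborel) \<partial>\<mu>)"
      unfolding intA(1)[symmetric] intB(2)[symmetric] by (rule nn_integral_multc[symmetric]) simp
    also have "\<dots> = (\<integral>\<^sup>+x. (\<integral>\<^sup>+y. iA x * iB (x + y) \<partial>lborel) \<partial>\<mu>)"
    proof (rule nn_integral_cong)
      fix x
      have "(\<integral>\<^sup>+y. iB y \<partial>lborel) = (\<integral>\<^sup>+y. iB (x + y) \<partial>lborel)"
        by (rule lborel_translation_invariant_nn_integral[symmetric]) measurable
      then show "iA x * (\<integral>\<^sup>+y. iB y \<partial>lborel) = (\<integral>\<^sup>+y. iA x * iB (x + y) \<partial>lborel)"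
        by (simp add: nn_integral_cmult)
    qed
    also have "\<dots> = (\<integral>\<^sup>+y. (\<integral>\<^sup>+x. iA x * iB (x + y) \<partial>\<mu>) \<partial>lborel)"
      by (rule Fubini') measurable
    also have "\<dots> = (\<integral>\<^sup>+y. (\<integral>\<^sup>+x. iA (- y + x) * iB x \<partial>\<mu>) \<partial>lborel)"
    proof (rule nn_integral_cong)
      fix y
      show "(\<integral>\<^sup>+x. iA x * iB (x + y) \<partial>\<mu>) = (\<integral>\<^sup>+x. iA (- y + x) * iB x \<partial>\<mu>)"
        using inv[of "\<lambda>x. iA x * iB (x + y)" "- y"] by (simp add: algebra_simps)
    qed
    also have "\<dots> = (\<integral>\<^sup>+x. (\<integral>\<^sup>+y. iA (- y + x) * iB x \<partial>lborel) \<partial>\<mu>)"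
      by (rule Fubini'[symmetric]) measurable
    also have "\<dots> = (\<integral>\<^sup>+x. emeasure lborel A * iB x \<partial>\<mu>)"
    proof (rule nn_integral_cong)
      fix x
      have "(\<integral>\<^sup>+y. iA (- y + x) \<partial>lborel) = (\<integral>\<^sup>+y. iA (y + x) \<partial>lborel)"
        using lborel_reflection_invariant_nn_integral[of "\<lambda>y. iA (y + x)"] by simp
      also have "\<dots> = emeasure lborel A"
        using lborel_translation_invariant_nn_integral[of iA x] intA(2) by (simp add: add.commute)
      finally show "(\<integral>\<^sup>+y. iA (- y + x) * iB x \<partial>lborel) = emeasure lborel A * iB x"
        by (simp add: nn_integral_multc)
    qed
    also have "\<dots> = emeasure lborel A * emeasure \<mu> ?B"
      by (simp add: nn_integral_cmult intB(1))
    finally show ?thesis .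
  qed
  have pos: "emeasure lborel ?B \<noteq> 0" "emeasure lborel ?B \<noteq> \<infinity>"
    using emeasure_lborel_ball_finite[of "0::'a" 1]
    by (simp_all add: emeasure_ball less_imp_neq[OF unit_ball_vol_pos, THEN not_sym])
  have "\<mu> = lborel"
  proof (rule measure_eqI)
    fix A assume "A \<in> sets \<mu>"
    then have "emeasure \<mu> A * emeasure lborel ?B = emeasure lborel A * emeasure lborel ?B"
      using key[of A] \<mu>B by simp
    with pos show "emeasure \<mu> A = emeasure lborel A"
      by (simp add: mult.commute[of _ "emeasure lborel ?B"] ennreal_mult_cancel_left)
  qed simp
  then show ?thesis by (simp add: \<mu>_def)
qed

lemma integral_area_rotate:
  fixes f :: "complex \<Rightarrow> 'a::{banach, second_countable_topology}"
  assumes [measurable]: "f \<in> borel_measurable borel" and a: "cmod a = 1"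
  shows "(\<integral>z. f (a * z) \<partial>area) = (\<integral>z. f z \<partial>area)"
proof -
  have "distr lborel borel ((*) a) = lborel"
    using a by (intro lborel_isometry_invariant) (auto simp: norm_mult bounded_linear.linear bounded_linear_mult_right)
  then have "(\<integral>z. f z \<partial>lborel) = (\<integral>z. f z \<partial>distr lborel borel ((*) a))" by simp
  also have "\<dots> = (\<integral>z. f (a * z) \<partial>lborel)" by (subst integral_distr) auto
  finally show ?thesis unfolding area_def by (simp add: integral_density)
qed

lemma borel_measurable_cnj [measurable (raw)]:
  "f \<in> borel_measurable M \<Longrightarrow> (\<lambda>x. cnj (f x)) \<in> borel_measurable M"
  by (rule measurable_compose[OF _ borel_measurable_continuous_onI]) (auto intro: continuous_intros)

text \<open>With \<open>l = |j - k|\<close>, rotation by the angle \<open>\<pi> / l\<close> preserves the integral and reverses the sign of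
  the integrand.\<close>

lemma integral_monomials_radial_weight:
  assumes [measurable]: "\<omega> \<in> borel_measurable borel"
    and rad: "\<And>a z. cmod a = 1 \<Longrightarrow> \<omega> (a * z) = (\<omega> z :: real)" and jk: "j \<noteq> k"
  shows "(\<integral>z. z ^ j * cnj (z ^ k) * of_real (\<omega> z) \<partial>area) = 0"
proof -
  let ?I = "\<integral>z. z ^ j * cnj (z ^ k) * of_real (\<omega> z) \<partial>area"
  obtain l where "l > 0" "j = k + l \<or> k = j + l"
    using jk by (metis less_imp_add_positive nat_neq_iff)
  define a where "a = cis (pi / l)"
  have al: "a ^ l = -1" using \<open>l > 0\<close> unfolding a_def by (simp only: Complex.DeMoivre) simp
  have a1: "cmod a = 1" by (simp add: a_def)
  have aa: "a ^ m * cnj a ^ m = 1" for m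
    using a1 by (metis complex_norm_square of_real_1 one_power2 power_mult_distrib power_one)
  have ajk: "a ^ j * cnj (a ^ k) = - 1"
    using \<open>j = k + l \<or> k = j + l\<close>
  proof
    assume "j = k + l"
    then have "a ^ j * cnj (a ^ k) = (a ^ k * cnj a ^ k) * a ^ l" by (simp add: power_add)
    then show ?thesis by (simp add: aa al)
  next
    assume "k = j + l"
    then have "a ^ j * cnj (a ^ k) = (a ^ j * cnj a ^ j) * cnj (a ^ l)" by (simp add: power_add)
    then show ?thesis by (simp only: aa al) simp
  qed
  have "?I = (\<integral>z. (a * z) ^ j * cnj ((a * z) ^ k) * of_real (\<omega> (a * z)) \<partial>area)"
    by (rule integral_area_rotate[symmetric, OF _ a1]) measurable
  also have "\<dots> = (\<integral>z. (a ^ j * cnj (a ^ k)) * (z ^ j * cnj (z ^ k) * of_real (\<omega> z)) \<partial>area)"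
    unfolding rad[OF a1] by (simp add: power_mult_distrib mult_ac)
  also have "\<dots> = - ?I" unfolding ajk by simp
  finally show ?thesis by simp
qed

text \<open>Polar coordinates for radial integrands: the set \<open>- ln |z| > x\<close> is, up to the origin, a disc of radius
  \<open>exp (- x)\<close>, whose normalized area is \<open>exp (- 2 x)\<close>.\<close>

lemma distr_area_log_modulus:
  "distr area borel (\<lambda>z. - ln (cmod z)) = density lborel (\<lambda>y. ennreal (2 * exp (- 2 * y)))"
proof (rule measure_eqI_lessThan)
  fix x :: real
  have "(\<lambda>z. - ln (cmod z)) -` {x<..} \<inter> space borel \<in> sets borel"
    by (rule measurable_sets[of _ borel borel]) auto
  then have pre: "(\<lambda>z. - ln (cmod z)) -` {x<..} \<in> sets borel" by simp
  have "emeasure (distr area borel (\<lambda>z. - ln (cmod z))) {x<..} =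
        emeasure area ((\<lambda>z. - ln (cmod z)) -` {x<..})"
    by (subst emeasure_distr) auto
  also have "\<dots> = emeasure area (ball 0 (exp (- x)))"
  proof (rule emeasure_eq_AE)
    have "AE z in lborel. z \<noteq> (0::complex)" by (rule AE_lborel_singleton)
    then have "AE z in area. z \<noteq> 0" unfolding area_def by (subst AE_density) auto
    then show "AE z in area. z \<in> (\<lambda>z. - ln (cmod z)) -` {x<..} \<longleftrightarrow> z \<in> ball 0 (exp (- x))"
    proof eventually_elim
      case (elim z)
      then have "(x < - ln (cmod z)) \<longleftrightarrow> ln (cmod z) < ln (exp (- x))" by auto
      also have "\<dots> \<longleftrightarrow> cmod z < exp (- x)" using elim by (subst ln_less_cancel_iff) auto
      finally show ?case by simp
    qed
  qed (use pre in auto)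
  also have "\<dots> = ennreal (exp (- 2 * x))"
    by (subst emeasure_area_ball) (auto simp: exp_add[symmetric] power2_eq_square)
  finally have L: "emeasure (distr area borel (\<lambda>z. - ln (cmod z))) {x<..} = ennreal (exp (- 2 * x))" .
  have "emeasure (density lborel (\<lambda>y. ennreal (2 * exp (- 2 * y)))) {x<..} =
        (\<integral>\<^sup>+y. ennreal (2 * exp (- 2 * y)) * indicator {x<..} y \<partial>lborel)"
    by (subst emeasure_density) auto
  also have "\<dots> = (\<integral>\<^sup>+y. ennreal (2 * exp (- 2 * y)) * indicator {x..} y \<partial>lborel)"
    using AE_lborel_singleton[of x] by (intro nn_integral_cong_AE) (auto simp: indicator_def)
  also have "\<dots> = ennreal (0 - (- exp (- 2 * x)))"
  proof (rule nn_integral_FTC_atLeast)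
    show "((\<lambda>a. - exp (- 2 * a)) \<longlongrightarrow> (0::real)) at_top" by real_asymp
  qed (auto intro!: derivative_eq_intros)
  finally have "emeasure (density lborel (\<lambda>y. ennreal (2 * exp (- 2 * y)))) {x<..} = ennreal (exp (- 2 * x))" by simp
  with L show "emeasure (distr area borel (\<lambda>z. - ln (cmod z))) {x<..} =
    emeasure (density lborel (\<lambda>y. ennreal (2 * exp (- 2 * y)))) {x<..}" by simp
  show "emeasure (distr area borel (\<lambda>z. - ln (cmod z))) {x<..} < \<infinity>" using L by simp
qed auto

text \<open>The limit is taken at the punctured point, so that \<open>f z\<close> may differ from \<open>l\<close>. This matters at the
  origin, where a potential is only lower semicontinuous.\<close>

lemma ball_average_tendsto:
  fixes f :: "complex \<Rightarrow> real"
  assumes [measurable]: "f \<in> borel_measurable borel" and lim: "(f \<longlongrightarrow> l) (at z)"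
  shows "((\<lambda>\<delta>. (\<integral>w. f w * indicator (ball z \<delta>) w \<partial>area) / \<delta>\<^sup>2) \<longlongrightarrow> l) (at_right 0)"
proof (rule tendstoI)
  fix e :: real assume e: "e > 0"
  obtain d where d: "d > 0" and fd: "\<And>w. w \<noteq> z \<Longrightarrow> dist w z < d \<Longrightarrow> \<bar>f w - l\<bar> < e / 2"
    using lim[THEN tendstoD, of "e / 2"] e by (auto simp: eventually_at dist_real_def)
  have ae: "AE w in area. w \<noteq> z"
    using AE_lborel_singleton[of z] unfolding area_def by (subst AE_density) auto
  have "dist ((\<integral>w. f w * indicator (ball z \<delta>) w \<partial>area) / \<delta>\<^sup>2) l < e" if \<delta>: "0 < \<delta>" "\<delta> < d" for \<delta>
  proof -
    let ?iB = "indicator (ball z \<delta>) :: complex \<Rightarrow> real"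
    have fin: "emeasure area (ball z \<delta>) = ennreal (\<delta>\<^sup>2)" using \<delta> by (simp add: emeasure_area_ball)
    have intB: "integrable area ?iB" using fin by (simp add: integrable_indicator_iff)
    have mB: "measure area (ball z \<delta>) = \<delta>\<^sup>2" using fin by (simp add: measure_def)
    have bnd: "AE w in area. norm ((f w - l) * ?iB w) \<le> norm (e / 2 * ?iB w)"
      using ae by eventually_elim (use fd \<delta> e in \<open>force simp: indicator_def dist_commute\<close>)
    have i1: "integrable area (\<lambda>w. (f w - l) * ?iB w)"
      by (rule Bochner_Integration.integrable_bound[OF _ _ bnd]) (use intB in auto)
    have il: "integrable area (\<lambda>w. l * ?iB w)" using intB by auto
    have "(\<integral>w. f w * ?iB w \<partial>area) = (\<integral>w. (f w - l) * ?iB w + l * ?iB w \<partial>area)"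
      by (simp add: algebra_simps)
    also have "\<dots> = (\<integral>w. (f w - l) * ?iB w \<partial>area) + l * \<delta>\<^sup>2"
      using i1 il mB by (subst Bochner_Integration.integral_add) auto
    finally have eq: "(\<integral>w. f w * ?iB w \<partial>area) - l * \<delta>\<^sup>2 = (\<integral>w. (f w - l) * ?iB w \<partial>area)" by simp
    have "norm (\<integral>w. (f w - l) * ?iB w \<partial>area) \<le> (\<integral>w. norm ((f w - l) * ?iB w) \<partial>area)"
      by (rule integral_norm_bound)
    also have "\<dots> \<le> (\<integral>w. e / 2 * ?iB w \<partial>area)"
      using i1 intB bnd e by (intro integral_mono_AE integrable_norm) (auto simp: abs_mult)
    also have "\<dots> = e / 2 * \<delta>\<^sup>2" using mB by simp
    finally have "\<bar>(\<integral>w. f w * ?iB w \<partial>area) - l * \<delta>\<^sup>2\<bar> \<le> e / 2 * \<delta>\<^sup>2" by (simp add: eq)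
    then have "\<bar>(\<integral>w. f w * ?iB w \<partial>area) / \<delta>\<^sup>2 - l\<bar> \<le> e / 2"
      using \<delta> by (simp add: field_simps abs_if split: if_splits)
    then show ?thesis using e by (simp add: dist_real_def)
  qed
  then show "\<forall>\<^sub>F \<delta> in at_right 0. dist ((\<integral>w. f w * indicator (ball z \<delta>) w \<partial>area) / \<delta>\<^sup>2) l < e"
    using d by (auto simp: eventually_at_right_field)
qed

section \<open>The mean number of particles of a radial Gibbs measure\<close>

text \<open>Determinantal structure of the density \<open>|alternant|\<^sup>2\<close>. Each permutation contributes the product of all
  \<open>h a\<close>, with one factor \<open>h (\<sigma> i)\<close> replaced by the integral over \<open>B\<close>; after summation over \<open>i\<close>
  all permutations contribute the same amount.\<close>

lemma
  fixes e :: "nat \<Rightarrow> 'b \<Rightarrow> complex"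
  assumes sf: "sigma_finite_measure M"
    and int: "\<And>a b. a < n \<Longrightarrow> b < n \<Longrightarrow> integrable M (\<lambda>x. e a x * cnj (e b x))"
    and orth: "\<And>a b. a < n \<Longrightarrow> b < n \<Longrightarrow> a \<noteq> b \<Longrightarrow> (\<integral>x. e a x * cnj (e b x) \<partial>M) = 0"
    and h: "\<And>a. a < n \<Longrightarrow> h a = (\<integral>x. (cmod (e a x))\<^sup>2 \<partial>M)" "\<And>a. a < n \<Longrightarrow> h a > 0"
    and B: "B \<in> sets M" and n: "n > 0"
  shows integrable_alternant: "integrable (PiM {..<n} (\<lambda>_. M)) (\<lambda>x. (cmod (alternant n e x))\<^sup>2)"
    and integral_alternant: "(\<integral>x. (cmod (alternant n e x))\<^sup>2 \<partial>PiM {..<n} (\<lambda>_. M)) = fact n * (\<Prod>a<n. h a)"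
    and integral_alternant_count:
      "(\<integral>x. (cmod (alternant n e x))\<^sup>2 * (\<Sum>i<n. indicator B (x i)) \<partial>PiM {..<n} (\<lambda>_. M)) =
        fact n * (\<Prod>a<n. h a) * (\<Sum>a<n. (\<integral>x. (cmod (e a x))\<^sup>2 * indicator B x \<partial>M) / h a)"
proof -
  let ?P = "{\<sigma>. \<sigma> permutes {..<n}}" and ?PM = "PiM {..<n} (\<lambda>_. M)"
  have perm: "\<sigma> j < n" if "\<sigma> \<in> ?P" "j < n" for \<sigma> j
    using that permutes_in_image[of \<sigma> "{..<n}" j] by auto
  have card: "real (card ?P) = fact n" using card_permutations[of "{..<n}" n] by simp
  have prodh: "(\<Prod>j<n. h (\<sigma> j)) = (\<Prod>a<n. h a)" if "\<sigma> \<in> ?P" for \<sigma>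
    using prod.permute[of \<sigma> "{..<n}" h] that by (simp add: o_def)
  have single1: "integrable ?PM (\<lambda>x. (cmod (alternant n e x))\<^sup>2 * indicator C (x i))"
    and single2: "(\<integral>x. (cmod (alternant n e x))\<^sup>2 * indicator C (x i) \<partial>?PM) =
      (\<Sum>\<sigma>\<in>?P. \<Prod>j<n. \<integral>x. (cmod (e (\<sigma> j) x))\<^sup>2 * (if j = i then indicator C x else 1) \<partial>M)"
    if "i < n" "C \<in> sets M" for i C
    by (rule integral_alternant_indicator[OF sf _ _ that]; rule int orth; assumption)+
  have cong: "(cmod (alternant n e x))\<^sup>2 * indicator (space M) (x 0) = (cmod (alternant n e x))\<^sup>2"
    if "x \<in> space ?PM" for x
    using that n by (auto simp: space_PiM PiE_def Pi_def)
  have "integrable ?PM (\<lambda>x. (cmod (alternant n e x))\<^sup>2 * indicator (space M) (x 0)) \<longleftrightarrow>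
      integrable ?PM (\<lambda>x. (cmod (alternant n e x))\<^sup>2)"
    by (rule Bochner_Integration.integrable_cong[OF refl cong])
  then show "integrable ?PM (\<lambda>x. (cmod (alternant n e x))\<^sup>2)" using single1[OF n sets.top] by simp
  have "(\<integral>x. (cmod (alternant n e x))\<^sup>2 \<partial>?PM) = (\<integral>x. (cmod (alternant n e x))\<^sup>2 * indicator (space M) (x 0) \<partial>?PM)"
    by (rule Bochner_Integration.integral_cong[OF refl cong[symmetric]])
  also have "\<dots> = (\<Sum>\<sigma>\<in>?P. \<Prod>j<n. \<integral>x. (cmod (e (\<sigma> j) x))\<^sup>2 * (if j = 0 then indicator (space M) x else 1) \<partial>M)"
    by (rule single2[OF n sets.top])
  also have "\<dots> = (\<Sum>\<sigma>\<in>?P. \<Prod>a<n. h a)"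
  proof (rule sum.cong[OF refl])
    fix \<sigma> assume s: "\<sigma> \<in> ?P"
    have "(\<Prod>j<n. \<integral>x. (cmod (e (\<sigma> j) x))\<^sup>2 * (if j = 0 then indicator (space M) x else 1) \<partial>M) = (\<Prod>j<n. h (\<sigma> j))"
      using h(1) perm[OF s] by (intro prod.cong refl) (auto intro!: Bochner_Integration.integral_cong)
    then show "(\<Prod>j<n. \<integral>x. (cmod (e (\<sigma> j) x))\<^sup>2 * (if j = 0 then indicator (space M) x else 1) \<partial>M) = (\<Prod>a<n. h a)"
      using prodh[OF s] by simp
  qed
  also have "\<dots> = fact n * (\<Prod>a<n. h a)" using card by simp
  finally show "(\<integral>x. (cmod (alternant n e x))\<^sup>2 \<partial>?PM) = fact n * (\<Prod>a<n. h a)" .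
  define b where "b a = (\<integral>x. (cmod (e a x))\<^sup>2 * indicator B x \<partial>M)" for a
  have one: "(\<integral>x. (cmod (alternant n e x))\<^sup>2 * indicator B (x i) \<partial>?PM) = (\<Sum>\<sigma>\<in>?P. (\<Prod>a<n. h a) * (b (\<sigma> i) / h (\<sigma> i)))"
    if i: "i < n" for i
    unfolding single2[OF i B]
  proof (rule sum.cong[OF refl])
    fix \<sigma> assume s: "\<sigma> \<in> ?P"
    have "(\<Prod>j<n. \<integral>x. (cmod (e (\<sigma> j) x))\<^sup>2 * (if j = i then indicator B x else 1) \<partial>M) =
        (\<Prod>j<n. h (\<sigma> j) * (if j = i then b (\<sigma> i) / h (\<sigma> i) else 1))"
    proof (intro prod.cong refl)
      fix j assume "j \<in> {..<n}"
      then show "(\<integral>x. (cmod (e (\<sigma> j) x))\<^sup>2 * (if j = i then indicator B x else 1) \<partial>M) =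
          h (\<sigma> j) * (if j = i then b (\<sigma> i) / h (\<sigma> i) else 1)"
        using h(1)[of "\<sigma> j"] h(2)[of "\<sigma> j"] perm[OF s, of j] by (cases "j = i") (auto simp: b_def)
    qed
    also have "\<dots> = (\<Prod>a<n. h a) * (b (\<sigma> i) / h (\<sigma> i))"
      unfolding prod.distrib prodh[OF s] using i by (simp add: prod.delta)
    finally show "(\<Prod>j<n. \<integral>x. (cmod (e (\<sigma> j) x))\<^sup>2 * (if j = i then indicator B x else 1) \<partial>M) =
        (\<Prod>a<n. h a) * (b (\<sigma> i) / h (\<sigma> i))" .
  qed
  have "(\<integral>x. (cmod (alternant n e x))\<^sup>2 * (\<Sum>i<n. indicator B (x i)) \<partial>?PM) =
      (\<Sum>i<n. \<integral>x. (cmod (alternant n e x))\<^sup>2 * indicator B (x i) \<partial>?PM)"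
    unfolding sum_distrib_left by (rule Bochner_Integration.integral_sum) (rule single1[OF _ B], simp)
  also have "\<dots> = (\<Sum>i<n. \<Sum>\<sigma>\<in>?P. (\<Prod>a<n. h a) * (b (\<sigma> i) / h (\<sigma> i)))" using one by simp
  also have "\<dots> = (\<Sum>\<sigma>\<in>?P. \<Sum>i<n. (\<Prod>a<n. h a) * (b (\<sigma> i) / h (\<sigma> i)))" by (rule sum.swap)
  also have "\<dots> = (\<Sum>\<sigma>\<in>?P. (\<Prod>a<n. h a) * (\<Sum>a<n. b a / h a))"
  proof (rule sum.cong[OF refl])
    fix \<sigma> assume s: "\<sigma> \<in> ?P"
    then have "(\<Sum>i<n. b (\<sigma> i) / h (\<sigma> i)) = (\<Sum>a<n. b a / h a)"
      using sum.permute[of \<sigma> "{..<n}" "\<lambda>a. b a / h a"] by (simp add: o_def)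
    then show "(\<Sum>i<n. (\<Prod>a<n. h a) * (b (\<sigma> i) / h (\<sigma> i))) = (\<Prod>a<n. h a) * (\<Sum>a<n. b a / h a)"
      by (simp only: sum_distrib_left[symmetric])
  qed
  also have "\<dots> = fact n * (\<Prod>a<n. h a) * (\<Sum>a<n. b a / h a)" using card by simp
  finally show "(\<integral>x. (cmod (alternant n e x))\<^sup>2 * (\<Sum>i<n. indicator B (x i)) \<partial>?PM) =
        fact n * (\<Prod>a<n. h a) * (\<Sum>a<n. (\<integral>x. (cmod (e a x))\<^sup>2 * indicator B x \<partial>M) / h a)"
    by (simp only: b_def)
qed

lemma prod_off_diagonal:
  fixes d :: "nat \<Rightarrow> nat \<Rightarrow> 'a::comm_monoid_mult"
  assumes sym: "\<And>j k. d j k = d k j"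
  shows "(\<Prod>j<n. \<Prod>k\<in>{..<n} - {j}. d j k) = (\<Prod>j<n. \<Prod>k<j. d j k * d j k)"
proof (induction n)
  case (Suc n)
  have "(\<Prod>k\<in>{..<Suc n} - {j}. d j k) = d j n * (\<Prod>k\<in>{..<n} - {j}. d j k)" if "j < n" for j
  proof -
    have "{..<Suc n} - {j} = insert n ({..<n} - {j})" using that by auto
    then show ?thesis by simp
  qed
  then have "(\<Prod>j<n. \<Prod>k\<in>{..<Suc n} - {j}. d j k) = (\<Prod>j<n. d j n * (\<Prod>k\<in>{..<n} - {j}. d j k))" by simp
  moreover have "{..<Suc n} - {n} = {..<n}" by auto
  moreover have "(\<Prod>j<n. d j n) = (\<Prod>j<n. d n j)" by (intro prod.cong refl) (rule sym)
  ultimately show ?case using Suc.IH by (simp add: prod.distrib mult_ac)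
qed simp

definition boltzmann_weight :: "nat \<Rightarrow> (complex \<Rightarrow> ereal) \<Rightarrow> complex \<Rightarrow> real" where
  "boltzmann_weight N W z = (if W z = \<infinity> then 0 else exp (- (real N * real_of_ereal (W z))))"

lemma boltzmann_weight_nonneg: "boltzmann_weight N W z \<ge> 0"
  by (simp add: boltzmann_weight_def)

lemma exp_minus_infinity: "exp_minus \<infinity> = 0"
  by (simp only: exp_minus_def infinity_ereal_def ereal.case)

text \<open>Every unordered pair occurs twice in the double sum over the logarithmic kernel, which produces the
  square of the Vandermonde determinant. For coinciding points, and at points of infinite potential,
  the energy is infinite and the right-hand side has a zero factor.\<close>

lemma exp_minus_hamiltonian:
  assumes N: "N > 0" and W: "\<And>z. W z \<noteq> - \<infinity>"
  shows "exp_minus (hamiltonian N W \<zeta>) =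
    ennreal ((cmod (vandermonde N \<zeta>))\<^sup>2 * (\<Prod>j<N. boltzmann_weight N W (\<zeta> j)))"
proof -
  consider (coincide) i j where "i < j" "j < N" "\<zeta> j = \<zeta> i"
    | (infinite) j where "j < N" "W (\<zeta> j) = \<infinity>"
    | (finite) "\<And>i j. i < N \<Longrightarrow> j < N \<Longrightarrow> i \<noteq> j \<Longrightarrow> \<zeta> i \<noteq> \<zeta> j" "\<And>j. j < N \<Longrightarrow> W (\<zeta> j) \<noteq> \<infinity>"
  proof (cases "(\<exists>i j. i < j \<and> j < N \<and> \<zeta> j = \<zeta> i) \<or> (\<exists>j<N. W (\<zeta> j) = \<infinity>)")
    case True
    then show thesis using that(1,2) by blast
  next
    case False
    have "\<zeta> i \<noteq> \<zeta> j" if "i < N" "j < N" "i \<noteq> j" for i j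
    proof (cases "i < j")
      case True
      then show ?thesis using False \<open>j < N\<close> by (metis (no_types))
    next
      case ij: False
      then have "j < i" using that by simp
      then show ?thesis using False \<open>i < N\<close> by (metis (no_types))
    qed
    moreover have "W (\<zeta> j) \<noteq> \<infinity>" if "j < N" for j using False that by blast
    ultimately show thesis by (rule that(3))
  qed
  then show ?thesis
  proof cases
    case (coincide i j)
    have "i \<in> {..<N} - {j}" "log_kernel (\<zeta> j) (\<zeta> i) = \<infinity>" using coincide by (auto simp: log_kernel_def)
    then have "(\<Sum>k\<in>{..<N} - {j}. log_kernel (\<zeta> j) (\<zeta> k)) = \<infinity>" unfolding sum_Pinfty by blast
    then have "(\<Sum>j<N. \<Sum>k\<in>{..<N} - {j}. log_kernel (\<zeta> j) (\<zeta> k)) = \<infinity>"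
      using coincide(2) by (subst sum_Pinfty) blast
    then have "hamiltonian N W \<zeta> = \<infinity>" by (simp add: hamiltonian_def)
    moreover have "vandermonde N \<zeta> = 0"
      unfolding vandermonde_eq_0_iff using coincide by metis
    ultimately show ?thesis by (simp add: exp_minus_infinity)
  next
    case (infinite j)
    then have "(\<Sum>j<N. W (\<zeta> j)) = \<infinity>" by (subst sum_Pinfty) blast
    then have "hamiltonian N W \<zeta> = \<infinity>" using N by (simp add: hamiltonian_def)
    moreover have "(\<Prod>j<N. boltzmann_weight N W (\<zeta> j)) = 0"
      using infinite by (intro prod_zero bexI[of _ j]) (auto simp: boltzmann_weight_def)
    ultimately show ?thesis by (simp only: exp_minus_infinity mult_zero_right ennreal_0)
  next
    case finite
    define V where "V j = real_of_ereal (W (\<zeta> j))" for j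
    have V: "W (\<zeta> j) = ereal (V j)" if "j < N" for j
      using finite(2)[OF that] W[of "\<zeta> j"] by (cases "W (\<zeta> j)") (auto simp: V_def)
    let ?d = "\<lambda>j k. cmod (\<zeta> j - \<zeta> k)"
    have "log_kernel (\<zeta> j) (\<zeta> k) = ereal (- ln (?d j k))" if "j < N" "k \<in> {..<N} - {j}" for j k
      using that finite(1)[of j k] by (auto simp: log_kernel_def ln_div)
    then have H: "hamiltonian N W \<zeta> = ereal ((\<Sum>j<N. \<Sum>k\<in>{..<N} - {j}. - ln (?d j k)) + real N * (\<Sum>j<N. V j))"
      unfolding hamiltonian_def by (simp add: V)
    have "exp (- ((\<Sum>j<N. \<Sum>k\<in>{..<N} - {j}. - ln (?d j k)) + real N * (\<Sum>j<N. V j))) =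
        exp (\<Sum>j<N. \<Sum>k\<in>{..<N} - {j}. ln (?d j k)) * exp (\<Sum>j<N. - (real N * V j))"
      by (simp add: exp_add[symmetric] sum_negf sum_distrib_left)
    also have "exp (\<Sum>j<N. \<Sum>k\<in>{..<N} - {j}. ln (?d j k)) = (\<Prod>j<N. \<Prod>k\<in>{..<N} - {j}. ?d j k)"
      using finite(1) by (simp add: exp_sum)
    also have "\<dots> = (\<Prod>j<N. \<Prod>k<j. ?d j k * ?d j k)" by (rule prod_off_diagonal) (rule norm_minus_commute)
    also have "\<dots> = (cmod (vandermonde N \<zeta>))\<^sup>2"
      by (simp add: vandermonde_def prod_norm[symmetric] power2_eq_square prod.distrib)
    also have "exp (\<Sum>j<N. - (real N * V j)) = (\<Prod>j<N. boltzmann_weight N W (\<zeta> j))"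
      using finite(2) by (simp add: exp_sum boltzmann_weight_def V_def)
    finally show ?thesis unfolding H by (simp add: exp_minus_def)
  qed
qed

text \<open>One square root of the weight is attached to each of the two determinants in \<open>|alternant|\<^sup>2\<close>, so
  that these functions are orthogonal for the area measure itself.\<close>

definition weighted_monomial :: "(complex \<Rightarrow> real) \<Rightarrow> nat \<Rightarrow> complex \<Rightarrow> complex" where
  "weighted_monomial \<omega> k z = z ^ k * of_real (sqrt (\<omega> z))"

lemma cmod_weighted_monomial_square:
  "\<omega> z \<ge> 0 \<Longrightarrow> (cmod (weighted_monomial \<omega> k z))\<^sup>2 = cmod z ^ (2 * k) * \<omega> z"
  by (simp add: weighted_monomial_def norm_mult norm_power power_mult_distrib power_mult[symmetric] mult.commute)

lemma alternant_weighted_monomial: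
  "alternant n (weighted_monomial \<omega>) x = vandermonde n x * (\<Prod>j<n. of_real (sqrt (\<omega> (x j))))"
  by (simp add: alternant_def weighted_monomial_def prod.distrib vandermonde_eq_alternating_sum sum_distrib_right mult.assoc)

lemma exp_minus_hamiltonian_alternant:
  assumes "N > 0" "\<And>z. W z \<noteq> - \<infinity>"
  shows "exp_minus (hamiltonian N W \<zeta>) =
    ennreal ((cmod (alternant N (weighted_monomial (boltzmann_weight N W)) \<zeta>))\<^sup>2)"
  unfolding exp_minus_hamiltonian[OF assms] alternant_weighted_monomial
  by (simp add: norm_mult prod_norm[symmetric] power_mult_distrib prod_power_distrib boltzmann_weight_nonneg)

text \<open>The one-point intensity: the normalization \<open>fact N * (\<Prod>k<N. h k)\<close> cancels against the same factor in
  the mean.\<close>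

lemma gibbs_mean_count:
  assumes N: "N > 0" and W: "\<And>z. W z \<noteq> - \<infinity>" and meas: "W \<in> borel_measurable borel"
    and rad: "\<And>a z. cmod a = 1 \<Longrightarrow> W (a * z) = W z"
    and int: "\<And>k. k < N \<Longrightarrow> integrable area (\<lambda>z. cmod z ^ (2 * k) * boltzmann_weight N W z)"
    and h: "\<And>k. k < N \<Longrightarrow> h k = (\<integral>z. cmod z ^ (2 * k) * boltzmann_weight N W z \<partial>area)"
           "\<And>k. k < N \<Longrightarrow> h k > 0"
    and B: "B \<in> sets borel"
  shows "(\<integral>\<zeta>. real (card {j. j < N \<and> \<zeta> j \<in> B}) \<partial>gibbs N W) =
    (\<integral>z. (\<Sum>k<N. cmod z ^ (2 * k) * boltzmann_weight N W z / h k) * indicator B z \<partial>area)"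
proof -
  let ?\<omega> = "boltzmann_weight N W"
  let ?e = "weighted_monomial ?\<omega>"
  have \<omega>m[measurable]: "?\<omega> \<in> borel_measurable borel"
    unfolding boltzmann_weight_def[abs_def] using meas by measurable
  have em[measurable]: "?e k \<in> borel_measurable borel" for k
    unfolding weighted_monomial_def[abs_def] by measurable
  have prod: "?e a z * cnj (?e b z) = z ^ a * cnj (z ^ b) * of_real (?\<omega> z)" for a b z
  proof -
    have "complex_of_real (sqrt (?\<omega> z)) * complex_of_real (sqrt (?\<omega> z)) = of_real (?\<omega> z)"
      by (simp only: of_real_mult[symmetric]) (simp add: boltzmann_weight_nonneg)
    then show ?thesis by (simp add: weighted_monomial_def mult_ac)
  qed
  have sq: "(cmod (?e k z))\<^sup>2 = cmod z ^ (2 * k) * ?\<omega> z" for k z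
    by (rule cmod_weighted_monomial_square) (rule boltzmann_weight_nonneg)
  have inte: "integrable area (\<lambda>z. ?e a z * cnj (?e b z))" if "a < N" "b < N" for a b
  proof (rule Bochner_Integration.integrable_bound[OF Bochner_Integration.integrable_add[OF int[OF that(1)] int[OF that(2)]]])
    show "(\<lambda>z. ?e a z * cnj (?e b z)) \<in> borel_measurable area"
      by measurable
    have "norm (?e a z * cnj (?e b z)) \<le> norm (cmod z ^ (2 * a) * ?\<omega> z + cmod z ^ (2 * b) * ?\<omega> z)" for z
    proof -
      \<comment> \<open>mixed products are integrable because the diagonal ones are\<close>
      have "cmod (?e a z) * cmod (?e b z) \<le> (cmod (?e a z))\<^sup>2 + (cmod (?e b z))\<^sup>2"
        using sum_squares_bound[of "cmod (?e a z)" "cmod (?e b z)"]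
          mult_nonneg_nonneg[OF norm_ge_zero[of "?e a z"] norm_ge_zero[of "?e b z"]] by linarith
      then show ?thesis unfolding sq by (simp add: norm_mult boltzmann_weight_nonneg)
    qed
    then show "AE z in area. norm (?e a z * cnj (?e b z)) \<le> norm (cmod z ^ (2 * a) * ?\<omega> z + cmod z ^ (2 * b) * ?\<omega> z)"
      by simp
  qed
  have orth: "(\<integral>z. ?e a z * cnj (?e b z) \<partial>area) = 0" if "a \<noteq> b" for a b
    unfolding prod by (rule integral_monomials_radial_weight[OF \<omega>m _ that]) (simp add: boltzmann_weight_def rad)
  have h': "h k = (\<integral>z. (cmod (?e k z))\<^sup>2 \<partial>area)" if "k < N" for k unfolding sq by (rule h(1)[OF that])
  have B': "B \<in> sets area" using B by simp
  let ?p = "\<lambda>\<zeta>. (cmod (alternant N ?e \<zeta>))\<^sup>2"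
  let ?PM = "PiM {..<N} (\<lambda>_. area)"
  have alt1: "integrable ?PM ?p"
    by (rule integrable_alternant[OF sigma_finite_area _ _ _ _ B' N]) (use inte orth h' h(2) in auto)
  have alt2: "(\<integral>\<zeta>. ?p \<zeta> \<partial>?PM) = fact N * (\<Prod>k<N. h k)"
    by (rule integral_alternant[OF sigma_finite_area _ _ _ _ B' N]) (use inte orth h' h(2) in auto)
  have alt3: "(\<integral>\<zeta>. ?p \<zeta> * (\<Sum>i<N. indicator B (\<zeta> i)) \<partial>?PM) =
        fact N * (\<Prod>k<N. h k) * (\<Sum>k<N. (\<integral>z. (cmod (?e k z))\<^sup>2 * indicator B z \<partial>area) / h k)"
    by (rule integral_alternant_count[OF sigma_finite_area _ _ _ _ B' N]) (use inte orth h' h(2) in auto)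
  define Z where "Z = fact N * (\<Prod>k<N. h k)"
  have Z: "Z > 0" unfolding Z_def using h(2) by (intro mult_pos_pos prod_pos) auto
  have ip: "integrable ?PM ?p" by (rule alt1)
  have expH: "exp_minus (hamiltonian N W \<zeta>) = ennreal (?p \<zeta>)" for \<zeta>
    by (rule exp_minus_hamiltonian_alternant[OF N W])
  have pf: "partition_function N W = ennreal Z"
    unfolding partition_function_def area_power_def expH Z_def using alt2
    by (subst nn_integral_eq_integral[OF ip]) auto
  have gibbs: "gibbs N W = density ?PM (\<lambda>\<zeta>. ennreal (?p \<zeta> / Z))"
    unfolding gibbs_def area_power_def pf expH using Z by (simp add: divide_ennreal)
  have count: "real (card {j. j < N \<and> \<zeta> j \<in> B}) = (\<Sum>i<N. indicator B (\<zeta> i))" for \<zeta> :: "nat \<Rightarrow> complex"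
  proof -
    have "(\<Sum>i<N. indicator B (\<zeta> i)) = (\<Sum>i\<in>{..<N}. if \<zeta> i \<in> B then 1 else (0::real))"
      by (intro sum.cong refl) (simp add: indicator_def)
    also have "\<dots> = real (card {j \<in> {..<N}. \<zeta> j \<in> B})" by (simp add: sum.If_cases Int_def)
    finally show ?thesis by simp
  qed
  have "(\<integral>\<zeta>. real (card {j. j < N \<and> \<zeta> j \<in> B}) \<partial>gibbs N W) = (\<integral>\<zeta>. (?p \<zeta> / Z) *\<^sub>R (\<Sum>i<N. indicator B (\<zeta> i)) \<partial>?PM)"
    unfolding gibbs count
  proof (rule integral_density)
    have "(\<lambda>\<zeta>. indicator B (\<zeta> i) :: real) \<in> borel_measurable ?PM" if "i < N" for i
    proof -
      have "(\<lambda>\<zeta>. \<zeta> i) \<in> measurable ?PM area"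
        by (rule measurable_component_singleton[where M = "\<lambda>_. area"]) (use that in simp)
      then show ?thesis by (rule measurable_compose[OF _ borel_measurable_indicator[OF B']])
    qed
    then show "(\<lambda>\<zeta>. \<Sum>i<N. indicator B (\<zeta> i) :: real) \<in> borel_measurable ?PM"
      by (intro borel_measurable_sum) auto
  qed (use ip Z in auto)
  also have "\<dots> = (\<integral>\<zeta>. ?p \<zeta> * (\<Sum>i<N. indicator B (\<zeta> i)) / Z \<partial>?PM)" by simp
  also have "\<dots> = (\<integral>\<zeta>. ?p \<zeta> * (\<Sum>i<N. indicator B (\<zeta> i)) \<partial>?PM) / Z" by (rule integral_divide_zero)
  also have "\<dots> = (\<Sum>k<N. (\<integral>z. cmod z ^ (2 * k) * ?\<omega> z * indicator B z \<partial>area) / h k)"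
    unfolding alt3 sq Z_def[symmetric] using Z by simp
  also have "\<dots> = (\<Sum>k<N. \<integral>z. cmod z ^ (2 * k) * ?\<omega> z / h k * indicator B z \<partial>area)"
    unfolding times_divide_eq_left by (simp only: integral_divide_zero)
  also have "\<dots> = (\<integral>z. (\<Sum>k<N. cmod z ^ (2 * k) * ?\<omega> z / h k * indicator B z) \<partial>area)"
  proof (rule Bochner_Integration.integral_sum[symmetric])
    fix k assume "k \<in> {..<N}"
    then have "integrable area (\<lambda>z. indicator B z *\<^sub>R (cmod z ^ (2 * k) * ?\<omega> z / h k))"
      using int[of k] B' by (intro integrable_mult_indicator) auto
    then show "integrable area (\<lambda>z. cmod z ^ (2 * k) * ?\<omega> z / h k * indicator B z)" by (simp add: mult.commute)
  qed
  finally show ?thesis by (simp only: sum_distrib_right)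
qed

text \<open>The event that a rescaled particle lies in a disc about \<open>w\<close> is the event that the particle itself lies
  in a disc about \<open>q + w / \<alpha>\<close> whose radius is divided by \<open>|\<alpha>|\<close>.\<close>

lemma scaled_mean_count_tendsto:
  assumes N: "N > 0" and W: "\<And>z. W z \<noteq> - \<infinity>" and meas: "W \<in> borel_measurable borel"
    and rad: "\<And>a z. cmod a = 1 \<Longrightarrow> W (a * z) = W z"
    and int: "\<And>k. k < N \<Longrightarrow> integrable area (\<lambda>z. cmod z ^ (2 * k) * boltzmann_weight N W z)"
    and h: "\<And>k. k < N \<Longrightarrow> h k = (\<integral>z. cmod z ^ (2 * k) * boltzmann_weight N W z \<partial>area)"
           "\<And>k. k < N \<Longrightarrow> h k > 0"
    and \<alpha>: "\<alpha> \<noteq> 0"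
    and lim: "((\<lambda>z. \<Sum>k<N. cmod z ^ (2 * k) * boltzmann_weight N W z / h k) \<longlongrightarrow> l) (at (q + w / \<alpha>))"
  shows "(scaled_mean_count (gibbs N W) N (\<lambda>j \<zeta>. \<alpha> * (\<zeta> j - q)) w \<longlongrightarrow> l / (cmod \<alpha>)\<^sup>2) (at_right 0)"
proof -
  let ?K = "\<lambda>z. \<Sum>k<N. cmod z ^ (2 * k) * boltzmann_weight N W z / h k"
  have Km: "?K \<in> borel_measurable borel"
    unfolding boltzmann_weight_def[abs_def] using meas by measurable
  have ball: "\<alpha> * (x - q) \<in> ball w \<epsilon> \<longleftrightarrow> x \<in> ball (q + w / \<alpha>) (\<epsilon> / cmod \<alpha>)" for x \<epsilon>
  proof -
    have "w - \<alpha> * (x - q) = \<alpha> * (q + w / \<alpha> - x)" using \<alpha> by (simp add: field_simps)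
    then have "dist w (\<alpha> * (x - q)) = cmod \<alpha> * dist (q + w / \<alpha>) x" by (simp add: dist_norm norm_mult)
    then show ?thesis using \<alpha> by (simp add: pos_less_divide_eq mult.commute)
  qed
  have eq: "scaled_mean_count (gibbs N W) N (\<lambda>j \<zeta>. \<alpha> * (\<zeta> j - q)) w \<epsilon> =
      (\<integral>z. ?K z * indicator (ball (q + w / \<alpha>) (\<epsilon> / cmod \<alpha>)) z \<partial>area) / (\<epsilon> / cmod \<alpha>)\<^sup>2 / (cmod \<alpha>)\<^sup>2" for \<epsilon>
  proof -
    have "(\<integral>\<zeta>. real (card {j. j < N \<and> \<zeta> j \<in> ball (q + w / \<alpha>) (\<epsilon> / cmod \<alpha>)}) \<partial>gibbs N W) =
        (\<integral>z. ?K z * indicator (ball (q + w / \<alpha>) (\<epsilon> / cmod \<alpha>)) z \<partial>area)"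
      by (rule gibbs_mean_count[OF N W meas]; (erule rad | erule int | erule h(1) | erule h(2) | simp))
    then show ?thesis unfolding scaled_mean_count_def ball using \<alpha> by (simp add: power_divide)
  qed
  have "((\<lambda>\<epsilon>. \<epsilon> / cmod \<alpha>) \<longlongrightarrow> 0 / cmod \<alpha>) (at_right 0)" using \<alpha> by (intro tendsto_intros) auto
  moreover have "\<forall>\<^sub>F \<epsilon> in at_right 0. \<epsilon> / cmod \<alpha> \<in> {0<..}"
    using \<alpha> by (auto simp: eventually_at_right_field intro!: exI[of _ 1])
  ultimately have "filterlim (\<lambda>\<epsilon>. \<epsilon> / cmod \<alpha>) (at_right 0) (at_right 0)"
    by (auto simp: filterlim_at elim!: eventually_mono)
  from filterlim_compose[OF ball_average_tendsto[OF Km lim] this]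
  have "((\<lambda>\<epsilon>. (\<integral>z. ?K z * indicator (ball (q + w / \<alpha>) (\<epsilon> / cmod \<alpha>)) z \<partial>area) / (\<epsilon> / cmod \<alpha>)\<^sup>2) \<longlongrightarrow> l) (at_right 0)" .
  then show ?thesis unfolding eq[abs_def] using \<alpha> by (intro tendsto_divide tendsto_const) auto
qed

section \<open>Radial subharmonic functions\<close>

text \<open>The mean value property of \<open>ln |z|\<close> away from the origin: the real part of the Cauchy integral formula
  for the holomorphic branch \<open>Ln (1 + u / z)\<close>.\<close>

lemma has_integral_ln_cmod_circle:
  assumes s: "0 < s" "s < cmod z"
  shows "((\<lambda>t. ln (cmod (z + of_real s * cis t))) has_integral (2 * pi * ln (cmod z))) {0..2 * pi}"
proof -
  define f where "f u = Ln (1 + u / z) + of_real (ln (cmod z))" for u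
  have z: "z \<noteq> 0" using s by auto
  have pos: "Re (1 + u / z) > 0" if "cmod u < cmod z" for u
  proof -
    have "cmod (u / z) < 1" using that z by (simp add: norm_divide)
    then have "Re (u / z) > -1" using abs_Re_le_cmod[of "u / z"] by linarith
    then show ?thesis by simp
  qed
  have "f holomorphic_on cball 0 s" unfolding f_def
    proof (intro holomorphic_intros)
    fix u :: complex assume "u \<in> cball 0 s"
    then have "Re (1 + u / z) > 0" using s pos by auto
    then show "1 + u / z \<notin> \<real>\<^sub>\<le>\<^sub>0" using complex_nonpos_Reals_iff by (metis not_le)
  qed (use z in auto)
  then have "((\<lambda>u. f u / (u - 0)) has_contour_integral (2 * of_real pi * \<i> * f 0)) (circlepath 0 s)"
    using s by (intro Cauchy_integral_circlepath_simple) auto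
  then have "((\<lambda>t. f (of_real s * cis t) / (of_real s * cis t) * of_real s * \<i> * cis t) has_integral (2 * of_real pi * \<i> * f 0)) {0..2 * pi}"
    unfolding circlepath_def by (subst (asm) has_contour_integral_part_circlepath_iff) auto
  then have "((\<lambda>t. \<i> * f (of_real s * cis t)) has_integral (2 * of_real pi * \<i> * f 0)) {0..2 * pi}"
    by (rule has_integral_eq[rotated]) (use s in \<open>auto simp: field_simps\<close>)
  then have "((Im \<circ> (\<lambda>t. \<i> * f (of_real s * cis t))) has_integral Im (2 * of_real pi * \<i> * f 0)) {0..2 * pi}"
    by (rule has_integral_linear) (rule bounded_linear_Im)
  then have "((\<lambda>t. Re (f (of_real s * cis t))) has_integral (2 * pi * ln (cmod z))) {0..2 * pi}"
    by (simp add: o_def f_def)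
  then show ?thesis
  proof (rule has_integral_eq[rotated])
    fix t
    have "cmod (of_real s * cis t) < cmod z" using s by (simp add: norm_mult)
    from pos[OF this] have nz: "1 + of_real s * cis t / z \<noteq> 0" by force
    have "Re (f (of_real s * cis t)) = ln (cmod (1 + of_real s * cis t / z) * cmod z)"
      using nz z by (simp add: f_def ln_mult)
    also have "cmod (1 + of_real s * cis t / z) * cmod z = cmod (z + of_real s * cis t)"
    proof -
      have "(1 + of_real s * cis t / z) * z = z + of_real s * cis t" using z by (simp add: distrib_right)
      then show ?thesis by (metis norm_mult)
    qed
    finally show "Re (f (of_real s * cis t)) = ln (cmod (z + of_real s * cis t))" .
  qed
qed

text \<open>Maximum principle. If \<open>g (exp t)\<close> exceeded a chord somewhere, the difference \<open>v\<close> would have a positive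
  maximum in the interior of an annulus. The chord is a harmonic function of \<open>z\<close>, being affine in
  \<open>ln |z|\<close>, so the mean of the difference over a small circle about a point of maximum is not below
  the maximum. Hence the difference is maximal on the whole circle, in particular at a smaller modulus,
  which is impossible at the leftmost point of maximum.\<close>

lemma radial_subharmonic_convex:
  fixes u :: "complex \<Rightarrow> real"
  assumes sub: "subharmonic_on (- {0}) u" and u: "\<And>z. z \<noteq> 0 \<Longrightarrow> u z = g (cmod z)"
    and cont: "continuous_on {0<..} g"
  shows "convex_on UNIV (\<lambda>t. g (exp t))"
proof (rule convex_onI)
  fix lam t1 t2 :: real assume lam: "0 < lam" "lam < 1"
  have main: "g (exp ((1 - lam) *\<^sub>R t1 + lam *\<^sub>R t2)) \<le> (1 - lam) * g (exp t1) + lam * g (exp t2)"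
    if lam: "0 < lam" "lam < 1" and less: "t1 < t2" for lam t1 t2 :: real
  proof (rule ccontr)
    assume neg: "\<not> ?thesis"
    define B where "B = (g (exp t2) - g (exp t1)) / (t2 - t1)"
    define v where "v t = g (exp t) - (g (exp t1) + B * (t - t1))" for t
    have contg: "continuous_on T (\<lambda>t. g (exp t))" for T :: "real set"
      by (rule continuous_on_compose2[OF cont]) (auto intro!: continuous_intros)
    have contv: "continuous_on {t1..t2} v" unfolding v_def by (intro continuous_intros contg)
    have v12: "v t1 = 0" "v t2 = 0" using less by (auto simp: v_def B_def)
    define t where "t = (1 - lam) * t1 + lam * t2"
    have tt: "t - t1 = lam * (t2 - t1)" by (simp add: t_def algebra_simps)
    have "g (exp t1) + B * (t - t1) = (1 - lam) * g (exp t1) + lam * g (exp t2)"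
      unfolding tt B_def using less by (simp add: field_simps)
    then have vt: "v t > 0" using neg by (simp add: v_def t_def)
    have tI: "t \<in> {t1..t2}"
    proof -
      have "0 \<le> lam * (t2 - t1)" "lam * (t2 - t1) \<le> t2 - t1"
        using lam less by (auto intro: mult_left_le_one_le)
      then show ?thesis using tt by auto
    qed
    obtain tm where tm: "tm \<in> {t1..t2}" "\<And>x. x \<in> {t1..t2} \<Longrightarrow> v x \<le> v tm"
      using continuous_attains_sup[OF _ _ contv] less by auto
    define M where "M = v tm"
    have M: "M > 0" using tm(2)[OF tI] vt by (simp add: M_def)
    \<comment> \<open>the points of maximum; the least of them is used\<close>
    define T where "T = {x \<in> {t1..t2}. v x = M}"
    have "closed T" unfolding T_def
      by (rule continuous_closed_preimage_constant[OF contv]) simp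
    moreover have "T \<subseteq> {t1..t2}" by (auto simp: T_def)
    ultimately have cT: "compact T" using compact_Int_closed[of "{t1..t2}" T] by (simp add: Int_absorb1)
    have nT: "T \<noteq> {}" using tm by (auto simp: T_def M_def)
    obtain t0 where t0T: "t0 \<in> T" and t0min: "\<forall>x\<in>T. t0 \<le> x"
      using compact_attains_inf[OF cT nT] by (elim bexE)
    have t0I: "t0 \<in> {t1..t2}" and vt0: "v t0 = M"
      using t0T[unfolded T_def mem_Collect_eq] by (rule conjunct1, rule conjunct2)
    have t0': "t1 < t0" "t0 < t2"
    proof -
      have "t0 \<noteq> t1" "t0 \<noteq> t2" using vt0 M v12 by (metis less_irrefl)+
      then show "t1 < t0" "t0 < t2" using t0I by simp_all
    qed
    \<comment> \<open>a radius for which the circle about \<open>exp t0\<close> stays in the closed annulus\<close>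
    define s where "s = min (exp t0 - exp t1) (exp t2 - exp t0)"
    have s: "0 < s" "exp t1 \<le> exp t0 - s" "exp t0 + s \<le> exp t2" 
    proof -
      have "s \<le> exp t0 - exp t1" "s \<le> exp t2 - exp t0" unfolding s_def by (rule min.cobounded1, rule min.cobounded2)
      then show "exp t1 \<le> exp t0 - s" "exp t0 + s \<le> exp t2" by linarith+
      show "0 < s" using t0' unfolding s_def by simp
    qed
    define z where "z = complex_of_real (exp t0)"
    have cz: "cmod z = exp t0" by (simp add: z_def)
    have sz: "s < cmod z" using s(2) cz exp_gt_zero[of t1] by linarith
    define r where "r \<tau> = cmod (z + of_real s * cis \<tau>)" for \<tau>
    have r: "exp t1 \<le> r \<tau>" "r \<tau> \<le> exp t2" for \<tau>
    proof -
      have "cmod (of_real s * cis \<tau>) = s" using s by (simp add: norm_mult)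
      then have "exp t0 - s \<le> r \<tau>" "r \<tau> \<le> exp t0 + s"
        unfolding r_def using cz norm_triangle_ineq[of z "of_real s * cis \<tau>"]
          norm_diff_ineq[of z "of_real s * cis \<tau>"] by auto
      then show "exp t1 \<le> r \<tau>" "r \<tau> \<le> exp t2" using s by auto
    qed
    have rpos: "r \<tau> > 0" for \<tau> using r(1)[of \<tau>] exp_gt_zero[of t1] by linarith
    have rne: "r \<tau> \<noteq> 0" for \<tau> using rpos[of \<tau>] by simp
    have lr: "ln (r \<tau>) \<in> {t1..t2}" for \<tau>
    proof -
      have "ln (exp t1) \<le> ln (r \<tau>)" "ln (r \<tau>) \<le> ln (exp t2)"
        using r[of \<tau>] rpos[of \<tau>] by (subst ln_le_cancel_iff; simp)+
      then show ?thesis by simp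
    qed
    have "cball z s \<subseteq> - {0}" using sz by (auto simp: dist_norm)
    have "u z \<le> 1 / (2 * pi) * integral {0..2 * pi} (\<lambda>\<tau>. u (z + of_real s * cis \<tau>))"
      and "(\<lambda>\<tau>. u (z + of_real s * cis \<tau>)) integrable_on {0..2 * pi}"
    proof -
      have "(\<lambda>\<tau>. u (z + of_real s * cis \<tau>)) absolutely_integrable_on {0..2 * pi} \<and>
          u z \<le> 1 / (2 * pi) * integral {0..2 * pi} (\<lambda>\<tau>. u (z + of_real s * cis \<tau>))"
        using sub \<open>cball z s \<subseteq> - {0}\<close> s(1) unfolding subharmonic_on_def by simp
      then show "u z \<le> 1 / (2 * pi) * integral {0..2 * pi} (\<lambda>\<tau>. u (z + of_real s * cis \<tau>))"
        and "(\<lambda>\<tau>. u (z + of_real s * cis \<tau>)) integrable_on {0..2 * pi}"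
        using set_lebesgue_integral_eq_integral(1) by auto
    qed
    moreover have ueq: "u (z + of_real s * cis \<tau>) = g (r \<tau>)" for \<tau>
      using u rpos[of \<tau>] by (auto simp: r_def)
    moreover have "u z = g (exp t0)" using u[of z] cz by (auto simp: z_def)
    ultimately have mean: "2 * pi * g (exp t0) \<le> integral {0..2 * pi} (\<lambda>\<tau>. g (r \<tau>))"
      and gi: "(\<lambda>\<tau>. g (r \<tau>)) integrable_on {0..2 * pi}"
      by (simp_all add: pos_le_divide_eq mult.commute)
    have cint: "((\<lambda>\<tau>. c) has_integral (2 * pi * c)) {0..2 * pi}" for c :: real
      using has_integral_const_real[of c 0 "2 * pi"] by simp
    have lnint: "((\<lambda>\<tau>. ln (r \<tau>)) has_integral (2 * pi * t0)) {0..2 * pi}"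
      using has_integral_ln_cmod_circle[OF s(1) sz] by (simp add: r_def cz)
    let ?h = "\<lambda>\<tau>. M - v (ln (r \<tau>))"
    have "((\<lambda>\<tau>. M - (g (r \<tau>) - (g (exp t1) + B * (ln (r \<tau>) - t1)))) has_integral
        (2 * pi * M - (integral {0..2 * pi} (\<lambda>\<tau>. g (r \<tau>)) - (2 * pi * g (exp t1) + B * (2 * pi * t0 - 2 * pi * t1))))) {0..2 * pi}"
      by (intro has_integral_diff has_integral_add has_integral_mult_right lnint integrable_integral gi cint)
    then have hint: "(?h has_integral (2 * pi * M - (integral {0..2 * pi} (\<lambda>\<tau>. g (r \<tau>)) - (2 * pi * g (exp t1) + B * (2 * pi * t0 - 2 * pi * t1))))) {0..2 * pi}"
      using rpos by (simp add: v_def)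
    have "M = g (exp t0) - (g (exp t1) + B * (t0 - t1))"
      using vt0 by (simp add: v_def)
    then have "2 * pi * M = 2 * pi * (g (exp t0) - (g (exp t1) + B * (t0 - t1)))" by simp
    also have "\<dots> = 2 * pi * g (exp t0) - (2 * pi * g (exp t1) + B * (2 * pi * t0 - 2 * pi * t1))"
      by (simp add: algebra_simps)
    finally have Mint: "2 * pi * M = 2 * pi * g (exp t0) - (2 * pi * g (exp t1) + B * (2 * pi * t0 - 2 * pi * t1))" .
    with mean Mint have le: "integral {0..2 * pi} ?h \<le> 0"
      using integral_unique[OF hint] by linarith
    have hnn: "?h \<tau> \<ge> 0" for \<tau> using tm(2)[OF lr[of \<tau>]] by (simp add: M_def)
    have hcont: "continuous_on {0..2 * pi} ?h"
    proof (intro continuous_intros continuous_on_compose2[OF contv])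
      show "continuous_on {0..2 * pi} r" unfolding r_def cis_conv_exp by (intro continuous_intros)
    qed (use rne lr in auto)
    have "integral {0..2 * pi} ?h \<ge> 0" using hnn by (intro integral_nonneg has_integral_integrable[OF hint]) auto
    then have "integral {0..2 * pi} ?h = 0" using le by simp
    then have "(?h has_integral 0) (cbox 0 (2 * pi))" using hint integral_unique[OF hint] by (simp add: box_real)
    then have "?h pi = 0"
      by (rule has_integral_0_cbox_imp_0[rotated 2]) (use hcont hnn in \<open>auto simp: box_real not_le\<close>)
    then have "ln (r pi) \<in> T" using lr[of pi] by (simp add: T_def)
    then have "t0 \<le> ln (r pi)" using t0min by blast
    moreover have "ln (r pi) < t0"
    proof -
      have "z + of_real s * cis pi = of_real (exp t0 - s)" by (simp add: z_def)
      then have "r pi = \<bar>exp t0 - s\<bar>" unfolding r_def by (metis norm_of_real real_norm_def)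
      then have "r pi < exp t0" using s sz cz by simp
      then have "ln (r pi) < ln (exp t0)" using rpos[of pi] by (subst ln_less_cancel_iff) auto
      then show ?thesis by simp
    qed
    ultimately show False by simp
  qed
  consider "t1 < t2" | "t1 = t2" | "t2 < t1" by linarith
  then show "g (exp ((1 - lam) *\<^sub>R t1 + lam *\<^sub>R t2)) \<le> (1 - lam) * g (exp t1) + lam * g (exp t2)"
  proof cases
    case 1 then show ?thesis using main[OF lam] by simp
  next
    case 2 then show ?thesis by (simp add: algebra_simps)
  next
    case 3 then show ?thesis using main[of "1 - lam" t2 t1] lam by (simp add: add.commute)
  qed
qed simp

section \<open>Absolutely continuous functions with a bounded derivative\<close>

lemma abs_continuous_on_intervalE:
  assumes ac: "abs_continuous_on_interval a b f" and e: "e > 0"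
  obtains d where "d > 0" "\<And>(n::nat) u v. (\<And>i. i < n \<Longrightarrow> a \<le> u i \<and> u i \<le> v i \<and> v i \<le> b) \<Longrightarrow>
        disjoint_family_on (\<lambda>i. {u i<..<v i}) {..<n} \<Longrightarrow>
        (\<Sum>i<n. v i - u i) < d \<Longrightarrow> (\<Sum>i<n. \<bar>f (v i) - f (u i)\<bar>) < e"
proof -
  have "\<exists>\<delta>>0. \<forall>(n::nat) u v.
        (\<forall>i<n. a \<le> u i \<and> u i \<le> v i \<and> v i \<le> b) \<and>
        disjoint_family_on (\<lambda>i. {u i<..<v i}) {..<n} \<and>
        (\<Sum>i<n. v i - u i) < \<delta> \<longrightarrow> (\<Sum>i<n. \<bar>f (v i) - f (u i)\<bar>) < e"
    using ac unfolding abs_continuous_on_interval_def by (rule allE[of _ e]) (use e in simp)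
  then obtain d where d: "d > 0" and D: "\<forall>(n::nat) u v.
        (\<forall>i<n. a \<le> u i \<and> u i \<le> v i \<and> v i \<le> b) \<and>
        disjoint_family_on (\<lambda>i. {u i<..<v i}) {..<n} \<and>
        (\<Sum>i<n. v i - u i) < d \<longrightarrow> (\<Sum>i<n. \<bar>f (v i) - f (u i)\<bar>) < e" by (elim exE conjE)
  show ?thesis by (rule that[OF d]) (intro D[THEN spec, THEN spec, THEN spec, THEN mp] conjI allI impI; blast)
qed

text \<open>The same modulus of continuity serves families indexed by an arbitrary finite set; tagged divisions
  are such families.\<close>

lemma abs_continuous_on_interval_finite_family:
  assumes ac: "abs_continuous_on_interval a b f" and e: "e > 0"
  obtains d where "d > 0" "\<And>I u v. finite (I :: 'i set) \<Longrightarrow>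
      (\<And>i. i \<in> I \<Longrightarrow> a \<le> u i \<and> u i \<le> v i \<and> v i \<le> b) \<Longrightarrow>
      disjoint_family_on (\<lambda>i. {u i<..<v i}) I \<Longrightarrow> (\<Sum>i\<in>I. v i - u i) < d \<Longrightarrow>
      (\<Sum>i\<in>I. \<bar>f (v i) - f (u i)\<bar>) < e"
proof -
  obtain d where d: "d > 0" and D: "\<And>(n::nat) u v. (\<And>i. i < n \<Longrightarrow> a \<le> u i \<and> u i \<le> v i \<and> v i \<le> b) \<Longrightarrow>
        disjoint_family_on (\<lambda>i. {u i<..<v i}) {..<n} \<Longrightarrow>
        (\<Sum>i<n. v i - u i) < d \<Longrightarrow> (\<Sum>i<n. \<bar>f (v i) - f (u i)\<bar>) < e"
    using abs_continuous_on_intervalE[OF ac e] by blast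
  show ?thesis
  proof (rule that[OF d])
    fix I :: "'i set" and u v
    assume fin: "finite I" and uv: "\<And>i. i \<in> I \<Longrightarrow> a \<le> u i \<and> u i \<le> v i \<and> v i \<le> b"
      and dis: "disjoint_family_on (\<lambda>i. {u i<..<v i}) I" and sm: "(\<Sum>i\<in>I. v i - u i) < d"
    obtain h where h: "bij_betw h {..<card I} I"
      using fin ex_bij_betw_nat_finite[of I] by (auto simp: atLeast0LessThan)
    have hI: "h i \<in> I" if "i < card I" for i using h that by (auto simp: bij_betw_def)
    have sums: "(\<Sum>i<card I. F (h i)) = (\<Sum>i\<in>I. F i)" for F :: "'i \<Rightarrow> real"
      by (rule sum.reindex_bij_betw[OF h])
    have "(\<Sum>i<card I. \<bar>f (v (h i)) - f (u (h i))\<bar>) < e"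
    proof (rule D)
      show "disjoint_family_on (\<lambda>i. {u (h i)<..<v (h i)}) {..<card I}"
        unfolding disjoint_family_on_def
      proof (intro ballI impI)
        fix m n assume mn: "m \<in> {..<card I}" "n \<in> {..<card I}" "m \<noteq> n"
        then have "h m \<noteq> h n" using h by (auto simp: bij_betw_def inj_on_def)
        with dis hI mn show "{u (h m)<..<v (h m)} \<inter> {u (h n)<..<v (h n)} = {}"
          unfolding disjoint_family_on_def by simp
      qed
      show "(\<Sum>i<card I. v (h i) - u (h i)) < d" using sums[of "\<lambda>i. v i - u i"] sm by simp
    qed (use uv hI in blast)
    then show "(\<Sum>i\<in>I. \<bar>f (v i) - f (u i)\<bar>) < e" using sums[of "\<lambda>i. \<bar>f (v i) - f (u i)\<bar>"] by simp
  qed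
qed

lemma abs_continuous_on_interval_subset:
  assumes "abs_continuous_on_interval a b f" "a \<le> c" "d \<le> b"
  shows "abs_continuous_on_interval c d f"
  unfolding abs_continuous_on_interval_def
proof (intro allI impI)
  fix e :: real assume "e > 0"
  obtain del where del: "del > 0" and D: "\<And>(n::nat) u v. (\<And>i. i < n \<Longrightarrow> a \<le> u i \<and> u i \<le> v i \<and> v i \<le> b) \<Longrightarrow>
        disjoint_family_on (\<lambda>i. {u i<..<v i}) {..<n} \<Longrightarrow>
        (\<Sum>i<n. v i - u i) < del \<Longrightarrow> (\<Sum>i<n. \<bar>f (v i) - f (u i)\<bar>) < e"
    using abs_continuous_on_intervalE[OF assms(1) \<open>e > 0\<close>] by blast
  show "\<exists>\<delta>>0. \<forall>(n::nat) u v.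
        (\<forall>i<n. c \<le> u i \<and> u i \<le> v i \<and> v i \<le> d) \<and>
        disjoint_family_on (\<lambda>i. {u i<..<v i}) {..<n} \<and>
        (\<Sum>i<n. v i - u i) < \<delta> \<longrightarrow> (\<Sum>i<n. \<bar>f (v i) - f (u i)\<bar>) < e"
  proof (intro exI[of _ del] conjI[OF del] allI impI, elim conjE)
    fix n :: nat and u v
    assume *: "\<forall>i<n. c \<le> u i \<and> u i \<le> v i \<and> v i \<le> d"
    have "a \<le> u i \<and> u i \<le> v i \<and> v i \<le> b" if "i < n" for i
      using *[rule_format, OF that] assms(2,3) by linarith
    then show "disjoint_family_on (\<lambda>i. {u i<..<v i}) {..<n} \<Longrightarrow> (\<Sum>i<n. v i - u i) < del \<Longrightarrow>
      (\<Sum>i<n. \<bar>f (v i) - f (u i)\<bar>) < e" by (rule D)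
  qed
qed

lemma abs_continuous_on_interval_imp_continuous:
  assumes ac: "abs_continuous_on_interval a b f"
  shows "continuous_on {a..b} f"
  unfolding continuous_on_iff
proof (intro ballI allI impI)
  fix x e :: real assume x: "x \<in> {a..b}" and "e > 0"
  obtain d where d: "d > 0" and D: "\<And>I u v. finite (I :: nat set) \<Longrightarrow>
      (\<And>i. i \<in> I \<Longrightarrow> a \<le> u i \<and> u i \<le> v i \<and> v i \<le> b) \<Longrightarrow>
      disjoint_family_on (\<lambda>i. {u i<..<v i}) I \<Longrightarrow> (\<Sum>i\<in>I. v i - u i) < d \<Longrightarrow>
      (\<Sum>i\<in>I. \<bar>f (v i) - f (u i)\<bar>) < e"
    by (rule abs_continuous_on_interval_finite_family[OF ac \<open>e > 0\<close>]) blast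
  have "dist (f y) (f x) < e" if y: "y \<in> {a..b}" "dist y x < d" for y
  proof -
    have "\<bar>f (max x y) - f (min x y)\<bar> < e"
      using D[of "{0}" "\<lambda>_. min x y" "\<lambda>_. max x y"] x y
      by (cases "x \<le> y") (auto simp: dist_real_def disjoint_family_on_def max_def min_def)
    then show ?thesis by (simp add: dist_real_def max_def min_def abs_minus_commute split: if_splits)
  qed
  with d show "\<exists>d>0. \<forall>x'\<in>{a..b}. dist x' x < d \<longrightarrow> dist (f x') (f x) < e" by blast
qed

lemma abs_continuous_on_interval_uminus:
  "abs_continuous_on_interval a b f \<Longrightarrow> abs_continuous_on_interval a b (\<lambda>x. - f x)"
  unfolding abs_continuous_on_interval_def by (simp add: abs_minus_commute)

lemma abs_continuous_on_interval_ident_mult: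
  assumes ac: "abs_continuous_on_interval a b f" and a: "0 \<le> a" "a \<le> b"
  shows "abs_continuous_on_interval a b (\<lambda>x. x * f x)"
  unfolding abs_continuous_on_interval_def
proof (intro allI impI)
  fix e :: real assume e: "e > 0"
  have "bounded (f ` {a..b})"
    using abs_continuous_on_interval_imp_continuous[OF ac] by (intro compact_imp_bounded compact_continuous_image) auto
  then obtain M where M: "M > 0" "\<And>x. x \<in> {a..b} \<Longrightarrow> \<bar>f x\<bar> \<le> M"
    unfolding bounded_pos by auto
  have b1: "b + 1 > 0" using a by simp
  define e' where "e' = e / (2 * (b + 1))"
  have "e' > 0" using e b1 by (simp add: e'_def)
  then obtain d where d: "d > 0" and D: "\<And>(n::nat) u v. (\<And>i. i < n \<Longrightarrow> a \<le> u i \<and> u i \<le> v i \<and> v i \<le> b) \<Longrightarrow>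
        disjoint_family_on (\<lambda>i. {u i<..<v i}) {..<n} \<Longrightarrow>
        (\<Sum>i<n. v i - u i) < d \<Longrightarrow> (\<Sum>i<n. \<bar>f (v i) - f (u i)\<bar>) < e'"
    using abs_continuous_on_intervalE[OF ac] by blast
  define d' where "d' = min d (e / (2 * M))"
  have "d' > 0" using d e M by (simp add: d'_def)
  moreover have "(\<Sum>i<n. \<bar>v i * f (v i) - u i * f (u i)\<bar>) < e"
    if *: "(\<forall>i<n. a \<le> u i \<and> u i \<le> v i \<and> v i \<le> b) \<and>
        disjoint_family_on (\<lambda>i. {u i<..<v i}) {..<n} \<and> (\<Sum>i<n. v i - u i) < d'" for n :: nat and u v
  proof -
    have "(\<Sum>i<n. \<bar>v i * f (v i) - u i * f (u i)\<bar>) \<le>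
        (\<Sum>i<n. (b + 1) * \<bar>f (v i) - f (u i)\<bar> + M * (v i - u i))"
    proof (rule sum_mono)
      fix i assume "i \<in> {..<n}"
      then have uv: "a \<le> u i" "u i \<le> v i" "v i \<le> b" using * by auto
      have "v i * f (v i) - u i * f (u i) = v i * (f (v i) - f (u i)) + f (u i) * (v i - u i)"
        by (simp add: algebra_simps)
      also have "\<bar>\<dots>\<bar> \<le> \<bar>v i\<bar> * \<bar>f (v i) - f (u i)\<bar> + \<bar>f (u i)\<bar> * \<bar>v i - u i\<bar>"
        by (metis abs_mult abs_triangle_ineq)
      also have "\<dots> \<le> (b + 1) * \<bar>f (v i) - f (u i)\<bar> + M * (v i - u i)"
        using uv a M(2)[of "u i"] by (intro add_mono mult_mono) auto
      finally show "\<bar>v i * f (v i) - u i * f (u i)\<bar> \<le> (b + 1) * \<bar>f (v i) - f (u i)\<bar> + M * (v i - u i)" .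
    qed
    also have "\<dots> = (b + 1) * (\<Sum>i<n. \<bar>f (v i) - f (u i)\<bar>) + M * (\<Sum>i<n. v i - u i)"
      by (simp add: sum.distrib sum_distrib_left)
    also have "\<dots> < (b + 1) * e' + M * (e / (2 * M))"
    proof (rule add_strict_mono)
      show "(b + 1) * (\<Sum>i<n. \<bar>f (v i) - f (u i)\<bar>) < (b + 1) * e'"
        using D[of n u v] * b1 by (intro mult_strict_left_mono) (auto simp: d'_def)
      show "M * (\<Sum>i<n. v i - u i) < M * (e / (2 * M))"
        using * M by (intro mult_strict_left_mono) (auto simp: d'_def)
    qed
    also have "\<dots> = e" using b1 M by (simp add: e'_def field_simps)
    finally show ?thesis .
  qed
  ultimately show "\<exists>\<delta>>0. \<forall>(n::nat) u v.
        (\<forall>i<n. a \<le> u i \<and> u i \<le> v i \<and> v i \<le> b) \<and>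
        disjoint_family_on (\<lambda>i. {u i<..<v i}) {..<n} \<and>
        (\<Sum>i<n. v i - u i) < \<delta> \<longrightarrow> (\<Sum>i<n. \<bar>v i * f (v i) - u i * f (u i)\<bar>) < e" by blast
qed

text \<open>A fundamental theorem of calculus by Cousin's lemma. The gauge confines the intervals that are tagged
  in the exceptional null set to an open set of small measure, where absolute continuity bounds the
  increments; at every other tag it enforces that the difference quotients are at least \<open>m - e\<close>.\<close>

lemma abs_continuous_increment_ge:
  fixes f :: "real \<Rightarrow> real"
  assumes ac: "abs_continuous_on_interval a b f" and ab: "a \<le> b"
    and ae: "AE x in lborel. x \<in> {a..b} \<longrightarrow> (\<exists>d\<ge>m. (f has_real_derivative d) (at x))"
  shows "f b - f a \<ge> m * (b - a)"
proof -
  have main: "f b - f a \<ge> (m - e) * (b - a) - 2 * e" if e: "e > 0" for e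
  proof -
    obtain d where d: "d > 0" and D: "\<And>I u v. finite (I :: (real \<times> real set) set) \<Longrightarrow>
      (\<And>i. i \<in> I \<Longrightarrow> a \<le> u i \<and> u i \<le> v i \<and> v i \<le> b) \<Longrightarrow>
      disjoint_family_on (\<lambda>i. {u i<..<v i}) I \<Longrightarrow> (\<Sum>i\<in>I. v i - u i) < d \<Longrightarrow>
      (\<Sum>i\<in>I. \<bar>f (v i) - f (u i)\<bar>) < e"
      by (rule abs_continuous_on_interval_finite_family[OF ac e]) blast
    \<comment> \<open>total length below \<open>d\<close> makes the exceptional increments small, and the other bound makes \<open>(m - e)\<close> times that length small\<close>
    define d' where "d' = min d (e / (\<bar>m - e\<bar> + 1))"
    have d': "d' > 0" using d e by (simp add: d'_def)
    obtain Z where Z: "Z \<in> null_sets lborel"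
      "{x \<in> space lborel. \<not> (x \<in> {a..b} \<longrightarrow> (\<exists>d\<ge>m. (f has_real_derivative d) (at x)))} \<subseteq> Z"
      using ae by (auto elim: AE_E simp: null_sets_def)
    then have good: "\<exists>d\<ge>m. (f has_real_derivative d) (at x)" if "x \<in> {a..b}" "x \<notin> Z" for x
      using that by auto
    obtain U where U: "open U" "Z \<subseteq> U" "emeasure lborel U < ennreal d'"
    proof -
      have "Z \<in> sets borel" using Z(1) by auto
      then obtain U where "open U" "Z \<subseteq> U" "emeasure lborel (U - Z) < ennreal d'"
        using outer_regular_lborel[of Z "d'"] d' by auto
      moreover have "emeasure lborel U \<le> emeasure lborel (U - Z) + emeasure lborel Z"
        using \<open>Z \<in> sets borel\<close> \<open>open U\<close> by (intro order_trans[OF _ emeasure_subadditive]) (auto intro!: emeasure_mono)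
      ultimately show ?thesis using that Z(1) by (auto simp: null_setsD1)
    qed
    have "\<exists>\<eta>>0. \<forall>y. \<bar>y - x\<bar> < \<eta> \<longrightarrow> (m - e) * \<bar>y - x\<bar> \<le> (f y - f x) * sgn (y - x)"
      if x: "x \<in> {a..b}" "x \<notin> Z" for x
    proof -
      obtain c where c: "c \<ge> m" "(f has_real_derivative c) (at x)" using good[OF x] by auto
      then obtain \<eta> where \<eta>: "\<eta> > 0" "\<And>y. \<bar>y - x\<bar> < \<eta> \<Longrightarrow> \<bar>f y - f x - c * (y - x)\<bar> \<le> e * \<bar>y - x\<bar>"
        using e unfolding has_field_derivative_def has_derivative_at_alt by (auto simp: mult.commute)
      have "(m - e) * \<bar>y - x\<bar> \<le> (f y - f x) * sgn (y - x)" if "\<bar>y - x\<bar> < \<eta>" for y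
      proof -
        have 1: "\<bar>f y - f x - c * (y - x)\<bar> \<le> e * \<bar>y - x\<bar>" using \<eta>(2)[OF that] .
        have 2: "m * \<bar>y - x\<bar> \<le> c * \<bar>y - x\<bar>" using c by (intro mult_right_mono) auto
        show ?thesis
        proof (cases "y \<ge> x")
          case True
          then have eq: "\<bar>y - x\<bar> = y - x" by simp
          have "f y - f x \<ge> (m - e) * (y - x)"
            using 1[unfolded eq] 2[unfolded eq] unfolding left_diff_distrib by linarith
          then show ?thesis using True by (cases "y = x") (auto simp: sgn_if)
        next
          case False
          then have eq: "\<bar>y - x\<bar> = x - y" by simp
          have "c * (x - y) = - (c * (y - x))" by (simp add: algebra_simps)
          then have "f x - f y \<ge> (m - e) * (x - y)"
            using 1[unfolded eq] 2[unfolded eq] unfolding left_diff_distrib by linarith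
          then show ?thesis using False by (auto simp: sgn_if)
        qed
      qed
      with \<eta>(1) show ?thesis by blast
    qed
    then obtain \<eta> where \<eta>: "\<And>x. x \<in> {a..b} \<Longrightarrow> x \<notin> Z \<Longrightarrow> \<eta> x > 0"
      "\<And>x y. x \<in> {a..b} \<Longrightarrow> x \<notin> Z \<Longrightarrow> \<bar>y - x\<bar> < \<eta> x \<Longrightarrow> (m - e) * \<bar>y - x\<bar> \<le> (f y - f x) * sgn (y - x)"
      by metis
    define \<gamma> where "\<gamma> x = (if x \<in> Z then U else if x \<in> {a..b} then ball x (\<eta> x) else ball x 1)" for x
    have "gauge \<gamma>" unfolding gauge_def \<gamma>_def using U \<eta>(1) by auto
    then obtain p where p: "p tagged_division_of (cbox a b)" "\<gamma> fine p"
      using fine_division_exists[of \<gamma> a b] by blast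
    have pK: "a \<le> Inf K" "Inf K \<le> x" "x \<le> Sup K" "Sup K \<le> b" "x \<in> {a..b}" "{Inf K..Sup K} \<subseteq> \<gamma> x"
        "interior K = {Inf K<..<Sup K}"
      if xK: "(x, K) \<in> p" for x K
    proof -
      obtain l h where lh: "K = {l..h}" using tagged_division_ofD(4)[OF p(1) xK] by (auto simp: box_real)
      have x: "x \<in> {l..h}" "{l..h} \<subseteq> {a..b}"
        using tagged_division_ofD(2,3)[OF p(1) xK] by (simp_all only: lh box_real)
      have "K \<subseteq> \<gamma> x" using p(2) xK by (auto simp: fine_def)
      then show "{Inf K..Sup K} \<subseteq> \<gamma> x" using x(1) by (simp add: lh)
      show "a \<le> Inf K" "Inf K \<le> x" "x \<le> Sup K" "Sup K \<le> b" "x \<in> {a..b}" "interior K = {Inf K<..<Sup K}"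
        using x by (simp_all add: lh)
    qed
    have finp: "finite p" using p(1) by auto
    \<comment> \<open>the exceptional and the regular part of the division\<close>
    define p1 where "p1 = {q \<in> p. fst q \<in> Z}"
    define p2 where "p2 = {q \<in> p. fst q \<notin> Z}"
    have p12: "p = p1 \<union> p2" "p1 \<inter> p2 = {}" "finite p1" "finite p2" using finp by (auto simp: p1_def p2_def)
    let ?inc = "\<lambda>q. f (Sup (snd q)) - f (Inf (snd q))" and ?len = "\<lambda>q. Sup (snd q) - Inf (snd q)"
    have tele: "f b - f a = (\<Sum>q\<in>p. ?inc q)" "b - a = (\<Sum>q\<in>p. ?len q)"
      using additive_tagged_division_1[OF ab, of p f] additive_tagged_division_1[OF ab, of p "\<lambda>x. x"] p(1)
      by (auto simp: case_prod_beta)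
    have dis: "disjoint_family_on (\<lambda>q. {Inf (snd q)<..<Sup (snd q)}) p1"
      unfolding disjoint_family_on_def
    proof (intro ballI impI)
      fix q q' assume q: "q \<in> p1" "q' \<in> p1" "q \<noteq> q'"
      then have qp: "(fst q, snd q) \<in> p" "(fst q', snd q') \<in> p" by (auto simp: p1_def)
      have "interior (snd q) \<inter> interior (snd q') = {}"
        using tagged_division_ofD(5)[OF p(1) qp] q(3) by (metis prod.collapse)
      moreover have "interior (snd q) = {Inf (snd q)<..<Sup (snd q)}" "interior (snd q') = {Inf (snd q')<..<Sup (snd q')}"
        by (rule pK(7)[OF qp(1)], rule pK(7)[OF qp(2)])
      ultimately show "{Inf (snd q)<..<Sup (snd q)} \<inter> {Inf (snd q')<..<Sup (snd q')} = {}" by simp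
    qed
    have p1p: "(fst q, snd q) \<in> p" if "q \<in> p1" for q using that by (auto simp: p1_def)
    have len0: "Inf (snd q) \<le> Sup (snd q)" if "q \<in> p1" for q
      using pK(2,3)[OF p1p[OF that]] by (rule order_trans)
    have len1: "(\<Sum>q\<in>p1. ?len q) < d'"
    proof -
      have "ennreal (\<Sum>q\<in>p1. ?len q) = (\<Sum>q\<in>p1. ennreal (?len q))"
        using len0 by (intro sum_ennreal[symmetric]) auto
      also have "\<dots> = (\<Sum>q\<in>p1. emeasure lborel {Inf (snd q)<..<Sup (snd q)})"
        using len0 by (intro sum.cong refl) auto
      also have "\<dots> = emeasure lborel (\<Union>q\<in>p1. {Inf (snd q)<..<Sup (snd q)})"
        using dis p12(3) by (intro sum_emeasure) auto
      also have "\<dots> \<le> emeasure lborel U"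
      proof (rule emeasure_mono)
        show "(\<Union>q\<in>p1. {Inf (snd q)<..<Sup (snd q)}) \<subseteq> U"
        proof (rule UN_least)
          fix q assume q: "q \<in> p1"
          then have "\<gamma> (fst q) = U" by (simp add: p1_def \<gamma>_def)
          then have "{Inf (snd q)..Sup (snd q)} \<subseteq> U" using pK(6)[OF p1p[OF q]] by simp
          moreover have "{Inf (snd q)<..<Sup (snd q)} \<subseteq> {Inf (snd q)..Sup (snd q)}" by auto
          ultimately show "{Inf (snd q)<..<Sup (snd q)} \<subseteq> U" by (rule order_trans[rotated])
        qed
      qed (use U in auto)
      also have "\<dots> < ennreal d'" by (rule U)
      finally show ?thesis by (rule ennreal_less_iff[THEN iffD1, rotated]) (use len0 in \<open>auto intro!: sum_nonneg\<close>)
    qed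
    have "(\<Sum>q\<in>p1. \<bar>?inc q\<bar>) < e"
    proof (rule D[OF p12(3) _ dis])
      show "a \<le> Inf (snd q) \<and> Inf (snd q) \<le> Sup (snd q) \<and> Sup (snd q) \<le> b" if "q \<in> p1" for q
        using pK(1,4)[OF p1p[OF that]] len0[OF that] by simp
      show "(\<Sum>q\<in>p1. ?len q) < d" using len1 by (simp add: d'_def)
    qed
    then have 1: "(\<Sum>q\<in>p1. ?inc q) \<ge> - e"
      using sum_abs[of ?inc p1] by linarith
    have 2: "(\<Sum>q\<in>p2. ?inc q) \<ge> (\<Sum>q\<in>p2. (m - e) * ?len q)"
    proof (rule sum_mono)
      fix q assume "q \<in> p2"
      define x where "x = fst q" define l where "l = Inf (snd q)" define h where "h = Sup (snd q)"
      have q: "(x, snd q) \<in> p" "x \<notin> Z" using \<open>q \<in> p2\<close> by (auto simp: p2_def x_def)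
      note k = pK[OF q(1), folded l_def h_def]
      have "\<gamma> x = ball x (\<eta> x)" unfolding \<gamma>_def using k(5) q(2) by simp
      with k(6) have Kx': "{l..h} \<subseteq> ball x (\<eta> x)" by simp
      have "l \<in> ball x (\<eta> x)" "h \<in> ball x (\<eta> x)"
        by (rule subsetD[OF Kx'], use k(2,3) in simp)+
      then have lh: "\<bar>l - x\<bar> < \<eta> x" "\<bar>h - x\<bar> < \<eta> x" unfolding mem_ball dist_real_def by (simp_all only: abs_minus_commute[of x])
      have "(m - e) * (x - l) \<le> f x - f l"
        proof (cases "l = x")
        case False
        then have "l - x < 0" using k(2) by simp
        then show ?thesis using \<eta>(2)[OF k(5) q(2) lh(1)] by simp
      qed simp
      moreover have "(m - e) * (h - x) \<le> f h - f x"
        proof (cases "h = x")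
        case False
        then have "h - x > 0" using k(3) by simp
        then show ?thesis using \<eta>(2)[OF k(5) q(2) lh(2)] by simp
      qed simp
      ultimately have "(m - e) * (h - l) \<le> f h - f l" unfolding right_diff_distrib by linarith
      then show "(m - e) * ?len q \<le> ?inc q" unfolding l_def h_def .
    qed
    have "(\<Sum>q\<in>p1. ?len q) \<ge> 0" using len0 by (intro sum_nonneg) (simp only: diff_ge_0_iff_ge)
    then have "(m - e) * (\<Sum>q\<in>p1. ?len q) \<le> \<bar>m - e\<bar> * (\<Sum>q\<in>p1. ?len q)"
      by (intro mult_right_mono abs_ge_self)
    also have "\<dots> \<le> \<bar>m - e\<bar> * d'"
      by (rule mult_left_mono[OF less_imp_le[OF len1] abs_ge_zero])
    also have "\<dots> \<le> (\<bar>m - e\<bar> + 1) * (e / (\<bar>m - e\<bar> + 1))"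
      using d' by (intro mult_mono) (auto simp: d'_def)
    also have "\<dots> = e" by simp
    finally have 3: "(m - e) * (\<Sum>q\<in>p1. ?len q) \<le> e" .
    have inc12: "f b - f a = (\<Sum>q\<in>p1. ?inc q) + (\<Sum>q\<in>p2. ?inc q)"
      using sum.union_disjoint[OF p12(3,4,2), of ?inc] tele(1) unfolding p12(1)[symmetric] by (rule trans[rotated])
    have len12: "b - a = (\<Sum>q\<in>p1. ?len q) + (\<Sum>q\<in>p2. ?len q)"
      using sum.union_disjoint[OF p12(3,4,2), of ?len] tele(2) unfolding p12(1)[symmetric] by (rule trans[rotated])
    have "(m - e) * (b - a) = (m - e) * (\<Sum>q\<in>p1. ?len q) + (\<Sum>q\<in>p2. (m - e) * ?len q)"
      unfolding len12 distrib_left sum_distrib_left ..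
    with inc12 show ?thesis using 1 2 3 by linarith
  qed
  have "((\<lambda>e. (m - e) * (b - a) - 2 * e) \<longlongrightarrow> (m - 0) * (b - a) - 2 * 0) (at_right 0)"
    by (intro tendsto_intros)
  moreover have "\<forall>\<^sub>F e in at_right 0. (m - e) * (b - a) - 2 * e \<le> f b - f a"
    using main by (auto simp: eventually_at_right_field intro!: exI[of _ 1])
  ultimately show ?thesis using tendsto_upperbound by fastforce
qed

lemma abs_continuous_increment_le:
  fixes f :: "real \<Rightarrow> real"
  assumes "abs_continuous_on_interval a b f" "a \<le> b"
    and "AE x in lborel. x \<in> {a..b} \<longrightarrow> (\<exists>d\<le>m. (f has_real_derivative d) (at x))"
  shows "f b - f a \<le> m * (b - a)"
proof -
  have "AE x in lborel. x \<in> {a..b} \<longrightarrow> (\<exists>d\<ge>-m. ((\<lambda>x. - f x) has_real_derivative d) (at x))"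
    using assms(3)
  proof eventually_elim
    case (elim x)
    show ?case
    proof
      assume "x \<in> {a..b}"
      then obtain d where "d \<le> m" "(f has_real_derivative d) (at x)" using elim by auto
      then show "\<exists>d\<ge>-m. ((\<lambda>x. - f x) has_real_derivative d) (at x)"
        by (intro exI[of _ "- d"]) (auto intro!: derivative_eq_intros)
    qed
  qed
  from abs_continuous_increment_ge[OF abs_continuous_on_interval_uminus[OF assms(1)] assms(2) this]
  show ?thesis by (simp add: algebra_simps)
qed

section \<open>Laplacians of radial functions\<close>

text \<open>At points where the derivative does not exist, \<open>deriv\<close> is a number that depends neither on the function
  nor on the point. Consequently an almost everywhere statement about \<open>deriv f\<close> in which this number is
  impossible implies that \<open>f\<close> is differentiable almost everywhere.\<close>

lemma deriv_not_differentiable: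
  fixes f :: "real \<Rightarrow> real"
  assumes "\<not> f differentiable (at s)"
  shows "deriv f s = (SOME D. False)"
proof -
  have "\<not> DERIV f s :> D" for D using assms by (auto simp: real_differentiable_def)
  then show ?thesis unfolding deriv_def by simp
qed

lemma DERIV_sqrt_sum_squares:
  assumes "x\<^sup>2 + b\<^sup>2 > 0"
  shows "((\<lambda>x. sqrt (x\<^sup>2 + b\<^sup>2)) has_real_derivative x / sqrt (x\<^sup>2 + b\<^sup>2)) (at x)"
  using assms by (auto intro!: derivative_eq_intros simp: field_simps)

lemma eventually_sum_squares_pos:
  fixes a b :: real
  assumes "a\<^sup>2 + b\<^sup>2 > 0"
  shows "\<forall>\<^sub>F x in nhds a. x\<^sup>2 + b\<^sup>2 > 0"
proof -
  have "((\<lambda>x. x\<^sup>2 + b\<^sup>2) \<longlongrightarrow> a\<^sup>2 + b\<^sup>2) (nhds a)" by (intro tendsto_intros filterlim_ident)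
  then show ?thesis using assms by (rule order_tendstoD)
qed

lemma deriv_radial_section:
  assumes g: "\<And>s. s > 0 \<Longrightarrow> g differentiable (at s)" and ab: "a\<^sup>2 + b\<^sup>2 > (0::real)"
  shows "\<forall>\<^sub>F x in nhds a. deriv (\<lambda>x. g (sqrt (x\<^sup>2 + b\<^sup>2))) x =
           deriv g (sqrt (x\<^sup>2 + b\<^sup>2)) * (x / sqrt (x\<^sup>2 + b\<^sup>2))"
  using eventually_sum_squares_pos[OF ab]
proof eventually_elim
  case (elim x)
  then have "(g has_real_derivative deriv g (sqrt (x\<^sup>2 + b\<^sup>2))) (at (sqrt (x\<^sup>2 + b\<^sup>2)))"
    using g[of "sqrt (x\<^sup>2 + b\<^sup>2)"] by (metis DERIV_imp_deriv real_differentiable_def real_sqrt_gt_zero)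
  from DERIV_chain2[OF this DERIV_sqrt_sum_squares[OF elim]] show ?case by (rule DERIV_imp_deriv)
qed

lemma deriv_cong_nhds:
  assumes "\<forall>\<^sub>F x in nhds a. f x = g x" shows "deriv f a = deriv g a"
  using assms by (rule deriv_cong_ev) simp

lemma second_deriv_radial_section:
  assumes g: "\<And>s. s > 0 \<Longrightarrow> g differentiable (at s)" and s: "s = sqrt (a\<^sup>2 + b\<^sup>2)" "s > (0::real)"
    and h: "(deriv g has_real_derivative h') (at s)"
  shows "deriv (deriv (\<lambda>x. g (sqrt (x\<^sup>2 + b\<^sup>2)))) a = h' * (a\<^sup>2 / s\<^sup>2) + deriv g s * (1 / s - a\<^sup>2 / s ^ 3)"
proof -
  have ab: "a\<^sup>2 + b\<^sup>2 > 0" using s by simp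
  have D: "((\<lambda>x. sqrt (x\<^sup>2 + b\<^sup>2)) has_real_derivative a / s) (at a)"
    using DERIV_sqrt_sum_squares[OF ab] s by simp
  have 1: "((\<lambda>x. deriv g (sqrt (x\<^sup>2 + b\<^sup>2))) has_real_derivative h' * (a / s)) (at a)"
    by (rule DERIV_chain2[OF _ D]) (use h s in simp)
  have 2: "((\<lambda>x. x / sqrt (x\<^sup>2 + b\<^sup>2)) has_real_derivative (1 * s - a * (a / s)) / (s * s)) (at a)"
  proof -
    have "sqrt (a\<^sup>2 + b\<^sup>2) \<noteq> 0" unfolding s(1)[symmetric] using s(2) by simp
    from DERIV_divide[OF DERIV_ident D this] show ?thesis unfolding s(1)[symmetric] .
  qed
  from DERIV_mult[OF 1 2] have "((\<lambda>x. deriv g (sqrt (x\<^sup>2 + b\<^sup>2)) * (x / sqrt (x\<^sup>2 + b\<^sup>2))) has_real_derivative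
      h' * (a / s) * (a / s) + (1 * s - a * (a / s)) / (s * s) * deriv g s) (at a)"
    unfolding s(1)[symmetric] .
  moreover have "h' * (a / s) * (a / s) + (1 * s - a * (a / s)) / (s * s) * deriv g s =
      h' * (a\<^sup>2 / s\<^sup>2) + deriv g s * (1 / s - a\<^sup>2 / s ^ 3)"
    using s(2) by (simp add: field_simps power2_eq_square power3_eq_cube)
  ultimately have "((\<lambda>x. deriv g (sqrt (x\<^sup>2 + b\<^sup>2)) * (x / sqrt (x\<^sup>2 + b\<^sup>2))) has_real_derivative
      h' * (a\<^sup>2 / s\<^sup>2) + deriv g s * (1 / s - a\<^sup>2 / s ^ 3)) (at a)" by (simp only:)
  from DERIV_imp_deriv[OF this] show ?thesis
    using deriv_cong_nhds[OF deriv_radial_section[OF g ab]] by (simp only:)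
qed

text \<open>On an axis the tangential section has a second derivative as soon as the derivative of the profile is
  continuous, because the first derivative of the section is a continuous function times \<open>x\<close>.\<close>

lemma second_deriv_radial_section_tangential:
  assumes g: "\<And>s. s > 0 \<Longrightarrow> g differentiable (at s)" and s: "s > (0::real)" and c: "isCont (deriv g) s"
  shows "deriv (deriv (\<lambda>x. g (sqrt (x\<^sup>2 + s\<^sup>2)))) 0 = deriv g s / s"
proof -
  let ?k = "\<lambda>x. deriv g (sqrt (x\<^sup>2 + s\<^sup>2)) / sqrt (x\<^sup>2 + s\<^sup>2)"
  have "isCont (\<lambda>x. deriv g (sqrt (x\<^sup>2 + s\<^sup>2))) 0"
    by (rule isCont_o2[of _ "\<lambda>x. sqrt (x\<^sup>2 + s\<^sup>2)"]) (use s c in \<open>auto intro!: continuous_intros\<close>)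
  then have "isCont ?k 0" using s by (intro continuous_intros) auto
  then have "(\<lambda>x. ?k x) \<midarrow>0\<rightarrow> deriv g s / s" using s by (simp add: isCont_def)
  then have "((\<lambda>x. ?k x * x) has_real_derivative deriv g s / s) (at 0)"
    unfolding DERIV_def
    by (rule Lim_transform_eventually) (auto simp: eventually_at intro!: exI[of _ 1])
  then have "((\<lambda>x. deriv g (sqrt (x\<^sup>2 + s\<^sup>2)) * (x / sqrt (x\<^sup>2 + s\<^sup>2))) has_real_derivative deriv g s / s) (at 0)"
    by (simp only: times_divide_eq_left times_divide_eq_right)
  from DERIV_imp_deriv[OF this]
  have D: "deriv (\<lambda>x. deriv g (sqrt (x\<^sup>2 + s\<^sup>2)) * (x / sqrt (x\<^sup>2 + s\<^sup>2))) 0 = deriv g s / s" .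
  have "0\<^sup>2 + s\<^sup>2 > 0" using s by simp
  from deriv_cong_nhds[OF deriv_radial_section[OF g this]] show ?thesis unfolding D .
qed

lemma second_deriv_cong_nhds:
  assumes "\<forall>\<^sub>F x in nhds a. f x = g x" shows "deriv (deriv f) a = deriv (deriv g) a"
proof (rule deriv_cong_nhds)
  have "\<forall>\<^sub>F x in nhds a. \<forall>\<^sub>F y in nhds x. f y = g y" using assms by (simp add: eventually_eventually)
  then show "\<forall>\<^sub>F x in nhds a. deriv f x = deriv g x" by eventually_elim (rule deriv_cong_nhds)
qed

lemma laplacian_radial_eq_sections:
  assumes W: "\<And>z. z \<noteq> 0 \<Longrightarrow> W z = ereal (g (cmod z))" and z: "z \<noteq> 0"
  shows "laplacian W z = (deriv (deriv (\<lambda>x. g (sqrt (x\<^sup>2 + (Im z)\<^sup>2)))) (Re z) +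
           deriv (deriv (\<lambda>x. g (sqrt (x\<^sup>2 + (Re z)\<^sup>2)))) (Im z)) / 4"
proof -
  have pos: "(Re z)\<^sup>2 + (Im z)\<^sup>2 > 0" using z by (metis complex_neq_0)
  then have pos': "(Im z)\<^sup>2 + (Re z)\<^sup>2 > 0" unfolding add.commute[of "(Re z)\<^sup>2"] .
  have nz: "Complex x y \<noteq> 0" if "x\<^sup>2 + y\<^sup>2 > 0" for x y using that by (auto simp: complex_eq_iff)
  have "\<forall>\<^sub>F x in nhds (Re z). real_of_ereal (W (Complex x (Im z))) = g (sqrt (x\<^sup>2 + (Im z)\<^sup>2))"
    using eventually_sum_squares_pos[OF pos] by eventually_elim (use nz W in \<open>auto simp: complex_norm\<close>)
  moreover have "\<forall>\<^sub>F y in nhds (Im z). real_of_ereal (W (Complex (Re z) y)) = g (sqrt (y\<^sup>2 + (Re z)\<^sup>2))"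
    using eventually_sum_squares_pos[OF pos'] by eventually_elim (use nz W in \<open>auto simp: complex_norm add.commute\<close>)
  ultimately show ?thesis
    unfolding laplacian_def by (simp only: second_deriv_cong_nhds)
qed

lemma laplacian_radial:
  assumes W: "\<And>z. z \<noteq> 0 \<Longrightarrow> W z = ereal (g (cmod z))" and g: "\<And>s. s > 0 \<Longrightarrow> g differentiable (at s)"
    and z: "z \<noteq> 0" and h: "(deriv g has_real_derivative h') (at (cmod z))"
  shows "laplacian W z = (h' + deriv g (cmod z) / cmod z) / 4"
proof -
  define s where "s = cmod z"
  have hs: "(deriv g has_real_derivative h') (at s)" using h unfolding s_def .
  have s1: "s > 0" using z by (simp add: s_def)
  have s2: "s = sqrt ((Re z)\<^sup>2 + (Im z)\<^sup>2)" unfolding s_def cmod_def ..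
  have s3: "s = sqrt ((Im z)\<^sup>2 + (Re z)\<^sup>2)" unfolding s2 add.commute[of "(Re z)\<^sup>2"] ..
  have sq: "(Re z)\<^sup>2 + (Im z)\<^sup>2 = s\<^sup>2" by (simp add: s_def cmod_power2)
  let ?p = "(Re z)\<^sup>2 / s\<^sup>2" and ?p' = "(Im z)\<^sup>2 / s\<^sup>2" and ?q = "(Re z)\<^sup>2 / s ^ 3" and ?q' = "(Im z)\<^sup>2 / s ^ 3"
  have p: "?p + ?p' = 1" using sq s1 by (simp add: add_divide_distrib[symmetric])
  have q: "?q + ?q' = 1 / s" using s1 unfolding add_divide_distrib[symmetric] sq
    by (simp add: power2_eq_square power3_eq_cube)
  have alg: "h' * p + d * (i - q) + (h' * p' + d * (i - q')) = h' * (p + p') + d * (2 * i - (q + q'))"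
    for p p' d i q q' :: real by (simp add: algebra_simps)
  have "h' * ?p + deriv g s * (1 / s - ?q) + (h' * ?p' + deriv g s * (1 / s - ?q')) =
      h' * (?p + ?p') + deriv g s * (2 * (1 / s) - (?q + ?q'))"
    by (rule alg)
  also have "\<dots> = h' + deriv g s / s" unfolding p q by simp
  finally have sum: "h' * ?p + deriv g s * (1 / s - ?q) + (h' * ?p' + deriv g s * (1 / s - ?q')) = h' + deriv g s / s" .
  have "laplacian W z = (deriv (deriv (\<lambda>x. g (sqrt (x\<^sup>2 + (Im z)\<^sup>2)))) (Re z) +
           deriv (deriv (\<lambda>x. g (sqrt (x\<^sup>2 + (Re z)\<^sup>2)))) (Im z)) / 4"
    by (rule laplacian_radial_eq_sections[OF _ z]) (rule W)
  also have "\<dots> = (h' + deriv g s / s) / 4"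
    by (subst second_deriv_radial_section[OF _ s2 s1 hs], erule g,
        subst second_deriv_radial_section[OF _ s3 s1 hs], erule g, simp only: sum)
  finally show ?thesis unfolding s_def .
qed

text \<open>On the positive axis this holds for the term \<open>deriv (deriv g) s\<close> as it stands, whether or not the
  second derivative of \<open>g\<close> exists at \<open>s\<close>.\<close>

lemma laplacian_radial_of_real:
  assumes W: "\<And>z. z \<noteq> 0 \<Longrightarrow> W z = ereal (g (cmod z))" and g: "\<And>s. s > 0 \<Longrightarrow> g differentiable (at s)"
    and s: "s > 0" and c: "isCont (deriv g) s"
  shows "laplacian W (of_real s) = (deriv (deriv g) s + deriv g s / s) / 4"
proof -
  have "\<forall>\<^sub>F x in nhds s. g (sqrt (x\<^sup>2 + 0\<^sup>2)) = g x"
    using eventually_nhds_in_open[of "{0<..}" s] s by (auto elim!: eventually_mono)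
  from second_deriv_cong_nhds[OF this] second_deriv_radial_section_tangential[OF g s c]
  show ?thesis
    using s by (subst laplacian_radial_eq_sections[of W g, OF W]) auto
qed

text \<open>The derivative of the flux \<open>s * h s\<close> is \<open>s\<close> times the quantity that is close to \<open>4 L\<close> almost
  everywhere, so the flux has nearly constant slope. Differentiability almost everywhere is part of the
  claim: where \<open>h\<close> is not differentiable, \<open>deriv h s\<close> is a fixed number, too small compared with
  \<open>L\<close> to satisfy the bound, as long as the flux itself is at most \<open>M\<close>. That the flux does not exceed
  \<open>M\<close> on the interval follows from the intermediate value theorem: up to a first point with flux \<open>M\<close> the
  slope bound is valid, and it leads to a flux below \<open>M\<close>.\<close>

lemma radial_slope_bounds:
  fixes h :: "real \<Rightarrow> real"
  defines "\<phi> \<equiv> \<lambda>s. s * h s"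
  assumes ac: "\<And>a b. 0 < a \<Longrightarrow> a < b \<Longrightarrow> abs_continuous_on_interval a b h"
    and mono: "\<And>s t. 0 < s \<Longrightarrow> s \<le> t \<Longrightarrow> \<phi> s \<le> \<phi> t" and one: "\<phi> 1 = 2"
    and L: "L > 0" and \<eta>: "0 < \<eta>" "\<eta> \<le> 1 / 2" and \<epsilon>: "0 < \<epsilon>" "\<epsilon> \<le> 1 / 2"
    and ae: "AE s in lborel. \<bar>s - 1\<bar> \<le> \<eta> \<longrightarrow> \<bar>(deriv h s + h s / s) / 4 / L - 1\<bar> \<le> \<epsilon>"
    and M: "2 + 4 * L * (1 + \<epsilon>) * (1 + \<eta>) * \<eta> < M" and large: "(SOME D. False) + 4 * M < 2 * L"
    and uv: "1 - \<eta> \<le> u" "u \<le> v" "v \<le> 1 + \<eta>"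
  shows "4 * L * (1 - \<epsilon>) * (1 - \<eta>) * (v - u) \<le> \<phi> v - \<phi> u"
    and "\<phi> v - \<phi> u \<le> 4 * L * (1 + \<epsilon>) * (1 + \<eta>) * (v - u)"
proof -
  let ?lo = "4 * L * (1 - \<epsilon>) * (1 - \<eta>)" and ?hi = "4 * L * (1 + \<epsilon>) * (1 + \<eta>)"
  have nn: "0 \<le> 4 * L * (1 + \<epsilon>) * (1 + \<eta>) * \<eta>" using L \<eta> \<epsilon> by (intro mult_nonneg_nonneg) auto
  have ac\<phi>: "abs_continuous_on_interval (1 - \<eta>) (1 + \<eta>) \<phi>"
    unfolding \<phi>_def using \<eta> by (intro abs_continuous_on_interval_ident_mult ac) auto
  have der: "\<exists>d. (\<phi> has_real_derivative d) (at s) \<and> ?lo \<le> d \<and> d \<le> ?hi"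
    if s: "\<bar>s - 1\<bar> \<le> \<eta>" and b: "\<bar>(deriv h s + h s / s) / 4 / L - 1\<bar> \<le> \<epsilon>" and \<phi>M: "\<phi> s \<le> M" for s
  proof -
    have s': "1 / 2 \<le> s" "1 - \<eta> \<le> s" "s \<le> 1 + \<eta>" using s \<eta> by auto
    define X where "X = deriv h s + h s / s"
    have X: "4 * L * (1 - \<epsilon>) \<le> X" "X \<le> 4 * L * (1 + \<epsilon>)"
    proof -
      have "\<bar>X / 4 / L - 1\<bar> \<le> \<epsilon>" using b unfolding X_def .
      then have "1 - \<epsilon> \<le> X / (4 * L)" "X / (4 * L) \<le> 1 + \<epsilon>" by (simp_all add: abs_le_iff)
      then show "4 * L * (1 - \<epsilon>) \<le> X" "X \<le> 4 * L * (1 + \<epsilon>)"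
        using L by (simp_all add: pos_le_divide_eq pos_divide_le_eq mult.commute)
    qed
    have "h differentiable (at s)"
    proof (rule ccontr)
      assume "\<not> ?thesis"
      then have "deriv h s = (SOME D. False)" by (rule deriv_not_differentiable)
      moreover have "h s / s \<le> 4 * M"
      proof -
        have M0: "M > 0"
          using M nn by linarith
        have "1 \<le> 4 * (s * s)" using mult_mono[of "1/2" s "1/2" s] s' by simp
        then have "M * 1 \<le> M * (4 * (s * s))" using M0 by (intro mult_left_mono) auto
        then have "\<phi> s \<le> 4 * M * (s * s)" using \<phi>M by simp
        then have "\<phi> s / (s * s) \<le> 4 * M" using s' by (intro mult_imp_div_pos_le) auto
        moreover have "h s / s = \<phi> s / (s * s)" using s' by (simp add: \<phi>_def)
        ultimately show ?thesis by simp
      qed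
      moreover have "4 * L * (1 / 2) \<le> 4 * L * (1 - \<epsilon>)" using L \<epsilon> by (intro mult_left_mono) auto
      ultimately show False using X(1) large by (simp add: X_def)
    qed
    then have "(h has_real_derivative deriv h s) (at s)"
      by (metis DERIV_imp_deriv real_differentiable_def)
    from DERIV_mult[OF DERIV_ident this] have "(\<phi> has_real_derivative 1 * h s + deriv h s * s) (at s)"
      unfolding \<phi>_def .
    moreover have "1 * h s + deriv h s * s = X * s" using s' by (simp add: X_def field_simps)
    moreover have "?lo \<le> X * s"
    proof (rule mult_mono)
      have "0 \<le> 4 * L * (1 - \<epsilon>)" using L \<epsilon> by simp
      then show "0 \<le> X" using X(1) by linarith
    qed (use X s' \<eta> in auto)
    moreover have "X * s \<le> ?hi"
    proof (rule mult_mono)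
      show "0 \<le> s" "X \<le> 4 * L * (1 + \<epsilon>)" "s \<le> 1 + \<eta>" "0 \<le> 4 * L * (1 + \<epsilon>)" using s' X L \<epsilon> by auto
    qed
    ultimately show ?thesis by metis
  qed
  have incr: "?lo * (v - u) \<le> \<phi> v - \<phi> u \<and> \<phi> v - \<phi> u \<le> ?hi * (v - u)"
    if uv: "1 - \<eta> \<le> u" "u \<le> v" "v \<le> 1 + \<eta>" and vM: "\<phi> v \<le> M" for u v
  proof -
    have acuv: "abs_continuous_on_interval u v \<phi>" by (rule abs_continuous_on_interval_subset[OF ac\<phi> uv(1,3)])
    have aeuv: "AE s in lborel. s \<in> {u..v} \<longrightarrow> (\<exists>d. (\<phi> has_real_derivative d) (at s) \<and> ?lo \<le> d \<and> d \<le> ?hi)"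
      using ae
    proof eventually_elim
      case (elim s)
      show ?case
      proof
        assume s: "s \<in> {u..v}"
        then have "\<phi> s \<le> M" using mono[of s v] uv \<eta> vM by auto
        moreover have "\<bar>s - 1\<bar> \<le> \<eta>" using s uv by auto
        ultimately show "\<exists>d. (\<phi> has_real_derivative d) (at s) \<and> ?lo \<le> d \<and> d \<le> ?hi" using der elim by blast
      qed
    qed
    have "AE s in lborel. s \<in> {u..v} \<longrightarrow> (\<exists>d\<ge>?lo. (\<phi> has_real_derivative d) (at s))"
      using aeuv by (rule AE_mp) (auto intro!: AE_I2)
    moreover have "AE s in lborel. s \<in> {u..v} \<longrightarrow> (\<exists>d\<le>?hi. (\<phi> has_real_derivative d) (at s))"
      using aeuv by (rule AE_mp) (auto intro!: AE_I2)
    ultimately show ?thesis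
      using abs_continuous_increment_ge[OF acuv uv(2)] abs_continuous_increment_le[OF acuv uv(2)] by blast
  qed
  have "\<phi> (1 + \<eta>) \<le> M"
  proof (rule ccontr)
    assume "\<not> ?thesis"
    moreover have "2 < M" using M nn by linarith
    moreover have "continuous_on {1..1 + \<eta>} \<phi>"
      using abs_continuous_on_interval_imp_continuous[OF ac\<phi>] by (rule continuous_on_subset) (use \<eta> in auto)
    ultimately obtain s where s: "1 \<le> s" "s \<le> 1 + \<eta>" "\<phi> s = M"
      using IVT'[of \<phi> 1 M "1 + \<eta>"] one \<eta> by auto
    then have "M - 2 \<le> ?hi * (s - 1)" using incr[of 1 s] one \<eta> by simp
    also have "\<dots> \<le> ?hi * \<eta>" using s L \<epsilon> \<eta> by (intro mult_left_mono) auto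
    finally show False using M by simp
  qed
  then have "\<phi> v \<le> M" using mono[of v "1 + \<eta>"] uv \<eta> by auto
  then show "?lo * (v - u) \<le> \<phi> v - \<phi> u" "\<phi> v - \<phi> u \<le> ?hi * (v - u)" using incr[OF uv] by auto
qed

section \<open>Sums of Gaussian-like exponentials\<close>

lemma dominated_convergence_eventually:
  fixes f :: "'a \<Rightarrow> real"
  assumes f: "f \<in> borel_measurable M" and w: "integrable M w"
    and lim: "AE x in M. (\<lambda>i. s i x) \<longlonglongrightarrow> f x"
    and bnd: "\<forall>\<^sub>F i in sequentially. s i \<in> borel_measurable M \<and> (AE x in M. \<bar>s i x\<bar> \<le> w x)"
  shows "(\<lambda>i. \<integral>x. s i x \<partial>M) \<longlonglongrightarrow> (\<integral>x. f x \<partial>M)"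
proof -
  obtain K where K: "\<And>i. i \<ge> K \<Longrightarrow> s i \<in> borel_measurable M \<and> (AE x in M. \<bar>s i x\<bar> \<le> w x)"
    using bnd by (auto simp: eventually_sequentially)
  have "(\<lambda>i. \<integral>x. s (i + K) x \<partial>M) \<longlonglongrightarrow> (\<integral>x. f x \<partial>M)"
  proof (rule integral_dominated_convergence[OF f _ w])
    show "AE x in M. (\<lambda>i. s (i + K) x) \<longlonglongrightarrow> f x"
      using lim by eventually_elim (rule LIMSEQ_ignore_initial_segment)
  qed (use K in auto)
  then show ?thesis by (rule LIMSEQ_offset)
qed

text \<open>The right end point of the cell of the grid \<open>0, 1 / n, 2 / n, \<dots>\<close> that contains \<open>u\<close>.\<close>

definition grid_point :: "nat \<Rightarrow> real \<Rightarrow> real" where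
  "grid_point n u = (of_int \<lfloor>real n * u\<rfloor> + 1) / real n"

lemma grid_point_bounds:
  assumes "n > 0" shows "u < grid_point n u" "grid_point n u \<le> u + 1 / n"
proof -
  have "real n * u < of_int \<lfloor>real n * u\<rfloor> + 1" "of_int \<lfloor>real n * u\<rfloor> \<le> real n * u" by linarith+
  then show "u < grid_point n u" "grid_point n u \<le> u + 1 / n"
    using assms by (auto simp: grid_point_def field_simps)
qed

lemma grid_point_in_unit:
  assumes n: "n > 0" and u: "0 \<le> u" "u < 1" shows "grid_point n u \<in> {0..1}"
proof -
  have "real n * u < real n" using n u by simp
  then have "\<lfloor>real n * u\<rfloor> < int n" by (simp add: floor_less_iff)
  then have "of_int \<lfloor>real n * u\<rfloor> + 1 \<le> real n" by linarith
  then have "grid_point n u \<le> 1" using n by (simp add: grid_point_def)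
  moreover have "0 \<le> grid_point n u" using grid_point_bounds(1)[OF n, of u] u by linarith
  ultimately show ?thesis by simp
qed

lemma grid_point_tendsto: "(\<lambda>n. grid_point n u) \<longlonglongrightarrow> u"
proof (rule tendsto_sandwich)
  show "\<forall>\<^sub>F n in sequentially. u \<le> grid_point n u"
    using eventually_gt_at_top[of 0] by eventually_elim (use grid_point_bounds in \<open>auto intro: less_imp_le\<close>)
  show "\<forall>\<^sub>F n in sequentially. grid_point n u \<le> u + 1 / n"
    using eventually_gt_at_top[of 0] by eventually_elim (use grid_point_bounds in auto)
  show "(\<lambda>n. u + 1 / real n) \<longlonglongrightarrow> u" by real_asymp
qed simp

lemma step_function_eq_grid_point:
  assumes n: "n > 0"
  shows "(\<Sum>j<n. F ((real j + 1) / n) * indicator {real j / n..<(real j + 1) / n} u) =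
         (indicator {0..<1} u * F (grid_point n u) :: real)"
proof (cases "0 \<le> u \<and> u < 1")
  case True
  define k where "k = nat \<lfloor>real n * u\<rfloor>"
  have k: "real k = of_int \<lfloor>real n * u\<rfloor>" using True by (simp add: k_def)
  have "real n * u < real n" using n True by simp
  then have kn: "k < n" using k by (metis k_def floor_less_iff int_nat_eq nat_less_iff of_int_of_nat_eq of_nat_less_iff less_le_trans of_int_floor_le le_less_trans)
  have iff: "u \<in> {real j / n..<(real j + 1) / n} \<longleftrightarrow> j = k" for j
  proof -
    have "u \<in> {real j / n..<(real j + 1) / n} \<longleftrightarrow> real j \<le> real n * u \<and> real n * u < real j + 1"
      using n by (auto simp: field_simps)
    also have "\<dots> \<longleftrightarrow> \<lfloor>real n * u\<rfloor> = int j" by (subst floor_eq_iff) auto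
    also have "\<dots> \<longleftrightarrow> j = k" using k by (auto simp: k_def)
    finally show ?thesis .
  qed
  have "(\<Sum>j<n. F ((real j + 1) / n) * indicator {real j / n..<(real j + 1) / n} u) =
      (\<Sum>j<n. if j = k then F ((real k + 1) / n) else 0)"
    by (intro sum.cong refl) (simp only: indicator_def iff, simp)
  also have "\<dots> = F ((real k + 1) / n)" using kn by simp
  finally show ?thesis using True by (simp add: grid_point_def k)
next
  case False
  have "u \<notin> {real j / n..<(real j + 1) / n}" if j: "j < n" for j
  proof
    assume u: "u \<in> {real j / n..<(real j + 1) / n}"
    have "0 \<le> real j / n" "(real j + 1) / n \<le> 1" using n j by (auto simp: field_simps)
    with u False show False by auto
  qed
  then have "(\<Sum>j<n. F ((real j + 1) / n) * indicator {real j / n..<(real j + 1) / n} u) = 0"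
    by (intro sum.neutral) simp
  with False show ?thesis by (auto simp: indicator_def)
qed

text \<open>The Riemann sum is the integral of a step function, to which dominated convergence applies. The
  hypothesis on \<open>F\<close> is convergence along convergent arguments because the nodes move with \<open>n\<close>.\<close>

lemma riemann_sum_tendsto:
  fixes F :: "nat \<Rightarrow> real \<Rightarrow> real"
  assumes lim: "\<And>u a. u \<in> {0..1} \<Longrightarrow> (\<And>n. a n \<in> {0..1}) \<Longrightarrow> a \<longlonglongrightarrow> u \<Longrightarrow> (\<lambda>n. F n (a n)) \<longlonglongrightarrow> f u"
    and bnd: "\<forall>\<^sub>F n in sequentially. \<forall>u\<in>{0..1}. \<bar>F n u\<bar> \<le> B"
    and f: "continuous_on {0..1} f"
  shows "(\<lambda>n. (\<Sum>j<n. F n ((real j + 1) / n)) / n) \<longlonglongrightarrow> integral {0..1} f"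
proof -
  define S where "S n u = (\<Sum>j<n. F n ((real j + 1) / n) * indicator {real j / n..<(real j + 1) / n} u)" for n and u :: real
  have Seq: "S n u = indicator {0..<1} u * F n (grid_point n u)" if "n > 0" for n u
    using step_function_eq_grid_point[OF that, of "F n" u] by (simp add: S_def)
  have fint: "set_integrable lborel {0..1} f"
    using f by (rule borel_integrable_atLeastAtMost')
  have meas: "(\<lambda>u. indicator {0..<1} u * f u) \<in> borel_measurable lborel"
  proof -
    have "continuous_on {0..<1} f" using f by (rule continuous_on_subset) auto
    from borel_measurable_continuous_on_indicator[OF _ this] show ?thesis by simp
  qed
  have Slim: "(\<lambda>n. S n u) \<longlonglongrightarrow> indicator {0..<1} u * f u" for u
  proof (cases "u \<in> {0..<1}")
    case True
    define a where "a n = (if n = 0 then u else grid_point n u)" for n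
    have "\<forall>\<^sub>F n in sequentially. grid_point n u = a n"
      using eventually_gt_at_top[of 0] by eventually_elim (simp add: a_def)
    then have "a \<longlonglongrightarrow> u" by (rule Lim_transform_eventually[OF grid_point_tendsto])
    then have "(\<lambda>n. F n (a n)) \<longlonglongrightarrow> f u"
    proof (rule lim[rotated 2])
      show "u \<in> {0..1}" using True by simp
      show "a n \<in> {0..1}" for n using True grid_point_in_unit[of n u] by (simp add: a_def)
    qed
    then have "(\<lambda>n. indicator {0..<1} u * F n (a n)) \<longlonglongrightarrow> indicator {0..<1} u * f u"
      by (rule tendsto_mult_left)
    moreover have "\<forall>\<^sub>F n in sequentially. indicator {0..<1} u * F n (a n) = S n u"
      using eventually_gt_at_top[of 0] 
    proof eventually_elim
      case (elim n)
      show ?case unfolding Seq[OF elim] using elim by (simp only: a_def) simp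
    qed
    ultimately show ?thesis by (rule Lim_transform_eventually)
  next
    case False
    have "\<forall>\<^sub>F n in sequentially. 0 = S n u"
      using eventually_gt_at_top[of 0] by eventually_elim (use False Seq in auto)
    with False show ?thesis by (auto intro: Lim_transform_eventually[OF tendsto_const])
  qed
  have Sbnd: "\<forall>\<^sub>F n in sequentially. S n \<in> borel_measurable lborel \<and> (AE u in lborel. \<bar>S n u\<bar> \<le> B * indicator {0..1} u)"
    using bnd eventually_gt_at_top[of 0]
  proof eventually_elim
    case (elim n)
    have B0: "0 \<le> B" using elim(1)[rule_format, of 0] by simp
    have "\<bar>S n u\<bar> \<le> B * indicator {0..1} u" for u
    proof (cases "u \<in> {0..<1}")
      case True
      then have "\<bar>F n (grid_point n u)\<bar> \<le> B"
        using elim(1)[rule_format, of "grid_point n u"] grid_point_in_unit[OF elim(2), of u] by simp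
      then show ?thesis unfolding Seq[OF elim(2)] using True by simp
    next
      case False
      then show ?thesis unfolding Seq[OF elim(2)] using B0 by (simp add: indicator_def)
    qed
    moreover have "S n \<in> borel_measurable lborel" unfolding S_def[abs_def] by measurable
    ultimately show ?case by simp
  qed
  have w: "integrable lborel (\<lambda>u::real. B * indicator {0..1} u)" by auto
  have "(\<lambda>n. \<integral>u. S n u \<partial>lborel) \<longlonglongrightarrow> (\<integral>u. indicator {0..<1} u * f u \<partial>lborel)"
    by (rule dominated_convergence_eventually[OF meas w _ Sbnd]) (use Slim in auto)
  moreover have "(\<integral>u. indicator {0..<1} u * f u \<partial>lborel) = (\<integral>u. indicator {0..1} u * f u \<partial>lborel)"
  proof (rule integral_cong_AE)
    show "AE u in lborel. indicator {0..<1} u * f u = indicator {0..1} u * f u"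
      using AE_lborel_singleton[of 1] by eventually_elim (auto simp: indicator_def)
    show "(\<lambda>u. indicator {0..1} u * f u) \<in> borel_measurable lborel"
      using borel_measurable_continuous_on_indicator[OF _ f] by simp
  qed (use meas in simp)
  moreover have "(\<integral>u. indicator {0..1} u * f u \<partial>lborel) = integral {0..1} f"
    using set_borel_integral_eq_integral(2)[OF fint] by (simp add: set_lebesgue_integral_def)
  moreover have "(\<integral>u. S n u \<partial>lborel) = (\<Sum>j<n. F n ((real j + 1) / n)) / n" for n
  proof -
    have i: "integrable lborel (\<lambda>u. F n ((real j + 1) / n) * indicator {real j / n..<(real j + 1) / n} u)" for j
    proof -
      have "real j / n \<le> (real j + 1) / n" by (simp add: divide_right_mono)
      then show ?thesis by (intro integrable_mult_right) (simp add: integrable_indicator_iff)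
    qed
    have "measure lborel {real j / n..<(real j + 1) / n} = 1 / n" for j
      by (subst measure_lborel_Ico) (simp_all add: divide_right_mono add_divide_distrib)
    then show ?thesis unfolding S_def
      by (subst Bochner_Integration.integral_sum[OF i]) (simp add: sum_divide_distrib)
  qed
  ultimately show ?thesis by simp
qed

text \<open>Completing the square shows that the integrand is a multiple of the normal density with mean \<open>b / \<kappa>\<close>
  and variance \<open>1 / \<kappa>\<close>.\<close>

lemma integral_gaussian_exponential_tilt:
  fixes \<kappa> b :: real
  assumes "\<kappa> > 0"
  shows "integrable lborel (\<lambda>y. exp (- (\<kappa> * y\<^sup>2 / 2) + b * y))"
    and "(\<integral>y. exp (- (\<kappa> * y\<^sup>2 / 2) + b * y) \<partial>lborel) = sqrt (2 * pi / \<kappa>) * exp (b\<^sup>2 / (2 * \<kappa>))"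
proof -
  define \<sigma> where "\<sigma> = 1 / sqrt \<kappa>"
  have \<sigma>: "\<sigma> > 0" "\<sigma>\<^sup>2 = 1 / \<kappa>" using assms by (auto simp: \<sigma>_def power_divide)
  have "- (y - b / \<kappa>)\<^sup>2 / (2 * \<sigma>\<^sup>2) = - (\<kappa> * y\<^sup>2 / 2) + b * y - b\<^sup>2 / (2 * \<kappa>)" for y
    using assms unfolding \<sigma>(2) by (simp add: power2_eq_square field_simps)
  then have eq: "exp (- (\<kappa> * y\<^sup>2 / 2) + b * y) = sqrt (2 * pi / \<kappa>) * exp (b\<^sup>2 / (2 * \<kappa>)) * normal_density (b / \<kappa>) \<sigma> y" for y
    using assms by (simp add: normal_density_def \<sigma>(2) exp_diff exp_add)
  show "integrable lborel (\<lambda>y. exp (- (\<kappa> * y\<^sup>2 / 2) + b * y))"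
    unfolding eq using \<sigma> by (intro integrable_mult_right integrable_normal_density)
  show "(\<integral>y. exp (- (\<kappa> * y\<^sup>2 / 2) + b * y) \<partial>lborel) = sqrt (2 * pi / \<kappa>) * exp (b\<^sup>2 / (2 * \<kappa>))"
    unfolding eq using \<sigma> by (subst integral_mult_right_zero) (simp add: integral_normal_density)
qed

lemma integrable_exp_minus_abs: "integrable lborel (\<lambda>y::real. exp (- \<bar>y\<bar>))"
proof -
  let ?f = "\<lambda>y::real. exp (- y) * indicator {0..} y"
  have "(\<integral>\<^sup>+y. ennreal (exp (- y)) * indicator {0..} y \<partial>lborel) = ennreal (0 - (- exp (- 0)))"
  proof (rule nn_integral_FTC_atLeast)
    show "((\<lambda>y. - exp (- y)) \<longlongrightarrow> (0::real)) at_top" by real_asymp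
  qed (auto intro!: derivative_eq_intros)
  moreover have "ennreal (?f y) = ennreal (exp (- y)) * indicator {0..} y" for y
    by (simp add: indicator_def)
  ultimately have f: "integrable lborel ?f" by (intro integrableI_nonneg) auto
  have "integrable lborel (\<lambda>y. ?f (0 + (- 1) * y))" by (rule lborel_integrable_real_affine[OF f]) simp
  with f have "integrable lborel (\<lambda>y. ?f y + ?f (- y))" by auto
  then show ?thesis
    by (rule Bochner_Integration.integrable_bound) (auto simp: indicator_def)
qed

text \<open>Convex functions \<open>E N\<close> whose slopes approach those of the parabola \<open>\<kappa> y\<^sup>2 / 2\<close> uniformly on bounded
  sets. Convexity extends this local information to bounds on the whole line.\<close>

locale convex_quadratic_limit =
  fixes E E' :: "nat \<Rightarrow> real \<Rightarrow> real" and \<kappa> :: real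
  assumes kappa: "\<kappa> > 0"
    and convex: "\<forall>\<^sub>F N in sequentially. (\<forall>y. (E N has_real_derivative E' N y) (at y)) \<and> mono (E' N) \<and>
                   E N 0 = 0 \<and> E' N 0 = 0"
    and slope: "\<And>Y e. e > 0 \<Longrightarrow> \<forall>\<^sub>F N in sequentially. \<forall>y\<in>{- Y..Y}. \<bar>E' N y - \<kappa> * y\<bar> \<le> e"
begin

lemma tendsto_quadratic:
  assumes y: "y \<longlonglongrightarrow> y0"
  shows "(\<lambda>N. E N (y N)) \<longlonglongrightarrow> \<kappa> * y0\<^sup>2 / 2"
proof -
  define Y where "Y = \<bar>y0\<bar> + 1"
  have Y: "Y > 0" by (simp add: Y_def add_nonneg_pos)
  have "(\<lambda>N. \<bar>y N\<bar>) \<longlonglongrightarrow> \<bar>y0\<bar>" by (intro tendsto_intros y)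
  then have yY: "\<forall>\<^sub>F N in sequentially. \<bar>y N\<bar> < Y" by (rule order_tendstoD) (simp add: Y_def)
  have "(\<lambda>N. E N (y N) - \<kappa> * (y N)\<^sup>2 / 2) \<longlonglongrightarrow> 0"
  proof (rule tendstoI)
    fix e :: real assume e: "e > 0"
    define d where "d = e / (2 * Y)"
    have d: "d > 0" using e Y by (simp add: d_def)
    show "\<forall>\<^sub>F N in sequentially. dist (E N (y N) - \<kappa> * (y N)\<^sup>2 / 2) 0 < e"
      using convex slope[OF d, of Y] yY
    proof eventually_elim
      case (elim N)
      have "norm ((E N (y N) - \<kappa> * (y N)\<^sup>2 / 2) - (E N 0 - \<kappa> * 0\<^sup>2 / 2)) \<le> d * norm (y N - 0)"
      proof (rule field_differentiable_bound[where S = "{- Y..Y}" and f' = "\<lambda>t. E' N t - \<kappa> * t"])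
        fix t assume t: "t \<in> {- Y..Y}"
        have "(E N has_real_derivative E' N t) (at t within {- Y..Y})"
          using elim(1) by (auto intro: has_field_derivative_at_within)
        then show "((\<lambda>t. E N t - \<kappa> * t\<^sup>2 / 2) has_real_derivative E' N t - \<kappa> * t) (at t within {- Y..Y})"
          by (auto intro!: derivative_eq_intros)
        show "norm (E' N t - \<kappa> * t) \<le> d" using elim(2) t by simp
      qed (use elim(3) Y in auto)
      also have "\<dots> \<le> d * Y" using elim(3) d by simp
      also have "\<dots> < e" using e Y by (simp add: d_def)
      finally show ?case using elim(1) by simp
    qed
  qed
  then have "(\<lambda>N. E N (y N) - \<kappa> * (y N)\<^sup>2 / 2 + \<kappa> * (y N)\<^sup>2 / 2) \<longlonglongrightarrow> 0 + \<kappa> * y0\<^sup>2 / 2"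
    by (intro tendsto_intros y) auto
  then show ?thesis by simp
qed

lemma tangent_below:
  "\<forall>\<^sub>F N in sequentially. \<forall>c y. E N c + E' N c * (y - c) \<le> E N y"
  using convex
proof eventually_elim
  case (elim N)
  have "E N c + E' N c * (y - c) \<le> E N y" for c y
  proof (cases y c rule: linorder_cases)
    case less
    obtain t where t: "y < t" "t < c" "E N c - E N y = (c - y) * E' N t"
      using MVT2[OF less, of "E N" "E' N"] elim by auto
    have "(c - y) * E' N t \<le> (c - y) * E' N c" using t less elim by (intro mult_left_mono) (auto simp: mono_def)
    then show ?thesis using t(3) by (simp add: algebra_simps)
  next
    case greater
    obtain t where t: "c < t" "t < y" "E N y - E N c = (y - c) * E' N t"
      using MVT2[OF greater, of "E N" "E' N"] elim by auto
    have "(y - c) * E' N c \<le> (y - c) * E' N t" using t greater elim by (intro mult_left_mono) (auto simp: mono_def)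
    then show ?thesis using t(3) by (simp add: algebra_simps)
  qed simp
  then show ?case by blast
qed

text \<open>A convex function lies above its tangents, and at \<open>4 / \<kappa>\<close> and \<open>- 4 / \<kappa>\<close> the slopes are eventually at
  least \<open>3\<close> in modulus. This exceeds the modulus \<open>2\<close> of the largest exponential tilt below.\<close>

lemma linear_growth:
  obtains Y where "\<forall>\<^sub>F N in sequentially. \<forall>y. 3 * (\<bar>y\<bar> - Y) \<le> E N y"
proof
  define Y where "Y = 4 / \<kappa>"
  have Y: "Y > 0" "\<kappa> * Y = 4" using kappa by (auto simp: Y_def)
  show "\<forall>\<^sub>F N in sequentially. \<forall>y. 3 * (\<bar>y\<bar> - Y) \<le> E N y"
    using convex tangent_below slope[OF zero_less_one, of Y]
  proof eventually_elim
    case (elim N)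
    have pos: "0 \<le> E N y" for y using elim(2)[rule_format, of 0 y] elim(1) by simp
    have "\<bar>E' N Y - 4\<bar> \<le> 1" "\<bar>E' N (- Y) + 4\<bar> \<le> 1"
      using elim(3)[rule_format, of Y] elim(3)[rule_format, of "- Y"] Y by auto
    then have sl: "3 \<le> E' N Y" "E' N (- Y) \<le> - 3" by linarith+
    show ?case
    proof
      fix y
      consider "y \<ge> Y" | "y \<le> - Y" | "\<bar>y\<bar> \<le> Y" by linarith
      then show "3 * (\<bar>y\<bar> - Y) \<le> E N y"
      proof cases
        case 1
        have "3 * (y - Y) \<le> E' N Y * (y - Y)" using sl 1 by (intro mult_right_mono) auto
        then show ?thesis using elim(2)[rule_format, of Y y] pos[of Y] 1 Y by simp
      next
        case 2
        have "E' N (- Y) * (- y - Y) \<le> - 3 * (- y - Y)" using sl 2 by (intro mult_right_mono) auto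
        moreover have "E' N (- Y) * (y - (- Y)) = - (E' N (- Y) * (- y - Y))" by (simp add: algebra_simps)
        ultimately show ?thesis using elim(2)[rule_format, of "- Y" y] pos[of "- Y"] 2 Y by simp
      next
        case 3
        then show ?thesis using pos[of y] by simp
      qed
    qed
  qed
qed

text \<open>Up to the factor \<open>2 / N\<close> these are the squared norms of the orthogonal monomials, with \<open>a = (j + 1) / N\<close>
  for the monomial of degree \<open>j\<close>.\<close>

definition tilted_mass :: "nat \<Rightarrow> real \<Rightarrow> real" where
  "tilted_mass N a = (\<integral>y. exp (- E N y + 2 * (1 - a) * y) \<partial>lborel)"

lemma measurable_E: "\<forall>\<^sub>F N in sequentially. E N \<in> borel_measurable borel"
  using convex
proof eventually_elim
  case (elim N)
  then have "continuous_on UNIV (E N)" by (auto intro!: DERIV_isCont simp: continuous_on_eq_continuous_at)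
  then show ?case by (rule borel_measurable_continuous_onI)
qed

lemma integrand_bound:
  obtains C where "\<forall>\<^sub>F N in sequentially. \<forall>a\<in>{0..1}. \<forall>y. exp (- E N y + 2 * (1 - a) * y) \<le> C * exp (- \<bar>y\<bar>)"
proof -
  obtain Y where Y: "\<forall>\<^sub>F N in sequentially. \<forall>y. 3 * (\<bar>y\<bar> - Y) \<le> E N y" by (rule linear_growth)
  have "\<forall>\<^sub>F N in sequentially. \<forall>a\<in>{0..1}. \<forall>y. exp (- E N y + 2 * (1 - a) * y) \<le> exp (3 * Y) * exp (- \<bar>y\<bar>)"
    using Y
  proof eventually_elim
    case (elim N)
    show ?case
    proof (intro ballI allI)
      fix a y :: real assume a: "a \<in> {0..1}"
      have "(1 - a) * y \<le> (1 - a) * \<bar>y\<bar>" using a by (intro mult_left_mono) auto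
      then have "2 * (1 - a) * y \<le> 2 * ((1 - a) * \<bar>y\<bar>)" unfolding mult.assoc by (rule mult_left_mono) simp
      also have "\<dots> \<le> 2 * \<bar>y\<bar>" using a by (intro mult_left_mono mult_left_le_one_le) auto
      finally have "- E N y + 2 * (1 - a) * y \<le> 3 * Y + - \<bar>y\<bar>" using elim[rule_format, of y] by simp
      then show "exp (- E N y + 2 * (1 - a) * y) \<le> exp (3 * Y) * exp (- \<bar>y\<bar>)"
        unfolding exp_add[symmetric] by simp
    qed
  qed
  then show ?thesis by (rule that)
qed

lemma integrable_tilted_mass:
  "\<forall>\<^sub>F N in sequentially. \<forall>a\<in>{0..1}. integrable lborel (\<lambda>y. exp (- E N y + 2 * (1 - a) * y))"
proof -
  obtain C where C: "\<forall>\<^sub>F N in sequentially. \<forall>a\<in>{0..1}. \<forall>y. exp (- E N y + 2 * (1 - a) * y) \<le> C * exp (- \<bar>y\<bar>)"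
    by (rule integrand_bound)
  show ?thesis using C measurable_E
  proof eventually_elim
    case (elim N)
    note elim(2)[measurable]
    have bound: "norm (exp (- E N y + 2 * (1 - a) * y)) \<le> norm (C * exp (- \<bar>y\<bar>))" if "a \<in> {0..1}" for a y
      using elim(1)[rule_format, OF that, of y] by simp
    show ?case
      by (intro ballI Bochner_Integration.integrable_bound[OF integrable_mult_right[OF integrable_exp_minus_abs, of C]])
        (use bound in auto)
  qed
qed

lemma tilted_mass_tendsto:
  assumes a: "\<And>N. a N \<in> {0..1}" "a \<longlonglongrightarrow> a0"
  shows "(\<lambda>N. tilted_mass N (a N)) \<longlonglongrightarrow> sqrt (2 * pi / \<kappa>) * exp (2 * (1 - a0)\<^sup>2 / \<kappa>)"
proof -
  obtain C where C: "\<forall>\<^sub>F N in sequentially. \<forall>a\<in>{0..1}. \<forall>y. exp (- E N y + 2 * (1 - a) * y) \<le> C * exp (- \<bar>y\<bar>)"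
    by (rule integrand_bound)
  let ?f = "\<lambda>y. exp (- (\<kappa> * y\<^sup>2 / 2) + (2 * (1 - a0)) * y)"
  have "(\<lambda>N. \<integral>y. exp (- E N y + 2 * (1 - a N) * y) \<partial>lborel) \<longlonglongrightarrow> (\<integral>y. ?f y \<partial>lborel)"
  proof (rule dominated_convergence_eventually[where w = "\<lambda>y. C * exp (- \<bar>y\<bar>)"])
    show "integrable lborel (\<lambda>y::real. C * exp (- \<bar>y\<bar>))" by (intro integrable_mult_right integrable_exp_minus_abs)
    show "AE y in lborel. (\<lambda>N. exp (- E N y + 2 * (1 - a N) * y)) \<longlonglongrightarrow> ?f y"
      by (intro AE_I2 tendsto_intros a tendsto_quadratic)
    show "\<forall>\<^sub>F N in sequentially. (\<lambda>y. exp (- E N y + 2 * (1 - a N) * y)) \<in> borel_measurable lborel \<and>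
       (AE y in lborel. \<bar>exp (- E N y + 2 * (1 - a N) * y)\<bar> \<le> C * exp (- \<bar>y\<bar>))"
      using C measurable_E
    proof eventually_elim
      case (elim N)
      note elim(2)[measurable]
      show ?case using elim(1) a(1)[of N] by auto
    qed
  qed auto
  moreover have "(\<integral>y. ?f y \<partial>lborel) = sqrt (2 * pi / \<kappa>) * exp (2 * (1 - a0)\<^sup>2 / \<kappa>)"
    unfolding integral_gaussian_exponential_tilt(2)[OF kappa] power_mult_distrib by simp
  ultimately show ?thesis by (simp add: tilted_mass_def)
qed

lemma tilted_mass_lower_bound:
  obtains c where "c > 0" "\<forall>\<^sub>F N in sequentially. \<forall>a\<in>{0..1}. c \<le> tilted_mass N a"
proof (rule that)
  show "exp (- (\<kappa> + 1)) > 0" by simp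
  show "\<forall>\<^sub>F N in sequentially. \<forall>a\<in>{0..1}. exp (- (\<kappa> + 1)) \<le> tilted_mass N a"
    using convex tangent_below slope[OF zero_less_one, of 1] integrable_tilted_mass
  proof eventually_elim
    case (elim N)
    have "exp (- (\<kappa> + 1)) \<le> tilted_mass N a" if a: "a \<in> {0..1}" for a
    proof -
      have "exp (- (\<kappa> + 1)) * indicator {0..1} y \<le> exp (- E N y + 2 * (1 - a) * y)" for y :: real
      proof (cases "y \<in> {0..1}")
        case True
        \<comment> \<open>the tangent at \<open>y\<close> evaluated at the origin\<close>
        have "E N y \<le> E' N y * y" using elim(2)[rule_format, of y 0] elim(1) by simp
        also have "\<dots> \<le> (\<kappa> + 1) * 1"
        proof (rule mult_mono)
          have "\<bar>E' N y - \<kappa> * y\<bar> \<le> 1" using elim(3) True by simp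
          moreover have "\<kappa> * y \<le> \<kappa>" using True kappa by simp
          ultimately show "E' N y \<le> \<kappa> + 1" by linarith
        qed (use True kappa in auto)
        finally have "E N y \<le> \<kappa> + 1" by simp
        moreover have "0 \<le> 2 * (1 - a) * y" using a True by simp
        ultimately have "- (\<kappa> + 1) \<le> - E N y + 2 * (1 - a) * y" by linarith
        then show ?thesis using True by simp
      qed simp
      then have "(\<integral>y. exp (- (\<kappa> + 1)) * indicator {0..1::real} y \<partial>lborel) \<le> tilted_mass N a"
        unfolding tilted_mass_def using elim(4) a by (intro integral_mono) auto
      then show ?thesis by simp
    qed
    then show ?case by blast
  qed
qed

text \<open>A Riemann sum over \<open>u = (j + 1) / N\<close>. Each summand tends to a normalized Gaussian in \<open>y0\<close> with
  variance \<open>1 / \<kappa>\<close> and centre \<open>2 (1 - u) / \<kappa>\<close>.\<close>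

lemma normalized_sum_tendsto:
  assumes y: "y \<longlonglongrightarrow> y0"
  shows "(\<lambda>N. (\<Sum>j<N. exp (- E N (y N) + 2 * (1 - (real j + 1) / N) * y N) / tilted_mass N ((real j + 1) / N)) / N)
    \<longlonglongrightarrow> integral {0..1} (\<lambda>u. sqrt (\<kappa> / (2 * pi)) * exp (- (\<kappa> * y0 - 2 * (1 - u))\<^sup>2 / (2 * \<kappa>)))"
proof -
  let ?F = "\<lambda>N a. exp (- E N (y N) + 2 * (1 - a) * y N) / tilted_mass N a"
  let ?f = "\<lambda>u. sqrt (\<kappa> / (2 * pi)) * exp (- (\<kappa> * y0 - 2 * (1 - u))\<^sup>2 / (2 * \<kappa>))"
  obtain c where c: "c > 0" "\<forall>\<^sub>F N in sequentially. \<forall>a\<in>{0..1}. c \<le> tilted_mass N a" by (rule tilted_mass_lower_bound)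
  define Y where "Y = \<bar>y0\<bar> + 1"
  have "(\<lambda>N. \<bar>y N\<bar>) \<longlonglongrightarrow> \<bar>y0\<bar>" by (intro tendsto_intros y)
  then have yY: "\<forall>\<^sub>F N in sequentially. \<bar>y N\<bar> < Y" by (rule order_tendstoD) (simp add: Y_def)
  show ?thesis
  proof (rule riemann_sum_tendsto[where F = ?F and B = "exp (2 * Y) / c"])
    fix u and a :: "nat \<Rightarrow> real" assume a: "\<And>N. a N \<in> {0..1}" "a \<longlonglongrightarrow> u"
    have "(\<lambda>N. ?F N (a N)) \<longlonglongrightarrow> exp (- (\<kappa> * y0\<^sup>2 / 2) + 2 * (1 - u) * y0) / (sqrt (2 * pi / \<kappa>) * exp (2 * (1 - u)\<^sup>2 / \<kappa>))"
      using kappa by (intro tendsto_intros tilted_mass_tendsto tendsto_quadratic y a) auto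
    also have "exp (- (\<kappa> * y0\<^sup>2 / 2) + 2 * (1 - u) * y0) / (sqrt (2 * pi / \<kappa>) * exp (2 * (1 - u)\<^sup>2 / \<kappa>)) =
        (1 / sqrt (2 * pi / \<kappa>)) * exp (- (\<kappa> * y0\<^sup>2 / 2) + 2 * (1 - u) * y0 - 2 * (1 - u)\<^sup>2 / \<kappa>)"
      by (simp add: exp_diff)
    also have "1 / sqrt (2 * pi / \<kappa>) = sqrt (\<kappa> / (2 * pi))" by (simp add: real_sqrt_divide)
    also have "- (\<kappa> * y0\<^sup>2 / 2) + 2 * (1 - u) * y0 - 2 * (1 - u)\<^sup>2 / \<kappa> = - (\<kappa> * y0 - 2 * (1 - u))\<^sup>2 / (2 * \<kappa>)"
      using kappa by (simp add: field_simps power2_eq_square)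
    finally show "(\<lambda>N. ?F N (a N)) \<longlonglongrightarrow> ?f u" .
  next
    show "\<forall>\<^sub>F N in sequentially. \<forall>u\<in>{0..1}. \<bar>?F N u\<bar> \<le> exp (2 * Y) / c"
      using c(2) yY convex tangent_below
    proof eventually_elim
      case (elim N)
      have "0 \<le> E N (y N)" using elim(4)[rule_format, of 0 "y N"] elim(3) by simp
      have "\<bar>?F N u\<bar> \<le> exp (2 * Y) / c" if u: "u \<in> {0..1}" for u
      proof -
        have Jc: "c \<le> tilted_mass N u" using elim(1) u by blast
        have "(1 - u) * y N \<le> (1 - u) * \<bar>y N\<bar>" using u by (intro mult_left_mono) auto
      then have "2 * (1 - u) * y N \<le> 2 * ((1 - u) * \<bar>y N\<bar>)" unfolding mult.assoc by (rule mult_left_mono) simp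
        also have "\<dots> \<le> 2 * \<bar>y N\<bar>" using u by (intro mult_left_mono mult_left_le_one_le) auto
        finally have "- E N (y N) + 2 * (1 - u) * y N \<le> 2 * Y" using elim(2) \<open>0 \<le> E N (y N)\<close> by linarith
        then have "?F N u \<le> exp (2 * Y) / c" using Jc c(1) by (intro frac_le) auto
        moreover have "?F N u \<ge> 0" using Jc c(1) by simp
        ultimately show ?thesis by simp
      qed
      then show ?case by blast
    qed
  qed (use kappa in \<open>intro continuous_intros, auto\<close>)
qed

end

section \<open>Elementary limits\<close>

text \<open>If uniform convergence failed, a subsequence of points witnessing the failure would converge; filled up
  by its limit it becomes a full sequence, along which the hypothesis applies.\<close>

lemma uniform_limit_compactI:
  fixes R :: "nat \<Rightarrow> 'a::metric_space \<Rightarrow> real"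
  assumes K: "compact K" and f: "continuous_on K f"
    and seq: "\<And>w w0. (\<And>n. w n \<in> K) \<Longrightarrow> w0 \<in> K \<Longrightarrow> w \<longlonglongrightarrow> w0 \<Longrightarrow> (\<lambda>n. R n (w n)) \<longlonglongrightarrow> f w0"
  shows "uniform_limit K R f sequentially"
proof (rule ccontr)
  assume "\<not> ?thesis"
  then obtain e where e: "e > 0" and "\<not> (\<forall>\<^sub>F n in sequentially. \<forall>x\<in>K. dist (R n x) (f x) < e)"
    unfolding uniform_limit_iff by blast
  then have fr: "\<exists>\<^sub>F n in sequentially. \<exists>x\<in>K. dist (R n x) (f x) \<ge> e"
    by (simp add: frequently_def not_le)
  then have inf: "infinite {n. \<exists>x\<in>K. dist (R n x) (f x) \<ge> e}"
    by (simp add: frequently_cofinite flip: cofinite_eq_sequentially)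
  define \<sigma> where "\<sigma> = enumerate {n. \<exists>x\<in>K. dist (R n x) (f x) \<ge> e}"
  have sm: "strict_mono \<sigma>" unfolding \<sigma>_def by (rule strict_mono_enumerate[OF inf])
  have "\<forall>k. \<exists>x\<in>K. dist (R (\<sigma> k) x) (f x) \<ge> e"
    using enumerate_in_set[OF inf] unfolding \<sigma>_def by blast
  then obtain v where v: "\<And>k. v k \<in> K" "\<And>k. dist (R (\<sigma> k) (v k)) (f (v k)) \<ge> e" by metis
  obtain w0 \<tau> where w0: "w0 \<in> K" "strict_mono \<tau>" "(v \<circ> \<tau>) \<longlonglongrightarrow> w0"
    using K v(1) unfolding compact_def by blast
  define s where "s = \<sigma> \<circ> \<tau>"
  have ss: "strict_mono s" unfolding s_def using sm w0(2) by (rule strict_mono_o)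
  then have inj: "inj s" by (rule strict_mono_imp_inj_on)
  define w where "w n = (if n \<in> range s then v (\<tau> (inv s n)) else w0)" for n
  have ws: "w (s k) = v (\<tau> k)" for k by (simp add: w_def inv_f_f[OF inj])
  have wK: "w n \<in> K" for n using v(1) w0(1) by (simp add: w_def)
  have "w \<longlonglongrightarrow> w0"
  proof (rule metric_LIMSEQ_I)
    fix d :: real assume "d > 0"
    then obtain K0 where K0: "\<And>k. k \<ge> K0 \<Longrightarrow> dist (v (\<tau> k)) w0 < d"
      using w0(3) by (auto simp: lim_sequentially)
    have "dist (w n) w0 < d" if n: "n \<ge> s K0" for n
    proof (cases "n \<in> range s")
      case True
      then obtain k where k: "n = s k" by auto
      then have "k \<ge> K0" using n strict_mono_less_eq[OF ss] by simp
      then show ?thesis using K0 k ws by simp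
    qed (use \<open>d > 0\<close> in \<open>simp add: w_def\<close>)
    then show "\<exists>no. \<forall>n\<ge>no. dist (w n) w0 < d" by blast
  qed
  from seq[OF wK w0(1) this] have "(\<lambda>n. R n (w n)) \<longlonglongrightarrow> f w0" .
  from LIMSEQ_subseq_LIMSEQ[OF this ss] have 1: "(\<lambda>k. R (s k) (v (\<tau> k))) \<longlonglongrightarrow> f w0"
    by (simp add: o_def ws)
  have 2: "(\<lambda>k. f (v (\<tau> k))) \<longlonglongrightarrow> f w0"
    using continuous_on_tendsto_compose[OF f w0(3)[unfolded o_def] w0(1)] v(1) by simp
  have "(\<lambda>k. dist (R (s k) (v (\<tau> k))) (f (v (\<tau> k)))) \<longlonglongrightarrow> dist (f w0) (f w0)"
    by (intro tendsto_dist 1 2)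
  then have "\<forall>\<^sub>F k in sequentially. dist (R (s k) (v (\<tau> k))) (f (v (\<tau> k))) < e"
    using e by (intro order_tendstoD) auto
  then obtain k where "dist (R (s k) (v (\<tau> k))) (f (v (\<tau> k))) < e"
    using eventually_happens'[OF sequentially_bot] by blast
  with v(2)[of "\<tau> k"] show False by (simp add: s_def)
qed

text \<open>Expansion of \<open>|1 + q / N|\<^sup>2 = 1 + u\<close> with \<open>N u\<close> tending to \<open>2 Re q0\<close>.\<close>

lemma ln_cmod_one_plus_tendsto:
  assumes q: "q \<longlonglongrightarrow> q0"
  shows "(\<lambda>N. real N * ln (cmod (1 + q N / of_nat N))) \<longlonglongrightarrow> Re q0"
proof -
  define u where "u N = 2 * Re (q N) / N + (cmod (q N))\<^sup>2 / (real N)\<^sup>2" for N :: nat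
  have inv0: "(\<lambda>N. 1 / real N) \<longlonglongrightarrow> 0" by real_asymp
  have "(\<lambda>N. 2 * Re (q N) * (1 / real N) + (cmod (q N))\<^sup>2 * (1 / real N) * (1 / real N)) \<longlonglongrightarrow>
      2 * Re q0 * 0 + (cmod q0)\<^sup>2 * 0 * 0"
    by (intro tendsto_intros q inv0)
  then have u0: "u \<longlonglongrightarrow> 0" by (simp add: u_def[abs_def] power2_eq_square)
  have "(\<lambda>N. 2 * Re (q N) + (cmod (q N))\<^sup>2 * (1 / real N)) \<longlonglongrightarrow> 2 * Re q0 + (cmod q0)\<^sup>2 * 0"
    by (intro tendsto_intros q inv0)
  moreover have "\<forall>\<^sub>F N in sequentially. 2 * Re (q N) + (cmod (q N))\<^sup>2 * (1 / real N) = real N * u N"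
    using eventually_gt_at_top[of 0] by eventually_elim (simp add: u_def field_simps power2_eq_square)
  ultimately have Nu: "(\<lambda>N. real N * u N) \<longlonglongrightarrow> 2 * Re q0"
    using Lim_transform_eventually by fastforce
  have small: "\<forall>\<^sub>F N in sequentially. \<bar>u N\<bar> < 1 / 2"
    using order_tendstoD(2)[OF tendsto_rabs[OF u0], of "1/2"] by simp
  have "(\<lambda>N. real N * (ln (1 + u N) - u N)) \<longlonglongrightarrow> 0"
  proof (rule Lim_null_comparison)
    show "(\<lambda>N. 2 * (real N * u N) * u N) \<longlonglongrightarrow> 0"
      using tendsto_mult[OF tendsto_mult[OF tendsto_const[of 2] Nu] u0] by simp
    show "\<forall>\<^sub>F N in sequentially. norm (real N * (ln (1 + u N) - u N)) \<le> 2 * (real N * u N) * u N"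
      using small
    proof eventually_elim
      case (elim N)
      then have "\<bar>ln (1 + u N) - u N\<bar> \<le> 2 * (u N)\<^sup>2" by (intro abs_ln_one_plus_x_minus_x_bound) auto
      then have "real N * \<bar>ln (1 + u N) - u N\<bar> \<le> real N * (2 * (u N)\<^sup>2)" by (rule mult_left_mono) simp
      then show ?case by (simp add: abs_mult power2_eq_square mult_ac)
    qed
  qed
  from tendsto_add[OF this Nu] have "(\<lambda>N. real N * ln (1 + u N)) \<longlonglongrightarrow> 2 * Re q0"
    by (simp add: algebra_simps)
  then have "(\<lambda>N. real N * ln (1 + u N) / 2) \<longlonglongrightarrow> 2 * Re q0 / 2"
    by (rule tendsto_divide[OF _ tendsto_const]) simp
  moreover have "\<forall>\<^sub>F N in sequentially. real N * ln (1 + u N) / 2 = real N * ln (cmod (1 + q N / of_nat N))"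
    using small eventually_gt_at_top[of 0]
  proof eventually_elim
    case (elim N)
    have "(cmod (1 + q N / of_nat N))\<^sup>2 = (1 + Re (q N) / N)\<^sup>2 + (Im (q N) / N)\<^sup>2"
      by (simp add: cmod_power2)
    also have "\<dots> = 1 + u N"
      unfolding u_def cmod_power2 using elim(2) by (simp add: power2_eq_square field_simps)
    finally have sq: "1 + u N = (cmod (1 + q N / of_nat N))\<^sup>2" ..
    have "1 + u N > 0" using elim(1) by linarith
    then have "cmod (1 + q N / of_nat N) > 0" unfolding sq by (metis zero_less_norm_iff norm_zero power_zero_numeral less_irrefl)
    then show ?case unfolding sq by (simp add: ln_realpow)
  qed
  ultimately show ?thesis using Lim_transform_eventually by fastforce
qed

lemma DERIV_between_slopes:
  fixes f :: "real \<Rightarrow> real"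
  assumes der: "(f has_real_derivative d) (at x)" and \<delta>: "\<delta> > 0"
    and lo: "\<And>y. x < y \<Longrightarrow> y < x + \<delta> \<Longrightarrow> a * (y - x) \<le> f y - f x"
    and hi: "\<And>y. x < y \<Longrightarrow> y < x + \<delta> \<Longrightarrow> f y - f x \<le> b * (y - x)"
  shows "a \<le> d" "d \<le> b"
proof -
  have lim: "((\<lambda>y. (f y - f x) / (y - x)) \<longlongrightarrow> d) (at_right x)"
    using der unfolding has_field_derivative_iff by (rule tendsto_within_subset) simp
  have ev: "\<forall>\<^sub>F y in at_right x. x < y \<and> y < x + \<delta>"
    using \<delta> by (auto simp: eventually_at_right_field intro!: exI[of _ "x + \<delta>"])
  have "\<forall>\<^sub>F y in at_right x. a \<le> (f y - f x) / (y - x)"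
    using ev by eventually_elim (use lo in \<open>simp add: pos_le_divide_eq\<close>)
  with lim show "a \<le> d" by (intro tendsto_lowerbound[OF lim]) auto
  have "\<forall>\<^sub>F y in at_right x. (f y - f x) / (y - x) \<le> b"
    using ev by eventually_elim (use hi in \<open>simp add: pos_divide_le_eq\<close>)
  with lim show "d \<le> b" by (intro tendsto_upperbound[OF lim]) auto
qed

lemma abs_exp_minus_one_minus_le:
  fixes x :: real
  assumes "\<bar>x\<bar> \<le> 1 / 2"
  shows "\<bar>exp x - 1 - x\<bar> \<le> 2 * x\<^sup>2"
proof -
  have lo: "1 + x \<le> exp x" by (rule exp_ge_add_one_self)
  have "1 - x \<le> exp (- x)" using exp_ge_add_one_self[of "- x"] by simp
  then have "exp x * (1 - x) \<le> exp x * exp (- x)" by (intro mult_left_mono) auto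
  then have "exp x * (1 - x) \<le> 1" by (simp add: exp_minus)
  then have "exp x \<le> 1 / (1 - x)" using assms by (simp add: pos_le_divide_eq)
  also have "\<dots> \<le> 1 + x + 2 * x\<^sup>2"
  proof -
    have "0 \<le> x\<^sup>2 * (1 - 2 * x)" using assms by (intro mult_nonneg_nonneg) auto
    then have "1 \<le> (1 + x + 2 * x\<^sup>2) * (1 - x)" by (simp add: algebra_simps power2_eq_square)
    then show ?thesis using assms by (simp add: pos_divide_le_eq)
  qed
  finally show ?thesis using lo zero_le_power2[of x] unfolding abs_le_iff by linarith
qed

text \<open>The substitution \<open>t = \<rho> / 2 - \<rho> u\<close> maps the centres of the Gaussians onto the interval of
  integration of the limit profile.\<close>

lemma limit_profile_eq_unit_integral:
  assumes "\<rho> > 0"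
  shows "\<rho>\<^sup>2 / 2 * integral {0..1} (\<lambda>u. sqrt ((4 / \<rho>\<^sup>2) / (2 * pi)) *
      exp (- ((4 / \<rho>\<^sup>2) * (\<rho>\<^sup>2 / 4 + \<rho> * v) - 2 * (1 - u))\<^sup>2 / (2 * (4 / \<rho>\<^sup>2)))) = limit_profile (\<rho> / 4) (2 * v)"
proof -
  let ?f = "\<lambda>t. exp (- (1 / 2) * (2 * v - t)\<^sup>2) :: real"
  have c: "continuous_on {- \<rho> / 2..\<rho> / 2} ?f" by (intro continuous_intros)
  have "(?f has_integral integral {- \<rho> / 2..\<rho> / 2} ?f) (cbox (- \<rho> / 2) (\<rho> / 2))"
    using integrable_integral[OF integrable_continuous_interval[OF c]] by simp
  from has_integral_affinity[OF this, of "- \<rho>" "\<rho> / 2"]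
  have "((\<lambda>u. ?f ((- \<rho>) *\<^sub>R u + \<rho> / 2)) has_integral (integral {- \<rho> / 2..\<rho> / 2} ?f / \<rho>))
      ((\<lambda>x. (1 / - \<rho>) *\<^sub>R x + - ((1 / - \<rho>) *\<^sub>R (\<rho> / 2))) ` cbox (- \<rho> / 2) (\<rho> / 2))"
    using assms by simp
  also have "(\<lambda>x. (1 / - \<rho>) *\<^sub>R x + - ((1 / - \<rho>) *\<^sub>R (\<rho> / 2))) ` cbox (- \<rho> / 2) (\<rho> / 2) = {0..1}"
  proof -
    have "(\<lambda>x. (1 / - \<rho>) *\<^sub>R x + - ((1 / - \<rho>) *\<^sub>R (\<rho> / 2))) = (\<lambda>x. (- 1 / \<rho>) * x + 1 / 2)"
      using assms by (auto simp: fun_eq_iff)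
    moreover have "- 1 / \<rho> < 0" "- \<rho> / 2 \<le> \<rho> / 2" using assms by simp_all
    ultimately show ?thesis using assms
      unfolding box_real by (simp only: image_affinity_atLeastAtMost) (simp add: not_le)
  qed
  finally have I: "integral {0..1} (\<lambda>u. ?f (\<rho> / 2 - \<rho> * u)) = integral {- \<rho> / 2..\<rho> / 2} ?f / \<rho>"
    by (intro integral_unique) (simp add: algebra_simps)
  have arg: "- ((4 / \<rho>\<^sup>2) * (\<rho>\<^sup>2 / 4 + \<rho> * v) - 2 * (1 - u))\<^sup>2 / (2 * (4 / \<rho>\<^sup>2)) = - (1 / 2) * (2 * v - (\<rho> / 2 - \<rho> * u))\<^sup>2" for u
  proof -
    have "(4 / \<rho>\<^sup>2) * (\<rho>\<^sup>2 / 4 + \<rho> * v) - 2 * (1 - u) = (2 / \<rho>) * (2 * v - (\<rho> / 2 - \<rho> * u))"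
      using assms by (simp add: field_simps power2_eq_square)
    then show ?thesis using assms by (simp only: power_mult_distrib) (simp add: power_divide)
  qed
  have sq: "sqrt ((4 / \<rho>\<^sup>2) / (2 * pi)) = (2 / \<rho>) / sqrt (2 * pi)"
  proof -
    have "4 / \<rho>\<^sup>2 = (2 / \<rho>)\<^sup>2" by (simp add: power_divide)
    moreover have "sqrt ((2 / \<rho>)\<^sup>2) = 2 / \<rho>" using assms by (intro real_sqrt_unique) auto
    ultimately show ?thesis unfolding real_sqrt_divide[of _ "2 * pi"] by (simp only:)
  qed
  have "integral {0..1} (\<lambda>u. sqrt ((4 / \<rho>\<^sup>2) / (2 * pi)) *
      exp (- ((4 / \<rho>\<^sup>2) * (\<rho>\<^sup>2 / 4 + \<rho> * v) - 2 * (1 - u))\<^sup>2 / (2 * (4 / \<rho>\<^sup>2)))) =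
      (2 / \<rho>) / sqrt (2 * pi) * (integral {- \<rho> / 2..\<rho> / 2} ?f / \<rho>)"
    unfolding arg sq integral_mult_right I ..
  moreover have "\<rho>\<^sup>2 / 2 * ((2 / \<rho>) / sqrt (2 * pi) * (X / \<rho>)) = 1 / sqrt (2 * pi) * X" for X
    using assms by (simp add: power2_eq_square)
  moreover have "limit_profile (\<rho> / 4) (2 * v) = 1 / sqrt (2 * pi) * integral {- \<rho> / 2..\<rho> / 2} ?f"
    by (simp add: limit_profile_def)
  ultimately show ?thesis by simp
qed

lemma continuous_on_limit_profile: "continuous_on S (limit_profile a)"
proof -
  have "continuous_on UNIV (\<lambda>x. integral (cbox (- 2 * a) (2 * a)) (\<lambda>t. exp (- (1 / 2) * (x - t)\<^sup>2) :: real))"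
    by (rule integral_continuous_on_param) (auto intro!: continuous_intros simp: case_prod_beta)
  then have "continuous_on UNIV (limit_profile a)"
    unfolding limit_profile_def[abs_def] by (intro continuous_intros) simp
  then show ?thesis by (rule continuous_on_subset) auto
qed

section \<open>Almost-circular potentials in logarithmic coordinates\<close>

text \<open>The derivative of \<open>g (exp t)\<close> with respect to \<open>t = ln s\<close>; up to a constant, the flux of the gradient
  of the potential through the circle of radius \<open>s\<close>.\<close>

definition radial_flux :: "(real \<Rightarrow> real) \<Rightarrow> real \<Rightarrow> real" where
  "radial_flux g s = s * deriv g s"

text \<open>The function \<open>N g(s)\<close> in the coordinate \<open>y = - N ln s\<close>. The term \<open>2 y\<close> removes its slope at the
  unit circle, where the flux is \<open>2\<close>, so that value and slope vanish at the origin.\<close>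

definition log_profile :: "nat \<Rightarrow> (real \<Rightarrow> real) \<Rightarrow> real \<Rightarrow> real" where
  "log_profile N g y = real N * g (exp (- y / N)) + 2 * y"

lemma tilt_exponent:
  fixes X y :: real and j N :: nat
  shows "- 2 * (y / N) + (- (2 * real j * (y / N)) + - X) = - (X + 2 * y) + 2 * (1 - (real j + 1) / N) * y"
proof -
  have "2 * (1 - (real j + 1) / N) * y = 2 * y - 2 * ((real j + 1) * (y / N))" by (simp add: left_diff_distrib right_diff_distrib)
  also have "(real j + 1) * (y / N) = real j * (y / N) + y / N" by (simp only: distrib_right mult_1)
  finally show ?thesis by simp
qed

context
  fixes k :: real and W :: "complex \<Rightarrow> ereal" and g :: "real \<Rightarrow> real" and r :: real
  assumes circ: "almost_circular k W g r"
begin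

lemma almost_circular_W: "z \<noteq> 0 \<Longrightarrow> W z = ereal (g (cmod z))"
  using circ by (simp add: almost_circular_def)

lemma almost_circular_W_not_MInf: "W z \<noteq> - \<infinity>"
  using circ by (simp add: almost_circular_def external_potential_def)

lemma almost_circular_W_measurable: "W \<in> borel_measurable borel"
proof (rule borel_measurableI_greater)
  fix c
  have "open {z. c < W z}" using circ by (simp add: almost_circular_def external_potential_def)
  then show "{x \<in> space borel. c < W x} \<in> sets borel" by simp
qed

lemma almost_circular_W_rotation: "cmod a = 1 \<Longrightarrow> W (a * z) = W z"
proof (cases "z = 0")
  case False
  moreover assume "cmod a = 1"
  moreover from this have "a \<noteq> 0" by auto
  ultimately show ?thesis using almost_circular_W[of "a * z"] almost_circular_W[of z] by (simp add: norm_mult)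
qed simp

lemma almost_circular_differentiable: "s > 0 \<Longrightarrow> g differentiable (at s)"
  using circ by (simp add: almost_circular_def)

lemma almost_circular_DERIV: "s > 0 \<Longrightarrow> (g has_real_derivative deriv g s) (at s)"
  using almost_circular_differentiable[of s] by (metis DERIV_imp_deriv real_differentiable_def)

lemma almost_circular_continuous: "continuous_on {0<..} g"
  using almost_circular_DERIV by (auto intro!: DERIV_isCont continuous_at_imp_continuous_on)

lemma almost_circular_AC: "0 < a \<Longrightarrow> a < b \<Longrightarrow> abs_continuous_on_interval a b (deriv g)"
  using circ by (simp add: almost_circular_def)

lemma almost_circular_isCont_deriv:
  assumes s: "s > 0" shows "isCont (deriv g) s"
proof -
  have "continuous_on {s / 2..2 * s} (deriv g)"
    using s by (intro abs_continuous_on_interval_imp_continuous almost_circular_AC) auto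
  moreover have "s \<in> interior {s / 2..2 * s}" using s by simp
  ultimately show ?thesis by (rule continuous_on_interior)
qed

lemma almost_circular_norm: "g 1 = 0" "radial_flux g 1 = 2"
  using circ by (simp_all add: almost_circular_def radial_flux_def)

lemma DERIV_g_exp: "((\<lambda>t. g (exp t)) has_real_derivative radial_flux g (exp t)) (at t)"
  using DERIV_chain2[OF almost_circular_DERIV[OF exp_gt_zero] DERIV_exp, of t]
  by (simp add: radial_flux_def mult.commute)

lemma g_exp_above_tangent: "g (exp t) + radial_flux g (exp t) * (x - t) \<le> g (exp x)"
proof -
  have "subharmonic_on (- {0}) (\<lambda>z. real_of_ereal (W z))" using circ by (simp add: almost_circular_def)
  then have "convex_on UNIV (\<lambda>t. g (exp t))"
    by (rule radial_subharmonic_convex[OF _ _ almost_circular_continuous]) (simp add: almost_circular_W)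
  from convex_on_imp_above_tangent[OF this, of t x "radial_flux g (exp t)"] show ?thesis
    using DERIV_g_exp[of t] by simp
qed

lemma radial_flux_mono:
  assumes "0 < s" "s \<le> t" shows "radial_flux g s \<le> radial_flux g t"
proof (cases "s = t")
  case False
  define a where "a = ln s" define b where "b = ln t"
  have ab: "a < b" "exp a = s" "exp b = t" using assms False by (auto simp: a_def b_def)
  have "radial_flux g s * (b - a) + radial_flux g t * (a - b) \<le> 0"
    using g_exp_above_tangent[of a b, unfolded ab(2,3)] g_exp_above_tangent[of b a, unfolded ab(2,3)] by linarith
  moreover have "radial_flux g t * (a - b) = - (radial_flux g t * (b - a))"
    by (simp only: minus_mult_right minus_diff_eq)
  ultimately have "radial_flux g s * (b - a) \<le> radial_flux g t * (b - a)" by linarith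
  then show ?thesis by (rule mult_right_le_imp_le) (use ab(1) in simp)
qed simp

lemma log_profile_DERIV:
  assumes "N > 0"
  shows "(log_profile N g has_real_derivative 2 - radial_flux g (exp (- y / N))) (at y)"
proof -
  have "((\<lambda>y. - y / real N) has_real_derivative - 1 / N) (at y)"
    using assms by (auto intro!: derivative_eq_intros)
  from DERIV_chain2[OF DERIV_g_exp this]
  have "((\<lambda>y. g (exp (- y / N))) has_real_derivative radial_flux g (exp (- y / N)) * (- 1 / N)) (at y)" .
  from DERIV_add[OF DERIV_cmult[OF this, of "real N"] DERIV_cmult[OF DERIV_ident, of 2]]
  have "(log_profile N g has_real_derivative real N * (radial_flux g (exp (- y / N)) * (- 1 / N)) + 2 * 1) (at y)"
    unfolding log_profile_def[abs_def] .
  moreover have "real N * (X * (- 1 / N)) + 2 * 1 = 2 - X" for X using assms by simp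
  ultimately show ?thesis by (simp only:)
qed

lemma log_profile_convex:
  assumes "N > 0"
  shows "(\<forall>y. (log_profile N g has_real_derivative 2 - radial_flux g (exp (- y / N))) (at y)) \<and>
    mono (\<lambda>y. 2 - radial_flux g (exp (- y / N))) \<and> log_profile N g 0 = 0 \<and> 2 - radial_flux g (exp (- 0 / N)) = 0"
proof (intro conjI allI)
  show "mono (\<lambda>y. 2 - radial_flux g (exp (- y / N)))"
  proof (rule monoI)
    fix x y :: real assume "x \<le> y"
    then have "exp (- y / N) \<le> exp (- x / N)" by (simp add: divide_right_mono)
    then show "2 - radial_flux g (exp (- x / N)) \<le> 2 - radial_flux g (exp (- y / N))"
      using radial_flux_mono[of "exp (- y / N)"] by simp
  qed
qed (use almost_circular_norm log_profile_DERIV[OF assms] in \<open>simp_all add: log_profile_def\<close>)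

lemma boltzmann_weight_radial: "z \<noteq> 0 \<Longrightarrow> boltzmann_weight N W z = exp (- (real N * g (cmod z)))"
  by (simp add: boltzmann_weight_def almost_circular_W)

lemma monomial_weight_log_profile:
  assumes N: "N > 0" and z: "z \<noteq> 0" and y: "y = - (real N * ln (cmod z))"
  shows "cmod z ^ (2 * j) * boltzmann_weight N W z =
    exp (2 * y / N) * exp (- log_profile N g y + 2 * (1 - (real j + 1) / N) * y)"
proof -
  have z': "cmod z = exp (- y / N)" using N z by (simp add: y)
  have "cmod z ^ (2 * j) = exp (real (2 * j) * (- y / N))" unfolding z' by (simp only: exp_of_nat_mult)
  then have "cmod z ^ (2 * j) * boltzmann_weight N W z = exp (real (2 * j) * (- y / N) + (- (real N * g (exp (- y / N)))))"
    unfolding boltzmann_weight_radial[OF z] z' exp_add by (simp only:)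
  also have "real (2 * j) * (- y / N) + (- (real N * g (exp (- y / N)))) =
      2 * y / N + (- log_profile N g y + 2 * (1 - (real j + 1) / N) * y)"
    unfolding log_profile_def using tilt_exponent[of y N j "real N * g (exp (- y / N))"] by simp
  finally show ?thesis by (simp only: exp_add)
qed

text \<open>The Jacobian \<open>exp (- 2 y / N)\<close> of the coordinate \<open>y = - N ln |z|\<close> is what turns the exponent \<open>j\<close>
  into \<open>j + 1\<close>.\<close>

lemma
  assumes N: "N > 0" and int: "integrable lborel (\<lambda>y. exp (- log_profile N g y + 2 * (1 - (real j + 1) / N) * y))"
  shows integrable_monomial_weight: "integrable area (\<lambda>z. cmod z ^ (2 * j) * boltzmann_weight N W z)"
    and integral_monomial_weight: "(\<integral>z. cmod z ^ (2 * j) * boltzmann_weight N W z \<partial>area) =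
      2 / N * (\<integral>y. exp (- log_profile N g y + 2 * (1 - (real j + 1) / N) * y) \<partial>lborel)"
proof -
  define F where "F u = exp (- (2 * real j * u)) * exp (- (real N * g (exp (- u))))" for u
  let ?G = "\<lambda>y. exp (- log_profile N g y + 2 * (1 - (real j + 1) / N) * y)"
  have contF: "continuous_on UNIV F" unfolding F_def
    by (intro continuous_intros continuous_on_compose2[OF almost_circular_continuous]) auto
  have Fm[measurable]: "F \<in> borel_measurable borel" using contF by (rule borel_measurable_continuous_onI)
  have Wm[measurable]: "boltzmann_weight N W \<in> borel_measurable borel"
    unfolding boltzmann_weight_def[abs_def] using almost_circular_W_measurable by measurable
  have "AE z in lborel. z \<noteq> (0::complex)" by (rule AE_lborel_singleton)
  then have "AE z in area. z \<noteq> 0" unfolding area_def by (subst AE_density) auto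
  then have ae: "AE z in area. F (- ln (cmod z)) = cmod z ^ (2 * j) * boltzmann_weight N W z"
  proof eventually_elim
    case (elim z)
    have "exp (- (2 * real j * - ln (cmod z))) = exp (real (2 * j) * ln (cmod z))"
      by (simp only: mult_minus_right minus_minus of_nat_mult of_nat_numeral)
    also have "\<dots> = exp (ln (cmod z)) ^ (2 * j)" by (rule exp_of_nat_mult)
    also have "exp (ln (cmod z)) = cmod z" using elim by (intro exp_ln) simp
    finally have "exp (- (2 * real j * - ln (cmod z))) = cmod z ^ (2 * j)" .
    moreover have "exp (- (- ln (cmod z))) = cmod z" using elim unfolding minus_minus by (intro exp_ln) simp
    ultimately show ?case unfolding F_def boltzmann_weight_radial[OF elim] by (simp only:)
  qed
  have FG: "2 * exp (- 2 * (0 + (1 / N) * y)) * F (0 + (1 / N) * y) = 2 * ?G y" for y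
  proof -
    have arg: "0 + (1 / real N) * y = y / N" by simp
    have "exp (- 2 * (0 + (1 / N) * y)) * F (0 + (1 / N) * y) =
        exp (- 2 * (y / N) + (- (2 * real j * (y / N)) + - (real N * g (exp (- (y / N))))))"
      unfolding arg F_def exp_add ..
    also have "- 2 * (y / N) + (- (2 * real j * (y / N)) + - (real N * g (exp (- (y / N))))) =
        - log_profile N g y + 2 * (1 - (real j + 1) / N) * y"
      unfolding log_profile_def minus_divide_left[symmetric] by (rule tilt_exponent)
    finally show ?thesis by (simp only: mult.assoc)
  qed
  have N': "1 / real N \<noteq> 0" using N by simp
  have "integrable lborel (\<lambda>u. 2 * exp (- 2 * u) * F u)"
    unfolding lborel_integrable_real_affine_iff[OF N', of "\<lambda>u. 2 * exp (- 2 * u) * F u" 0, symmetric] FG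
    using int by simp
  then have "integrable (density lborel (\<lambda>u. ennreal (2 * exp (- 2 * u)))) F"
    by (subst integrable_density) auto
  then have iF: "integrable area (\<lambda>z. F (- ln (cmod z)))"
    unfolding distr_area_log_modulus[symmetric] by (subst (asm) integrable_distr_eq) auto
  then show "integrable area (\<lambda>z. cmod z ^ (2 * j) * boltzmann_weight N W z)"
    by (subst integrable_cong_AE[OF _ _ ae, symmetric]) auto
  have "(\<integral>z. cmod z ^ (2 * j) * boltzmann_weight N W z \<partial>area) = (\<integral>z. F (- ln (cmod z)) \<partial>area)"
    by (subst integral_cong_AE[OF _ _ ae]) auto
  also have "\<dots> = (\<integral>u. F u \<partial>distr area borel (\<lambda>z. - ln (cmod z)))"
    by (subst integral_distr) auto
  also have "\<dots> = (\<integral>u. 2 * exp (- 2 * u) * F u \<partial>lborel)"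
    unfolding distr_area_log_modulus by (subst integral_density) auto
  also have "\<dots> = \<bar>1 / N\<bar> * (\<integral>y. 2 * exp (- 2 * (0 + (1 / N) * y)) * F (0 + (1 / N) * y) \<partial>lborel)"
    using lborel_integral_real_affine[OF N', of "\<lambda>u. 2 * exp (- 2 * u) * F u" 0] by simp
  also have "\<dots> = 2 / N * (\<integral>y. ?G y \<partial>lborel)" unfolding FG by simp
  finally show "(\<integral>z. cmod z ^ (2 * j) * boltzmann_weight N W z \<partial>area) = 2 / N * (\<integral>y. ?G y \<partial>lborel)" .
qed

lemma boltzmann_weight_tendsto:
  assumes "z0 \<noteq> 0" shows "(boltzmann_weight N W \<longlongrightarrow> boltzmann_weight N W z0) (at z0)"
proof -
  have "isCont g (cmod z0)" using almost_circular_DERIV[of "cmod z0"] assms by (auto intro: DERIV_isCont)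
  have "isCont cmod z0" by (intro continuous_intros)
  then have "isCont (\<lambda>z. g (cmod z)) z0" by (rule isCont_o2) fact
  then have "isCont (\<lambda>z. exp (- (real N * g (cmod z)))) z0" by (intro continuous_intros)
  then have "((\<lambda>z. exp (- (real N * g (cmod z)))) \<longlongrightarrow> boltzmann_weight N W z0) (at z0)"
    unfolding isCont_def boltzmann_weight_radial[OF assms] .
  moreover have "\<forall>\<^sub>F z in at z0. exp (- (real N * g (cmod z))) = boltzmann_weight N W z"
  proof -
    have "\<forall>\<^sub>F z in at z0. z \<noteq> 0"
      using eventually_at_in_open'[of "- {0}" z0] assms by auto
    then show ?thesis by eventually_elim (simp add: boltzmann_weight_radial)
  qed
  ultimately show ?thesis by (rule Lim_transform_eventually)
qed

text \<open>For radii at most \<open>r / 2\<close> the flux is negative and bounded away from zero, so by convexity \<open>g (exp t)\<close>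
  tends to infinity at least linearly as \<open>t\<close> tends to minus infinity. Thus the weight extends
  continuously by zero to the origin, whatever the value of the potential there.\<close>

lemma boltzmann_weight_tendsto_0:
  assumes N: "N > 0" shows "(boltzmann_weight N W \<longlongrightarrow> 0) (at 0)"
proof -
  have r: "r > 0" and flux: "\<And>s. s > 0 \<Longrightarrow> radial_flux g s = 0 \<longleftrightarrow> s = r"
    using circ by (simp_all add: almost_circular_def radial_flux_def)
  define t where "t = ln (r / 2)"
  have t: "exp t = r / 2" using r by (simp add: t_def)
  define m where "m = - radial_flux g (r / 2)"
  have m: "m > 0"
  proof -
    have "radial_flux g (r / 2) \<le> radial_flux g r" using r by (intro radial_flux_mono) auto
    moreover have "radial_flux g r = 0" "radial_flux g (r / 2) \<noteq> 0" using flux[of r] flux[of "r / 2"] r by simp_all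
    ultimately show ?thesis unfolding m_def by linarith
  qed
  have gt: "g (r / 2) - m * (x - t) \<le> g (exp x)" for x using g_exp_above_tangent[of t x] unfolding t m_def by simp
  have "filterlim (\<lambda>z. ln (cmod z)) at_bot (at (0::complex))"
  proof (rule filterlim_compose[OF ln_at_0])
    have "(cmod \<longlongrightarrow> 0) (at (0::complex))" using tendsto_norm[OF tendsto_ident_at[of "0::complex" UNIV]] by simp
    moreover have "\<forall>\<^sub>F z in at (0::complex). cmod z \<in> {0<..} \<and> cmod z \<noteq> 0" by (simp add: eventually_at_filter)
    ultimately show "filterlim cmod (at_right 0) (at (0::complex))" unfolding filterlim_at by blast
  qed
  moreover have "((\<lambda>x. exp (- (real N * (g (r / 2) - m * (x - t))))) \<longlongrightarrow> 0) at_bot"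
  proof -
    have *: "((\<lambda>x. exp (a * x + b)) \<longlongrightarrow> 0) at_bot" if "a > 0" for a b :: real using that by real_asymp
    have "- (real N * (g (r / 2) - m * (x - t))) = (real N * m) * x + (- (real N * g (r / 2)) - real N * m * t)" for x
      by (simp add: algebra_simps)
    then show ?thesis using *[of "real N * m" "- (real N * g (r / 2)) - real N * m * t"] N m by (simp only:) simp
  qed
  ultimately have "((\<lambda>z::complex. exp (- (real N * (g (r / 2) - m * (ln (cmod z) - t))))) \<longlongrightarrow> 0) (at 0)"
    by (rule filterlim_compose[rotated])
  then show ?thesis
  proof (rule Lim_null_comparison[rotated])
    have "\<forall>\<^sub>F z in at (0::complex). z \<noteq> 0" by (simp add: eventually_at_filter)
    then show "\<forall>\<^sub>F z in at 0. norm (boltzmann_weight N W z) \<le> exp (- (real N * (g (r / 2) - m * (ln (cmod z) - t))))"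
    proof eventually_elim
      case (elim z)
      have "g (r / 2) - m * (ln (cmod z) - t) \<le> g (cmod z)" using gt[of "ln (cmod z)"] elim by simp
      then have "real N * (g (r / 2) - m * (ln (cmod z) - t)) \<le> real N * g (cmod z)" by (rule mult_left_mono) simp
      then show ?case using boltzmann_weight_radial[OF elim, of N] by simp
    qed
  qed
qed

end

section \<open>The limit of the one-point function\<close>

locale almost_circular_sequence =
  fixes Q :: "nat \<Rightarrow> complex \<Rightarrow> ereal" and g :: "nat \<Rightarrow> real \<Rightarrow> real"
    and r :: "nat \<Rightarrow> real" and k \<rho> :: real
  assumes circ: "\<And>N. N \<ge> 1 \<Longrightarrow> almost_circular k (Q N) (g N) (r N)"
    and rho_lim: "(\<lambda>N. sqrt (real N / laplacian (Q N) 1)) \<longlonglongrightarrow> \<rho>" and rho_pos: "\<rho> > 0"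
    and radius: "(\<lambda>N. r N - (1 - \<rho>\<^sup>2 / (2 * real N))) \<in> o(\<lambda>N. 1 / real N)"
    and regular: "\<And>C \<epsilon>. C > 0 \<Longrightarrow> \<epsilon> > 0 \<Longrightarrow>
           \<forall>\<^sub>F N in sequentially. AE s in lborel. \<bar>s - 1\<bar> \<le> C / real N \<longrightarrow>
             \<bar>laplacian (Q N) (of_real s) / laplacian (Q N) 1 - 1\<bar> \<le> \<epsilon>"
begin

abbreviation L :: "nat \<Rightarrow> real" where "L N \<equiv> laplacian (Q N) 1"

lemma eventually_laplacian_one_pos: "\<forall>\<^sub>F N in sequentially. N \<ge> 1 \<and> L N > 0"
proof -
  have "\<forall>\<^sub>F N in sequentially. sqrt (real N / L N) > 0" using rho_lim rho_pos by (rule order_tendstoD)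
  then show ?thesis using eventually_ge_at_top[of 1]
    by eventually_elim (auto simp: zero_less_divide_iff)
qed

lemma N_over_L_tendsto: "(\<lambda>N. real N / L N) \<longlonglongrightarrow> \<rho>\<^sup>2"
proof -
  have "(\<lambda>N. (sqrt (real N / L N))\<^sup>2) \<longlonglongrightarrow> \<rho>\<^sup>2" by (intro tendsto_intros rho_lim)
  moreover have "\<forall>\<^sub>F N in sequentially. (sqrt (real N / L N))\<^sup>2 = real N / L N"
    using eventually_laplacian_one_pos by eventually_elim (intro real_sqrt_pow2, simp)
  ultimately show ?thesis by (rule Lim_transform_eventually)
qed

lemma L_over_N_tendsto: "(\<lambda>N. L N / real N) \<longlonglongrightarrow> 1 / \<rho>\<^sup>2"
proof -
  have "(\<lambda>N. 1 / (real N / L N)) \<longlonglongrightarrow> 1 / \<rho>\<^sup>2"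
    using rho_pos by (intro tendsto_intros N_over_L_tendsto) auto
  then show ?thesis by simp
qed

lemma L_over_N_le: "\<forall>\<^sub>F N in sequentially. L N / real N \<le> 2 / \<rho>\<^sup>2"
proof -
  have "1 / \<rho>\<^sup>2 < 2 / \<rho>\<^sup>2" using rho_pos by (simp add: divide_strict_right_mono)
  with L_over_N_tendsto have "\<forall>\<^sub>F N in sequentially. L N / real N < 2 / \<rho>\<^sup>2" by (rule order_tendstoD)
  then show ?thesis by eventually_elim simp
qed

lemma L_at_top: "filterlim L at_top sequentially"
proof -
  have "filterlim (\<lambda>N. L N / real N * real N) at_top sequentially"
    by (rule filterlim_tendsto_pos_mult_at_top[OF L_over_N_tendsto _ filterlim_real_sequentially]) (use rho_pos in simp)
  moreover have "\<forall>\<^sub>F N in sequentially. L N / real N * real N = L N"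
    using eventually_gt_at_top[of 0] by eventually_elim simp
  ultimately show ?thesis by (rule filterlim_cong[OF refl refl, THEN iffD1, rotated])
qed

text \<open>The bounds on the Laplacian near the unit circle in integrated form. Since \<open>L N\<close> grows like
  \<open>N / \<rho>\<^sup>2\<close>, the flux varies by a bounded amount on intervals of length of order \<open>1 / N\<close>.\<close>

lemma flux_slopes:
  assumes C: "C > 0" and \<epsilon>: "0 < \<epsilon>" "\<epsilon> \<le> 1 / 2"
  shows "\<forall>\<^sub>F N in sequentially. \<forall>u v. 1 - C / N \<le> u \<and> u \<le> v \<and> v \<le> 1 + C / N \<longrightarrow>
      4 * L N * (1 - \<epsilon>) * (v - u) \<le> radial_flux (g N) v - radial_flux (g N) u \<and>
      radial_flux (g N) v - radial_flux (g N) u \<le> 4 * L N * (1 + \<epsilon>) * (v - u)"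
proof -
  \<comment> \<open>bounds \<open>2 + 4 L (1 + \<epsilon> / 3) (1 + \<eta>) \<eta>\<close>, where \<open>L \<eta> \<le> 2 C / \<rho>\<^sup>2\<close> and both brackets are at most \<open>3 / 2\<close>\<close>
  define M where "M = 3 + 18 * C / \<rho>\<^sup>2"
  have \<epsilon>3: "\<epsilon> / 3 > 0" using \<epsilon> by simp
  have "(\<lambda>N. C / real N) \<longlonglongrightarrow> 0" by real_asymp
  then have CN: "\<forall>\<^sub>F N in sequentially. C / real N < \<epsilon> / 3" using \<epsilon>3 by (rule order_tendstoD)
  have large: "\<forall>\<^sub>F N in sequentially. L N > ((SOME D. False) + 4 * M) / 2"
    using L_at_top by (simp only: filterlim_at_top_dense)
  show ?thesis
    using eventually_laplacian_one_pos L_over_N_le CN large regular[OF C \<epsilon>3]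
  proof eventually_elim
    case (elim N)
    note circN = circ[of N]
    define \<eta> where "\<eta> = C / real N"
    have N: "N \<ge> 1" "L N > 0" using elim(1) by auto
    have \<eta>: "0 < \<eta>" "\<eta> < \<epsilon> / 3" "\<eta> \<le> 1 / 2"
    proof -
      show "0 < \<eta>" using C N by (simp add: \<eta>_def)
      show "\<eta> < \<epsilon> / 3" unfolding \<eta>_def by (rule elim(3))
      then show "\<eta> \<le> 1 / 2" using \<epsilon> by linarith
    qed
    have ac: "\<And>a b. 0 < a \<Longrightarrow> a < b \<Longrightarrow> abs_continuous_on_interval a b (deriv (g N))"
      using almost_circular_AC[OF circN] N by auto
    have mono: "\<And>s t. 0 < s \<Longrightarrow> s \<le> t \<Longrightarrow> s * deriv (g N) s \<le> t * deriv (g N) t"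
      using radial_flux_mono[OF circN] N by (auto simp: radial_flux_def)
    have one: "1 * deriv (g N) 1 = 2" using almost_circular_norm(2)[OF circN] N by (simp add: radial_flux_def)
    have ae: "AE s in lborel. \<bar>s - 1\<bar> \<le> \<eta> \<longrightarrow> \<bar>(deriv (deriv (g N)) s + deriv (g N) s / s) / 4 / L N - 1\<bar> \<le> \<epsilon> / 3"
      using elim(5)
    proof eventually_elim
      case (elim s)
      show ?case
      proof
        assume s: "\<bar>s - 1\<bar> \<le> \<eta>"
        then have "s > 0" using \<eta> by linarith
        have "laplacian (Q N) (of_real s) = (deriv (deriv (g N)) s + deriv (g N) s / s) / 4"
        proof (rule laplacian_radial_of_real[OF _ _ \<open>s > 0\<close>])
          show "isCont (deriv (g N)) s" using almost_circular_isCont_deriv[OF circN \<open>s > 0\<close>] N by simp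
        qed (use almost_circular_W[OF circN] almost_circular_differentiable[OF circN] N in auto)
        moreover have "\<bar>laplacian (Q N) (of_real s) / L N - 1\<bar> \<le> \<epsilon> / 3"
          by (rule elim[rule_format]) (use s in \<open>simp add: \<eta>_def\<close>)
        ultimately show "\<bar>(deriv (deriv (g N)) s + deriv (g N) s / s) / 4 / L N - 1\<bar> \<le> \<epsilon> / 3"
          by (simp only:)
      qed
    qed
    have M: "2 + 4 * L N * (1 + \<epsilon> / 3) * (1 + \<eta>) * \<eta> < M"
    proof -
      have "4 * L N * (1 + \<epsilon> / 3) * (1 + \<eta>) * \<eta> = 4 * (L N * \<eta>) * ((1 + \<epsilon> / 3) * (1 + \<eta>))" by simp
      also have "\<dots> \<le> 4 * (L N * \<eta>) * ((3 / 2) * (3 / 2))"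
        using N \<eta> \<epsilon> by (intro mult_left_mono mult_mono) auto
      also have "\<dots> = 9 * C * (L N / N)" by (simp add: \<eta>_def)
      also have "\<dots> \<le> 9 * C * (2 / \<rho>\<^sup>2)" using elim(2) C by (intro mult_left_mono) auto
      finally show ?thesis by (simp add: M_def)
    qed
    have lg: "(SOME D. False) + 4 * M < 2 * L N" using elim(4) by simp
    show ?case
    proof (intro allI impI)
      fix u v :: real assume uv: "1 - C / N \<le> u \<and> u \<le> v \<and> v \<le> 1 + C / N"
      then have uv': "1 - \<eta> \<le> u" "u \<le> v" "v \<le> 1 + \<eta>" by (auto simp: \<eta>_def)
      have \<epsilon>3': "\<epsilon> / 3 \<le> 1 / 2" using \<epsilon> by simp
      have b: "4 * L N * (1 - \<epsilon> / 3) * (1 - \<eta>) * (v - u) \<le> radial_flux (g N) v - radial_flux (g N) u"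
        "radial_flux (g N) v - radial_flux (g N) u \<le> 4 * L N * (1 + \<epsilon> / 3) * (1 + \<eta>) * (v - u)"
        unfolding radial_flux_def
        by (rule radial_slope_bounds[OF _ _ one N(2) \<eta>(1,3) \<epsilon>3 \<epsilon>3' ae M lg uv']; (rule ac mono; assumption))+
      have lo: "1 - \<epsilon> \<le> (1 - \<epsilon> / 3) * (1 - \<eta>)"
      proof -
        have "(1 - \<epsilon> / 3) * (1 - \<eta>) = 1 - \<epsilon> / 3 - \<eta> + \<epsilon> / 3 * \<eta>"
          unfolding left_diff_distrib right_diff_distrib mult_1 by simp
        moreover have "0 \<le> \<epsilon> / 3 * \<eta>" using \<epsilon> \<eta> by simp
        ultimately show ?thesis using \<eta> \<epsilon> by linarith
      qed
      have hi: "(1 + \<epsilon> / 3) * (1 + \<eta>) \<le> 1 + \<epsilon>"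
      proof -
        have "(1 + \<epsilon> / 3) * (1 + \<eta>) = 1 + \<epsilon> / 3 + \<eta> + \<epsilon> / 3 * \<eta>"
          unfolding distrib_left distrib_right mult_1 by simp
        moreover have "\<epsilon> / 3 * \<eta> \<le> \<epsilon> / 3 * 1" using \<epsilon> \<eta> by (intro mult_left_mono) auto
        moreover have "\<epsilon> / 3 * \<eta> \<le> 1 / 6 * \<eta>" using \<epsilon> \<eta> by (intro mult_right_mono) auto
        ultimately show ?thesis using \<eta> \<epsilon> by linarith
      qed
      have "4 * L N * (1 - \<epsilon>) * (v - u) \<le> 4 * L N * ((1 - \<epsilon> / 3) * (1 - \<eta>)) * (v - u)"
        using lo N uv' by (intro mult_right_mono mult_left_mono) auto
      moreover have "4 * L N * ((1 + \<epsilon> / 3) * (1 + \<eta>)) * (v - u) \<le> 4 * L N * (1 + \<epsilon>) * (v - u)"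
        using hi N uv' by (intro mult_right_mono mult_left_mono) auto
      ultimately show "4 * L N * (1 - \<epsilon>) * (v - u) \<le> radial_flux (g N) v - radial_flux (g N) u \<and>
          radial_flux (g N) v - radial_flux (g N) u \<le> 4 * L N * (1 + \<epsilon>) * (v - u)"
        using b unfolding mult.assoc by linarith
    qed
  qed
qed

text \<open>Near the unit circle \<open>\<phi>(1) - \<phi>(s)\<close> is close to \<open>4 L (1 - s)\<close>, and \<open>1 - exp (- y / N)\<close> is close to
  \<open>y / N\<close>; the quotient \<open>L / N\<close> tends to \<open>1 / \<rho>\<^sup>2\<close>. The three errors are collected in \<open>B N\<close>.\<close>

sublocale quad: convex_quadratic_limit "\<lambda>N. log_profile N (g N)" "\<lambda>N y. 2 - radial_flux (g N) (exp (- y / N))" "4 / \<rho>\<^sup>2"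
proof
  show "4 / \<rho>\<^sup>2 > 0" using rho_pos by simp
  show "\<forall>\<^sub>F N in sequentially. (\<forall>y. (log_profile N (g N) has_real_derivative 2 - radial_flux (g N) (exp (- y / real N))) (at y)) \<and>
      mono (\<lambda>y. 2 - radial_flux (g N) (exp (- y / real N))) \<and> log_profile N (g N) 0 = 0 \<and> 2 - radial_flux (g N) (exp (- 0 / real N)) = 0"
    using eventually_ge_at_top[of 1] by eventually_elim (rule log_profile_convex[OF circ], auto)
next
  fix Y0 e :: real assume e: "e > 0"
  define Y where "Y = \<bar>Y0\<bar> + 1"
  have Y: "Y > 0" by (simp add: Y_def add_nonneg_pos)
  \<comment> \<open>chosen so that the first error in \<open>B N\<close> is at most \<open>e / 2\<close>\<close>
  define \<epsilon> where "\<epsilon> = min (1 / 2) (e * \<rho>\<^sup>2 / (32 * Y))"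
  have \<epsilon>: "0 < \<epsilon>" "\<epsilon> \<le> 1 / 2" using e Y rho_pos by (auto simp: \<epsilon>_def)
  have "\<epsilon> \<le> e * \<rho>\<^sup>2 / (32 * Y)" by (simp add: \<epsilon>_def)
  then have \<epsilon>e: "16 * Y * \<epsilon> / \<rho>\<^sup>2 \<le> e / 2" using Y rho_pos by (simp add: field_simps)
  define B where "B N = 16 * Y * \<epsilon> / \<rho>\<^sup>2 + 16 * Y\<^sup>2 / \<rho>\<^sup>2 * (1 / real N) + \<bar>4 * (L N / N) - 4 * (1 / \<rho>\<^sup>2)\<bar> * Y" for N
  have "(\<lambda>N. 1 / real N) \<longlonglongrightarrow> 0" by real_asymp
  then have "B \<longlonglongrightarrow> 16 * Y * \<epsilon> / \<rho>\<^sup>2 + 16 * Y\<^sup>2 / \<rho>\<^sup>2 * 0 + \<bar>4 * (1 / \<rho>\<^sup>2) - 4 * (1 / \<rho>\<^sup>2)\<bar> * Y"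
    unfolding B_def by (intro tendsto_intros L_over_N_tendsto)
  then have "B \<longlonglongrightarrow> 16 * Y * \<epsilon> / \<rho>\<^sup>2" by simp
  moreover have "16 * Y * \<epsilon> / \<rho>\<^sup>2 < e" using \<epsilon>e e by linarith
  ultimately have Be: "\<forall>\<^sub>F N in sequentially. B N < e" by (rule order_tendstoD)
  have C: "2 * Y > 0" using Y by simp
  have NY: "\<forall>\<^sub>F N in sequentially. real N \<ge> 2 * Y" by (rule eventually_sequentiallyI[of "nat \<lceil>2 * Y\<rceil>"]) linarith
  show "\<forall>\<^sub>F N in sequentially. \<forall>y\<in>{- Y0..Y0}. \<bar>2 - radial_flux (g N) (exp (- y / real N)) - 4 / \<rho>\<^sup>2 * y\<bar> \<le> e"
    using eventually_laplacian_one_pos L_over_N_le Be NY flux_slopes[OF C \<epsilon>]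
  proof eventually_elim
    case (elim N)
    have N: "N \<ge> 1" "L N > 0" "real N > 0" using elim(1) by auto
    show ?case
    proof
      fix y assume "y \<in> {- Y0..Y0}"
      then have y: "\<bar>y\<bar> \<le> Y" by (auto simp: Y_def)
      define x where "x = - y / real N"
      define s where "s = exp x"
      have absx: "\<bar>x\<bar> = \<bar>y\<bar> / N" using N by (simp add: x_def)
      have x: "\<bar>x\<bar> \<le> 1 / 2" unfolding absx using y elim(4) N by (simp add: pos_divide_le_eq)
      have sx: "\<bar>s - 1 - x\<bar> \<le> 2 * x\<^sup>2" unfolding s_def by (rule abs_exp_minus_one_minus_le[OF x])
      have "2 * x\<^sup>2 = 2 * \<bar>x\<bar> * \<bar>x\<bar>" by (simp add: power2_eq_square)
      also have "\<dots> \<le> 1 * \<bar>x\<bar>" using x by (intro mult_right_mono) auto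
      finally have "\<bar>s - 1\<bar> \<le> 2 * \<bar>x\<bar>" using sx by linarith
      also have "\<dots> \<le> 2 * Y / N" unfolding absx using y N by (simp add: divide_right_mono)
      finally have s1: "\<bar>s - 1\<bar> \<le> 2 * Y / N" .
      define D where "D = radial_flux (g N) 1 - radial_flux (g N) s"
      have D1: "\<bar>D - 4 * L N * (1 - s)\<bar> \<le> 4 * L N * \<epsilon> * \<bar>s - 1\<bar>"
      proof (cases "s \<le> 1")
        case True
        have "4 * L N * (1 - \<epsilon>) * (1 - s) \<le> D \<and> D \<le> 4 * L N * (1 + \<epsilon>) * (1 - s)"
          unfolding D_def by (rule elim(5)[rule_format]) (use s1 True C N in auto)
        moreover have "\<bar>s - 1\<bar> = 1 - s" using True by simp
        ultimately show ?thesis unfolding abs_le_iff by (simp add: algebra_simps)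
      next
        case False
        have "4 * L N * (1 - \<epsilon>) * (s - 1) \<le> - D \<and> - D \<le> 4 * L N * (1 + \<epsilon>) * (s - 1)"
          unfolding D_def minus_diff_eq by (rule elim(5)[rule_format]) (use s1 False C N in auto)
        moreover have "\<bar>s - 1\<bar> = s - 1" using False by simp
        ultimately show ?thesis unfolding abs_le_iff by (simp add: algebra_simps)
      qed
      have "4 * L N * \<epsilon> * \<bar>s - 1\<bar> \<le> 4 * L N * \<epsilon> * (2 * Y / N)" using N \<epsilon> s1 by (intro mult_left_mono) auto
      also have "\<dots> = 8 * Y * \<epsilon> * (L N / N)" by simp
      also have "\<dots> \<le> 8 * Y * \<epsilon> * (2 / \<rho>\<^sup>2)" using elim(2) Y \<epsilon> by (intro mult_left_mono) auto
      finally have b1: "\<bar>D - 4 * L N * (1 - s)\<bar> \<le> 16 * Y * \<epsilon> / \<rho>\<^sup>2" using D1 by simp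
      have "4 * L N * (1 - s) - 4 * (L N / N) * y = - (4 * L N * (s - 1 - x))"
        using N by (simp add: x_def algebra_simps)
      then have "\<bar>4 * L N * (1 - s) - 4 * (L N / N) * y\<bar> = 4 * L N * \<bar>s - 1 - x\<bar>" using N by (simp add: abs_mult)
      also have "\<dots> \<le> 4 * L N * (2 * x\<^sup>2)" using sx N by (intro mult_left_mono) auto
      also have "\<dots> = 8 * (L N / N) * (y\<^sup>2 / N)" using N by (simp add: x_def power2_eq_square)
      also have "\<dots> \<le> 8 * (2 / \<rho>\<^sup>2) * (Y\<^sup>2 / N)"
      proof (intro mult_mono)
        have "y\<^sup>2 \<le> Y\<^sup>2" using y by (metis abs_le_square_iff abs_of_pos Y)
        then show "y\<^sup>2 / N \<le> Y\<^sup>2 / N" by (rule divide_right_mono) simp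
      qed (use elim(2) N in auto)
      finally have b2: "\<bar>4 * L N * (1 - s) - 4 * (L N / N) * y\<bar> \<le> 16 * Y\<^sup>2 / \<rho>\<^sup>2 * (1 / real N)" by simp
      have "4 * (L N / N) * y - 4 / \<rho>\<^sup>2 * y = (4 * (L N / N) - 4 * (1 / \<rho>\<^sup>2)) * y" by (simp add: left_diff_distrib)
      then have "\<bar>4 * (L N / N) * y - 4 / \<rho>\<^sup>2 * y\<bar> = \<bar>4 * (L N / N) - 4 * (1 / \<rho>\<^sup>2)\<bar> * \<bar>y\<bar>" by (simp only: abs_mult)
      also have "\<dots> \<le> \<bar>4 * (L N / N) - 4 * (1 / \<rho>\<^sup>2)\<bar> * Y" using y by (intro mult_left_mono) auto
      finally have b3: "\<bar>4 * (L N / N) * y - 4 / \<rho>\<^sup>2 * y\<bar> \<le> \<bar>4 * (L N / N) - 4 * (1 / \<rho>\<^sup>2)\<bar> * Y" .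
      have "2 - radial_flux (g N) (exp (- y / real N)) = D"
        using almost_circular_norm(2)[OF circ[OF N(1)]] by (simp add: D_def s_def x_def)
      moreover have "\<bar>D - 4 / \<rho>\<^sup>2 * y\<bar> \<le> B N" unfolding B_def using b1 b2 b3 by linarith
      ultimately show "\<bar>2 - radial_flux (g N) (exp (- y / real N)) - 4 / \<rho>\<^sup>2 * y\<bar> \<le> e" using elim(3) by simp
    qed
  qed
qed

abbreviation m :: "nat \<Rightarrow> real" where "m N \<equiv> (r N + 1) / 2"

lemma middle_tendsto: "(\<lambda>N. real N * (m N - 1)) \<longlonglongrightarrow> - \<rho>\<^sup>2 / 4"
proof -
  have "(\<lambda>N. (r N - (1 - \<rho>\<^sup>2 / (2 * real N))) / (1 / real N)) \<longlonglongrightarrow> 0" using radius by (rule smalloD_tendsto)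
  then have "(\<lambda>N. (r N - (1 - \<rho>\<^sup>2 / (2 * real N))) / (1 / real N) / 2 - \<rho>\<^sup>2 / 4) \<longlonglongrightarrow> 0 / 2 - \<rho>\<^sup>2 / 4"
    by (intro tendsto_intros) auto
  moreover have "\<forall>\<^sub>F N in sequentially. (r N - (1 - \<rho>\<^sup>2 / (2 * real N))) / (1 / real N) / 2 - \<rho>\<^sup>2 / 4 = real N * (m N - 1)"
    using eventually_gt_at_top[of 0] by eventually_elim (simp add: field_simps)
  ultimately show ?thesis using Lim_transform_eventually by fastforce
qed

lemma middle_tendsto_1: "m \<longlonglongrightarrow> 1"
proof -
  have "(\<lambda>N. 1 / real N) \<longlonglongrightarrow> 0" by real_asymp
  from tendsto_add[OF tendsto_mult[OF middle_tendsto this] tendsto_const[of 1]]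
  have "(\<lambda>N. real N * (m N - 1) * (1 / real N) + 1) \<longlonglongrightarrow> 1" by simp
  moreover have "\<forall>\<^sub>F N in sequentially. real N * (m N - 1) * (1 / real N) + 1 = m N"
    using eventually_gt_at_top[of 0]
  proof eventually_elim
    case (elim N)
    have "real N * X * (1 / real N) = X" for X using elim by simp
    from this[of "m N - 1"] show ?case by linarith
  qed
  ultimately show ?thesis by (rule Lim_transform_eventually)
qed

text \<open>The hypothesis on the Laplacian concerns almost every radius only, but at the middle radius the flux is
  differentiable, and its derivative inherits the bounds on difference quotients.\<close>

lemma laplacian_middle_tendsto: "(\<lambda>N. laplacian (Q N) (middle_point (r N) \<theta>) / L N) \<longlonglongrightarrow> 1"
proof -
  have m0: "\<forall>\<^sub>F N in sequentially. m N > 0" using middle_tendsto_1 by (rule order_tendstoD) simp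
  have "(\<lambda>N. m N * (laplacian (Q N) (middle_point (r N) \<theta>) / L N)) \<longlonglongrightarrow> 1"
  proof (rule tendstoI)
    fix e0 :: real assume e0: "e0 > 0"
    define e where "e = min (1 / 2) (e0 / 2)"
    have e: "0 < e" "e \<le> 1 / 2" "e < e0" using e0 by (auto simp: e_def min_def)
    define C where "C = \<rho>\<^sup>2 / 4 + 1"
    have C: "C > 0" using rho_pos by (simp add: C_def add_pos_pos)
    have lo: "\<forall>\<^sub>F N in sequentially. real N * (m N - 1) > - C"
      using middle_tendsto by (rule order_tendstoD) (simp add: C_def)
    have hi: "\<forall>\<^sub>F N in sequentially. real N * (m N - 1) < C"
      using middle_tendsto by (rule order_tendstoD) (use rho_pos in \<open>simp add: C_def add_pos_pos\<close>)
    show "\<forall>\<^sub>F N in sequentially. dist (m N * (laplacian (Q N) (middle_point (r N) \<theta>) / L N)) 1 < e0"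
      using eventually_laplacian_one_pos m0 lo hi flux_slopes[OF C e(1,2)]
    proof eventually_elim
      case (elim N)
      have N: "N \<ge> 1" "L N > 0" "real N > 0" using elim(1) by auto
      have mI: "1 - C / N < m N" "m N < 1 + C / N"
      proof -
        have "- C / N < m N - 1" using elim(3) N by (simp only: pos_divide_less_eq mult.commute[of _ "real N"])
        moreover have "m N - 1 < C / N" using elim(4) N by (simp only: pos_less_divide_eq mult.commute[of _ "real N"])
        ultimately show "1 - C / N < m N" "m N < 1 + C / N" by auto
      qed
      define z where "z = middle_point (r N) \<theta>"
      have z: "cmod z = m N" using elim(2) by (simp add: z_def middle_point_def norm_mult del: of_real_add of_real_divide)
      have "deriv (g N) differentiable (at (m N))" using circ[OF N(1)] by (simp add: almost_circular_def)
      then obtain h' where h': "(deriv (g N) has_real_derivative h') (at (m N))" by (auto simp: real_differentiable_def)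
      have lap: "laplacian (Q N) z = (h' + deriv (g N) (m N) / m N) / 4"
        unfolding z[symmetric]
      proof (rule laplacian_radial)
        show "z \<noteq> 0" using z elim(2) by auto
        show "(deriv (g N) has_real_derivative h') (at (cmod z))" unfolding z by (rule h')
      qed (use almost_circular_W[OF circ[OF N(1)]] almost_circular_differentiable[OF circ[OF N(1)]] in auto)
      from DERIV_mult[OF DERIV_ident h']
      have "(radial_flux (g N) has_real_derivative 1 * deriv (g N) (m N) + h' * m N) (at (m N))"
        unfolding radial_flux_def[abs_def] .
      moreover have "1 * deriv (g N) (m N) + h' * m N = 4 * (m N * laplacian (Q N) z)"
        unfolding lap using elim(2) by (simp add: distrib_left mult.commute)
      ultimately have D: "(radial_flux (g N) has_real_derivative 4 * (m N * laplacian (Q N) z)) (at (m N))" by (simp only:)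
      have sl: "4 * L N * (1 - e) * (y - m N) \<le> radial_flux (g N) y - radial_flux (g N) (m N) \<and>
          radial_flux (g N) y - radial_flux (g N) (m N) \<le> 4 * L N * (1 + e) * (y - m N)"
        if "m N < y" "y < m N + (1 + C / N - m N)" for y
        by (rule elim(5)[rule_format]) (use that mI in auto)
      have \<delta>: "1 + C / N - m N > 0" using mI by linarith
      have "4 * L N * (1 - e) \<le> 4 * (m N * laplacian (Q N) z)"
        by (rule DERIV_between_slopes(1)[OF D \<delta>]) (use sl in blast)+
      moreover have "4 * (m N * laplacian (Q N) z) \<le> 4 * L N * (1 + e)"
        by (rule DERIV_between_slopes(2)[OF D \<delta>]) (use sl in blast)+
      ultimately have "L N * (1 - e) \<le> m N * laplacian (Q N) z" "m N * laplacian (Q N) z \<le> L N * (1 + e)" by linarith+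
      then have "1 - e \<le> m N * laplacian (Q N) z / L N" "m N * laplacian (Q N) z / L N \<le> 1 + e"
        using N by (simp_all add: pos_le_divide_eq pos_divide_le_eq mult.commute)
      then show ?case unfolding z_def[symmetric] dist_real_def using e by (simp add: abs_less_iff)
    qed
  qed
  from tendsto_divide[OF this middle_tendsto_1]
  have "(\<lambda>N. m N * (laplacian (Q N) (middle_point (r N) \<theta>) / L N) / m N) \<longlonglongrightarrow> 1" by simp
  moreover have "\<forall>\<^sub>F N in sequentially. m N * (laplacian (Q N) (middle_point (r N) \<theta>) / L N) / m N = laplacian (Q N) (middle_point (r N) \<theta>) / L N"
    using m0 by eventually_elim simp
  ultimately show ?thesis by (rule Lim_transform_eventually)
qed


definition scaling :: "real \<Rightarrow> nat \<Rightarrow> real" where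
  "scaling \<theta> N = sqrt (real N * laplacian (Q N) (middle_point (r N) \<theta>))"

definition rescaled_density :: "real \<Rightarrow> nat \<Rightarrow> complex \<Rightarrow> real" where
  "rescaled_density \<theta> N \<zeta> = (\<Sum>j<N. cmod \<zeta> ^ (2 * j) * boltzmann_weight N (Q N) \<zeta> /
     (2 / N * quad.tilted_mass N ((real j + 1) / N))) / (scaling \<theta> N)\<^sup>2"

lemma eventually_laplacian_middle_pos: "\<forall>\<^sub>F N in sequentially. laplacian (Q N) (middle_point (r N) \<theta>) > 0"
proof -
  have "\<forall>\<^sub>F N in sequentially. laplacian (Q N) (middle_point (r N) \<theta>) / L N > 0"
    using laplacian_middle_tendsto by (rule order_tendstoD) simp
  then show ?thesis using eventually_laplacian_one_pos by eventually_elim (simp add: zero_less_divide_iff)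
qed

lemma eventually_scaling_pos: "\<forall>\<^sub>F N in sequentially. scaling \<theta> N > 0"
  using eventually_laplacian_middle_pos[of \<theta>] eventually_laplacian_one_pos by eventually_elim (simp add: scaling_def)

lemma scaling_tendsto: "(\<lambda>N. real N / scaling \<theta> N) \<longlonglongrightarrow> \<rho>"
proof -
  let ?l = "\<lambda>N. laplacian (Q N) (middle_point (r N) \<theta>)"
  have "(\<lambda>N. sqrt (real N / L N / (?l N / L N))) \<longlonglongrightarrow> sqrt (\<rho>\<^sup>2 / 1)"
    by (intro tendsto_intros N_over_L_tendsto laplacian_middle_tendsto) simp
  moreover have "\<forall>\<^sub>F N in sequentially. sqrt (real N / L N / (?l N / L N)) = real N / scaling \<theta> N"
    using eventually_laplacian_middle_pos[of \<theta>] eventually_laplacian_one_pos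
  proof eventually_elim
    case (elim N)
    have "real N / L N / (?l N / L N) = real N / ?l N" using elim by simp
    also have "\<dots> = (real N)\<^sup>2 / (real N * ?l N)" using elim by (simp add: power2_eq_square)
    finally show ?case by (simp add: scaling_def real_sqrt_divide)
  qed
  ultimately show ?thesis using rho_pos Lim_transform_eventually by fastforce
qed

text \<open>At the preimage of the origin under the rescaling the limit exists as well, and is zero, although the
  potential is not prescribed there. Elsewhere the density is continuous.\<close>

lemma one_point_function_limits:
  defines "z \<equiv> \<lambda>\<theta> N j \<zeta>. - \<i> * cis (- \<theta>) * of_real (scaling \<theta> N) * (\<zeta> j - middle_point (r N) \<theta>)"
  shows "\<forall>\<^sub>F N in sequentially. \<forall>w.
     (scaled_mean_count (gibbs N (Q N)) N (z \<theta> N) w \<longlongrightarrow> one_point_function (gibbs N (Q N)) N (z \<theta> N) w) (at_right 0) \<and>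
     (middle_point (r N) \<theta> + w / (- \<i> * cis (- \<theta>) * of_real (scaling \<theta> N)) \<noteq> 0 \<longrightarrow>
       one_point_function (gibbs N (Q N)) N (z \<theta> N) w =
       rescaled_density \<theta> N (middle_point (r N) \<theta> + w / (- \<i> * cis (- \<theta>) * of_real (scaling \<theta> N))))"
proof -
  obtain c where c: "c > 0" "\<forall>\<^sub>F N in sequentially. \<forall>a\<in>{0..1}. c \<le> quad.tilted_mass N a" by (rule quad.tilted_mass_lower_bound)
  show ?thesis
    using eventually_laplacian_one_pos eventually_scaling_pos[of \<theta>] quad.integrable_tilted_mass c(2)
  proof eventually_elim
    case (elim N)
    have N: "N \<ge> 1" "N > 0" using elim(1) by auto
    note circN = circ[OF N(1)]
    define \<alpha> where "\<alpha> = - \<i> * cis (- \<theta>) * of_real (scaling \<theta> N)"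
    have \<alpha>: "\<alpha> \<noteq> 0" "cmod \<alpha> = scaling \<theta> N" using elim(2) by (auto simp: \<alpha>_def norm_mult)
    define h where "h j = 2 / N * quad.tilted_mass N ((real j + 1) / N)" for j
    have aj: "(real j + 1) / N \<in> {0..1}" if "j < N" for j using that by (auto simp: field_simps)
    have hpos: "h j > 0" if "j < N" for j
      using elim(4)[rule_format, OF aj[OF that]] c(1) N by (simp add: h_def)
    have ij: "integrable lborel (\<lambda>y. exp (- log_profile N (g N) y + 2 * (1 - (real j + 1) / N) * y))" if "j < N" for j
      using elim(3) aj[OF that] by blast
    have im: "integrable area (\<lambda>z. cmod z ^ (2 * j) * boltzmann_weight N (Q N) z)" if "j < N" for j
      by (rule integrable_monomial_weight[OF circN N(2) ij[OF that]])
    have hj: "h j = (\<integral>z. cmod z ^ (2 * j) * boltzmann_weight N (Q N) z \<partial>area)" if "j < N" for j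
      unfolding integral_monomial_weight[OF circN N(2) ij[OF that]] h_def quad.tilted_mass_def ..
    let ?K = "\<lambda>z. \<Sum>j<N. cmod z ^ (2 * j) * boltzmann_weight N (Q N) z / h j"
    have smc: "(scaled_mean_count (gibbs N (Q N)) N (z \<theta> N) w \<longlongrightarrow> l / (scaling \<theta> N)\<^sup>2) (at_right 0)"
      if "(?K \<longlongrightarrow> l) (at (middle_point (r N) \<theta> + w / \<alpha>))" for w l
    proof -
      have "z \<theta> N = (\<lambda>j \<zeta>. \<alpha> * (\<zeta> j - middle_point (r N) \<theta>))" by (simp add: z_def \<alpha>_def)
      moreover have "(scaled_mean_count (gibbs N (Q N)) N (\<lambda>j \<zeta>. \<alpha> * (\<zeta> j - middle_point (r N) \<theta>)) w \<longlongrightarrow> l / (cmod \<alpha>)\<^sup>2) (at_right 0)"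
        by (rule scaled_mean_count_tendsto[OF N(2) almost_circular_W_not_MInf[OF circN] almost_circular_W_measurable[OF circN]
              _ _ _ _ \<alpha>(1) that]; (rule almost_circular_W_rotation[OF circN] im hj hpos; assumption))
      ultimately show ?thesis unfolding \<alpha>(2) by (simp only:)
    qed
    have val: "one_point_function (gibbs N (Q N)) N (z \<theta> N) w = l / (scaling \<theta> N)\<^sup>2"
      if "(?K \<longlongrightarrow> l) (at (middle_point (r N) \<theta> + w / \<alpha>))" for w l
      unfolding one_point_function_def by (rule tendsto_Lim[OF _ smc[OF that]]) simp
    show ?case unfolding \<alpha>_def[symmetric]
    proof
      fix w
      define \<zeta> where "\<zeta> = middle_point (r N) \<theta> + w / \<alpha>"
      show "(scaled_mean_count (gibbs N (Q N)) N (z \<theta> N) w \<longlongrightarrow> one_point_function (gibbs N (Q N)) N (z \<theta> N) w) (at_right 0) \<and>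
        (middle_point (r N) \<theta> + w / \<alpha> \<noteq> 0 \<longrightarrow>
          one_point_function (gibbs N (Q N)) N (z \<theta> N) w = rescaled_density \<theta> N (middle_point (r N) \<theta> + w / \<alpha>))"
      proof (cases "\<zeta> = 0")
        case True
        have "(?K \<longlongrightarrow> (\<Sum>j<N. cmod 0 ^ (2 * j) * 0 / h j)) (at \<zeta>)"
          unfolding True using hpos
          by (intro tendsto_sum tendsto_divide tendsto_mult tendsto_power tendsto_norm tendsto_ident_at tendsto_const
              boltzmann_weight_tendsto_0[OF circN N(2)]) force
        then have "(?K \<longlongrightarrow> (\<Sum>j<N. cmod 0 ^ (2 * j) * 0 / h j)) (at (middle_point (r N) \<theta> + w / \<alpha>))" unfolding \<zeta>_def .
        from smc[OF this] val[OF this] True show ?thesis unfolding \<zeta>_def by (simp only:) simp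
      next
        case False
        have "(?K \<longlongrightarrow> ?K \<zeta>) (at \<zeta>)" using hpos
          by (intro tendsto_sum tendsto_divide tendsto_mult tendsto_power tendsto_norm tendsto_ident_at tendsto_const
              boltzmann_weight_tendsto[OF circN False]) force
        then have "(?K \<longlongrightarrow> ?K \<zeta>) (at (middle_point (r N) \<theta> + w / \<alpha>))" unfolding \<zeta>_def .
        note lim = smc[OF this] val[OF this]
        have "?K \<zeta> / (scaling \<theta> N)\<^sup>2 = rescaled_density \<theta> N \<zeta>" by (simp only: rescaled_density_def h_def)
        with lim show ?thesis unfolding \<zeta>_def[symmetric] by simp
      qed
    qed
  qed
qed

lemma rescaled_density_log_profile:
  assumes N: "N \<ge> 1" and \<zeta>: "\<zeta> \<noteq> 0" and y: "y = - (real N * ln (cmod \<zeta>))"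
  shows "rescaled_density \<theta> N \<zeta> = (real N / scaling \<theta> N)\<^sup>2 * exp (2 * y / N) / 2 *
    ((\<Sum>j<N. exp (- log_profile N (g N) y + 2 * (1 - (real j + 1) / N) * y) / quad.tilted_mass N ((real j + 1) / N)) / N)"
proof -
  let ?T = "\<lambda>j. exp (- log_profile N (g N) y + 2 * (1 - (real j + 1) / N) * y)"
  have N': "N > 0" using N by simp
  have "cmod \<zeta> ^ (2 * j) * boltzmann_weight N (Q N) \<zeta> / (2 / N * quad.tilted_mass N ((real j + 1) / N)) =
      real N * exp (2 * y / N) / 2 * (?T j / quad.tilted_mass N ((real j + 1) / N))" for j
    unfolding monomial_weight_log_profile[OF circ[OF N] N' \<zeta> y] by simp
  then have "rescaled_density \<theta> N \<zeta> = (\<Sum>j<N. real N * exp (2 * y / N) / 2 * (?T j / quad.tilted_mass N ((real j + 1) / N))) / (scaling \<theta> N)\<^sup>2"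
    unfolding rescaled_density_def by (simp only:)
  also have "\<dots> = real N * exp (2 * y / N) / 2 * (\<Sum>j<N. ?T j / quad.tilted_mass N ((real j + 1) / N)) / (scaling \<theta> N)\<^sup>2"
    by (simp only: sum_distrib_left)
  also have "real N * exp (2 * y / N) / 2 * S / (scaling \<theta> N)\<^sup>2 = (real N / scaling \<theta> N)\<^sup>2 * exp (2 * y / N) / 2 * (S / N)" for S
    using N' by (simp add: power2_eq_square)
  finally show ?thesis .
qed

text \<open>In logarithmic coordinates the point with rescaled coordinate \<open>w\<close> converges to
  \<open>\<rho>\<^sup>2 / 4 + \<rho> Im w0\<close>, where \<open>\<rho>\<^sup>2 / 4\<close> comes from the middle radius.\<close>

lemma rescaled_density_tendsto:
  fixes w :: "nat \<Rightarrow> complex" and \<theta> :: real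
  assumes w: "w \<longlonglongrightarrow> w0"
  defines "\<zeta> \<equiv> \<lambda>N. middle_point (r N) \<theta> + w N / (- \<i> * cis (- \<theta>) * of_real (scaling \<theta> N))"
  shows "\<forall>\<^sub>F N in sequentially. \<zeta> N \<noteq> 0"
    and "(\<lambda>N. rescaled_density \<theta> N (\<zeta> N)) \<longlonglongrightarrow> limit_profile (\<rho> / 4) (2 * Im w0)"
proof -
  define q where "q N = of_real (real N * (m N - 1)) + \<i> * w N * of_real (real N / scaling \<theta> N)" for N
  have q: "q \<longlonglongrightarrow> of_real (- \<rho>\<^sup>2 / 4) + \<i> * w0 * of_real \<rho>"
    unfolding q_def by (intro tendsto_intros middle_tendsto scaling_tendsto w)
  have \<zeta>q: "\<forall>\<^sub>F N in sequentially. \<zeta> N = cis \<theta> * (1 + q N / of_nat N)"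
    using eventually_laplacian_one_pos eventually_scaling_pos[of \<theta>]
  proof eventually_elim
    case (elim N)
    have cc: "cis \<theta> * cis (- \<theta>) = 1" by (simp add: cis_mult)
    have nz: "- \<i> * cis (- \<theta>) * of_real (scaling \<theta> N) \<noteq> 0" using elim by simp
    have wN: "w N / (- \<i> * cis (- \<theta>) * of_real (scaling \<theta> N)) = cis \<theta> * (\<i> * w N / of_real (scaling \<theta> N))"
    proof -
      have "cis \<theta> * (\<i> * w N / of_real (scaling \<theta> N)) * (- \<i> * cis (- \<theta>) * of_real (scaling \<theta> N)) =
          (cis \<theta> * cis (- \<theta>)) * w N * (\<i> * - \<i>)" using elim by (simp add: mult_ac)
      also have "\<dots> = w N" unfolding cc by simp
      finally show ?thesis using nz by (metis nonzero_mult_div_cancel_right)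
    qed
    have qN: "of_real (m N) + \<i> * w N / of_real (scaling \<theta> N) = 1 + q N / of_nat N"
    proof -
      have "q N / of_nat N = of_real (m N - 1) + \<i> * w N / of_real (scaling \<theta> N)"
        unfolding q_def using elim by (simp add: add_divide_distrib)
      then show ?thesis by (simp only: of_real_diff of_real_1) simp
    qed
    have "\<zeta> N = cis \<theta> * of_real (m N) + cis \<theta> * (\<i> * w N / of_real (scaling \<theta> N))"
      unfolding \<zeta>_def wN middle_point_def by (simp only: mult.commute)
    also have "\<dots> = cis \<theta> * (1 + q N / of_nat N)" unfolding distrib_left[symmetric] qN ..
    finally show ?case .
  qed
  have "(\<lambda>N. 1 / real N) \<longlonglongrightarrow> 0" by real_asymp
  from tendsto_add[OF tendsto_const[of 1] tendsto_mult[OF q tendsto_of_real[OF this]]]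
  have "(\<lambda>N. 1 + q N * of_real (1 / real N)) \<longlonglongrightarrow> 1" by simp
  then have "\<forall>\<^sub>F N in sequentially. 1 + q N * of_real (1 / real N) \<noteq> 0"
    by (rule tendsto_imp_eventually_ne) simp
  then show nz: "\<forall>\<^sub>F N in sequentially. \<zeta> N \<noteq> 0"
    using \<zeta>q by eventually_elim (simp add: cis_neq_zero)
  define y where "y N = - (real N * ln (cmod (\<zeta> N)))" for N
  let ?y0 = "\<rho>\<^sup>2 / 4 + \<rho> * Im w0"
  have "- Re (of_real (- \<rho>\<^sup>2 / 4) + \<i> * w0 * of_real \<rho>) = ?y0" by simp
  with tendsto_minus[OF ln_cmod_one_plus_tendsto[OF q]]
  have "(\<lambda>N. - (real N * ln (cmod (1 + q N / of_nat N)))) \<longlonglongrightarrow> ?y0" by (simp only:)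
  moreover have "\<forall>\<^sub>F N in sequentially. - (real N * ln (cmod (1 + q N / of_nat N))) = y N"
    using \<zeta>q by eventually_elim (simp add: y_def norm_mult)
  ultimately have y: "y \<longlonglongrightarrow> ?y0" by (rule Lim_transform_eventually)
  let ?S = "\<lambda>N. (\<Sum>j<N. exp (- log_profile N (g N) (y N) + 2 * (1 - (real j + 1) / N) * y N) / quad.tilted_mass N ((real j + 1) / N)) / N"
  let ?I = "integral {0..1} (\<lambda>u. sqrt ((4 / \<rho>\<^sup>2) / (2 * pi)) *
      exp (- ((4 / \<rho>\<^sup>2) * ?y0 - 2 * (1 - u))\<^sup>2 / (2 * (4 / \<rho>\<^sup>2))))"
  have S: "?S \<longlonglongrightarrow> ?I" by (rule quad.normalized_sum_tendsto[OF y])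
  have "(\<lambda>N. 1 / real N) \<longlonglongrightarrow> 0" by real_asymp
  from tendsto_mult[OF tendsto_mult[OF tendsto_const[of 2] y] this]
  have "(\<lambda>N. 2 * y N / N) \<longlonglongrightarrow> 0" by simp
  then have "(\<lambda>N. (real N / scaling \<theta> N)\<^sup>2 * exp (2 * y N / N) / 2 * ?S N) \<longlonglongrightarrow> \<rho>\<^sup>2 * exp 0 / 2 * ?I"
    by (intro tendsto_intros scaling_tendsto S) auto
  also have "\<rho>\<^sup>2 * exp 0 / 2 * ?I = limit_profile (\<rho> / 4) (2 * Im w0)"
    using limit_profile_eq_unit_integral[OF rho_pos, of "Im w0"] by (simp only: exp_zero mult_1_right)
  finally have "(\<lambda>N. (real N / scaling \<theta> N)\<^sup>2 * exp (2 * y N / N) / 2 * ?S N) \<longlonglongrightarrow> limit_profile (\<rho> / 4) (2 * Im w0)" .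
  moreover have "\<forall>\<^sub>F N in sequentially. (real N / scaling \<theta> N)\<^sup>2 * exp (2 * y N / N) / 2 * ?S N = rescaled_density \<theta> N (\<zeta> N)"
    using nz eventually_ge_at_top[of 1]
    by eventually_elim (rule rescaled_density_log_profile[symmetric], auto simp: y_def)
  ultimately show "(\<lambda>N. rescaled_density \<theta> N (\<zeta> N)) \<longlonglongrightarrow> limit_profile (\<rho> / 4) (2 * Im w0)"
    by (rule Lim_transform_eventually)
qed

end

theorem theorem1p9:
  fixes Q :: "nat \<Rightarrow> complex \<Rightarrow> ereal" and g :: "nat \<Rightarrow> real \<Rightarrow> real"
    and r :: "nat \<Rightarrow> real" and k \<rho> \<theta> :: real
  defines "p \<equiv> \<lambda>N. middle_point (r N) \<theta>"
  defines "z \<equiv> \<lambda>N j \<zeta>. - \<i> * cis (- \<theta>) *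
             of_real (sqrt (real N * laplacian (Q N) (p N))) * (\<zeta> j - p N)"
  defines "R \<equiv> \<lambda>N. one_point_function (gibbs N (Q N)) N (z N)"
  assumes "k > 1"
    and "\<And>N. N \<ge> 1 \<Longrightarrow> almost_circular k (Q N) (g N) (r N)"
    and "(\<lambda>N. sqrt (real N / laplacian (Q N) 1)) \<longlonglongrightarrow> \<rho>" and "\<rho> > 0"
    and "(\<lambda>N. r N - (1 - \<rho>\<^sup>2 / (2 * real N))) \<in> o(\<lambda>N. 1 / real N)"
    and regular: "\<And>C \<epsilon>. C > 0 \<Longrightarrow> \<epsilon> > 0 \<Longrightarrow>
           \<forall>\<^sub>F N in sequentially. AE s in lborel. \<bar>s - 1\<bar> \<le> C / real N \<longrightarrow>
             \<bar>laplacian (Q N) (of_real s) / laplacian (Q N) 1 - 1\<bar> \<le> \<epsilon>"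
    and "\<theta> \<in> {0..2 * pi}"
  shows "(\<forall>\<^sub>F N in sequentially. \<forall>w.
            (scaled_mean_count (gibbs N (Q N)) N (z N) w \<longlongrightarrow> R N w) (at_right 0)) \<and>
         (\<forall>K. compact K \<longrightarrow>
            uniform_limit K R (\<lambda>w. limit_profile (\<rho> / 4) (2 * Im w)) sequentially)"
proof -
  interpret almost_circular_sequence Q g r k \<rho>
    by unfold_locales (fact assms)+
  have z: "z N = (\<lambda>j \<zeta>. - \<i> * cis (- \<theta>) * of_real (scaling \<theta> N) * (\<zeta> j - middle_point (r N) \<theta>))" for N
    by (simp add: z_def p_def scaling_def)
  let ?\<zeta> = "\<lambda>N w. middle_point (r N) \<theta> + w / (- \<i> * cis (- \<theta>) * of_real (scaling \<theta> N))"
  have lims: "\<forall>\<^sub>F N in sequentially. \<forall>w.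
     (scaled_mean_count (gibbs N (Q N)) N (z N) w \<longlongrightarrow> R N w) (at_right 0) \<and>
     (?\<zeta> N w \<noteq> 0 \<longrightarrow> R N w = rescaled_density \<theta> N (?\<zeta> N w))"
    unfolding R_def z by (rule one_point_function_limits)
  show ?thesis
  proof (intro conjI allI impI)
    show "\<forall>\<^sub>F N in sequentially. \<forall>w. (scaled_mean_count (gibbs N (Q N)) N (z N) w \<longlongrightarrow> R N w) (at_right 0)"
      using lims by eventually_elim blast
    fix K :: "complex set" assume K: "compact K"
    show "uniform_limit K R (\<lambda>w. limit_profile (\<rho> / 4) (2 * Im w)) sequentially"
    proof (rule uniform_limit_compactI[OF K])
      show "continuous_on K (\<lambda>w. limit_profile (\<rho> / 4) (2 * Im w))"
        by (intro continuous_on_compose2[OF continuous_on_limit_profile[of UNIV]] continuous_intros) auto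
      fix w :: "nat \<Rightarrow> complex" and w0 assume w: "w \<longlonglongrightarrow> w0"
      have "\<forall>\<^sub>F N in sequentially. rescaled_density \<theta> N (?\<zeta> N (w N)) = R N (w N)"
        using lims rescaled_density_tendsto(1)[OF w, of \<theta>] by eventually_elim simp
      then show "(\<lambda>N. R N (w N)) \<longlonglongrightarrow> limit_profile (\<rho> / 4) (2 * Im w0)"
        by (rule Lim_transform_eventually[OF rescaled_density_tendsto(2)[OF w]])
    qed
  qed
qed

end
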